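(* Assume the Setting and Constants below, and suppose that $(L_g,L_c)$ satisfies the smallness condition $(S_n)$. Then there exist a $C^n$ map $K:X_c\to X$ and a $C^n$ map $R=A_c+r:X_c\to X_c$ such that $$(A+g)\circ K=K\circ(A_c+r),$$ and moreover: (A) $R=A_c+r$ is globally invertible with inverse $T=A_c^{-1}+t$, where $r,t\in C^n_b(X_c,X_c)$, $r(0)=0$, $Dr(0)=0$, $\|Dr\|_0\le L_r$, and $t(0)=0$, $Dt(0)=0$, $\|Dt\|_0\le L_t$; (B) $K=\iota+(k_c,k_u,k_s)$, i.e. $K(x)=(x+k_c(x))+k_u(x)+k_s(x)$, where $k_u\in C^n_b(X_c,X_u)$ with $k_u(0)=0$, $Dk_u(0)=0$, $\|Dk_u\|_0\le L_u$, and $k_s\in C^n_b(X_c,X_s)$ with $k_s(0)=0$, $Dk_s(0)=0$, $\|Dk_s\|_0\le L_s$.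
   Context: Notation. For Banach spaces $Y,Z$, $\mathcal L(Y,Z)$ is the space of bounded linear maps with the operator norm and $\mathcal L^k(Y,Z)$ the space of bounded $k$-linear maps $Y^k\to Z$ with norm $\sup_{\|y_i\|\le1}\|B(y_1,\dots,y_k)\|$. For $k\ge0$, $C^k_b(Y,Z)$ is the Banach space of $C^k$ maps $f:Y\to Z$ with $\|f\|_k:=\max_{0\le j\le k}\sup_{y\in Y}\|D^jf(y)\|<\infty$ (operator norms on derivatives). Setting. Let $n\ge2$ be an integer and $X$ a Banach space with $X=X_c\oplus X_u\oplus X_s$ for closed subspaces, whose norm satisfies $\|x\|=\max\{\|x_c\|,\|x_u\|,\|x_s\|\}$ for $x=x_c+x_u+x_s$. Let $A\in\mathcal L(X,X)$ leave $X_c,X_u,X_s$ invariant, with restrictions $A_c,A_u,A_s$; assume $A_c$ and $A_u$ are invertible and $\|A_c^{-1}\|^{\tilde n}\|A_s\|<1$ and $\|A_u^{-1}\|\,\|A_c\|^{\tilde n}<1$ for all $1\le\tilde n\le n$. Let $L_g,L_c\ge0$. Let $F=A+g:X\to X$ where $A=DF(0)$, $g\in C^n_b(X,X)$, $g(0)=0$, $Dg(0)=0$, $\|Dg\|_0\le L_g$. Let $k_c\in C^n_b(X_c,X_c)$ with $k_c(0)=0$, $Dk_c(0)=0$, $\|Dk_c\|_0\le L_c$. $\iota:X_c\to X$ is the inclusion. Constants. $L_r:=\frac{L_g+L_c(2\|A_c\|+L_g)}{1-L_c}$, $L_t:=\frac{\|A_c^{-1}\|^2L_r}{1-\|A_c^{-1}\|L_r}$,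 $L_u:=\frac{\|A_u^{-1}\|(1+L_c)L_g}{1-L_r\|A_u^{-1}\|-\|A_c\|\|A_u^{-1}\|}$, $L_s:=\frac{\|A_c^{-1}\|(1+L_c)L_g}{1-L_r\|A_c^{-1}\|-\|A_s\|\|A_c^{-1}\|}$, $L_{-1}:=\|A_c^{-1}\|+L_t$, and for integers $\tilde n\ge0$: $\theta_{\tilde n,1}:=L_g+L_c$, $\theta_{\tilde n,2}:=\|A_u^{-1}\|\big((\|A_c\|+L_r)^{\tilde n}+L_g+L_u\big)$, $\theta_{\tilde n,3}:=L_{-1}^{\tilde n}\big(\|A_s\|(1+L_{-1}L_s)+L_g(1+L_{-1}(1+L_c))\big)$. For an integer $N\ge0$, $(L_g,L_c)$ satisfies the smallness condition $(S_N)$ if $L_c<1$, $L_r\|A_c^{-1}\|<1$, $L_r\|A_u^{-1}\|+\|A_c\|\|A_u^{-1}\|<1$, $L_r\|A_c^{-1}\|+\|A_s\|\|A_c^{-1}\|<1$, and $\theta_{\tilde n,i}<1$ for $i=1,2,3$ and all $0\le\tilde n\le N$. *)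

theory Defs
  imports "HOL-Analysis.Analysis"
begin

text \<open>A k-linear map on a subspace S is represented as a function on lists of
  length k; only lists with all entries in S matter.\<close>

definition mlin_on :: "'a::real_vector set \<Rightarrow> nat \<Rightarrow> ('a list \<Rightarrow> 'b::real_vector) \<Rightarrow> bool" where
  "mlin_on S k B \<longleftrightarrow>
     (\<forall>vs i u w a. length vs = k \<and> set vs \<subseteq> S \<and> i < k \<and> u \<in> S \<and> w \<in> S \<longrightarrow>
        B (vs[i := a *\<^sub>R u + w]) = a *\<^sub>R B (vs[i := u]) + B (vs[i := w]))"

definition unit_lists :: "'a::real_normed_vector set \<Rightarrow> nat \<Rightarrow> 'a list set" where
  "unit_lists S k = {vs. length vs = k \<and> set vs \<subseteq> S \<and> (\<forall>v\<in>set vs. norm v \<le> 1)}"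

definition mnorm :: "'a::real_normed_vector set \<Rightarrow> nat \<Rightarrow> ('a list \<Rightarrow> 'b::real_normed_vector) \<Rightarrow> real" where
  "mnorm S k B = Sup ((\<lambda>vs. norm (B vs)) ` unit_lists S k)"

definition mbounded :: "'a::real_normed_vector set \<Rightarrow> nat \<Rightarrow> ('a list \<Rightarrow> 'b::real_normed_vector) \<Rightarrow> bool" where
  "mbounded S k B \<longleftrightarrow> bdd_above ((\<lambda>vs. norm (B vs)) ` unit_lists S k)"

definition onorm_on :: "'a::real_normed_vector set \<Rightarrow> ('a \<Rightarrow> 'b::real_normed_vector) \<Rightarrow> real" where
  "onorm_on S f = mnorm S 1 (\<lambda>vs. f (hd vs))"

text \<open>Cn_on n S T f D: f maps the subspace S into T, is n times continuously
  Frechet differentiable on S, and D j x is its j-th derivative at x (a bounded j-linear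
  map on S, with D (Suc j) x (h # vs) the derivative of D j in direction h).\<close>
definition Cn_on :: "nat \<Rightarrow> 'a::real_normed_vector set \<Rightarrow> 'b::real_normed_vector set \<Rightarrow>
    ('a \<Rightarrow> 'b) \<Rightarrow> (nat \<Rightarrow> 'a \<Rightarrow> 'a list \<Rightarrow> 'b) \<Rightarrow> bool" where
  "Cn_on n S T f D \<longleftrightarrow>
     (\<forall>x\<in>S. f x \<in> T) \<and>
     (\<forall>x\<in>S. D 0 x [] = f x) \<and>
     (\<forall>j\<le>n. \<forall>x\<in>S. mlin_on S j (D j x) \<and> mbounded S j (D j x)) \<and>
     (\<forall>j<n. \<forall>x\<in>S.
        ((\<lambda>y. mnorm S j (\<lambda>vs. D j y vs - D j x vs - D (Suc j) x ((y - x) # vs)) / norm (y - x))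
          \<longlongrightarrow> 0) (at x within S)) \<and>
     (\<forall>x\<in>S. ((\<lambda>y. mnorm S n (\<lambda>vs. D n y vs - D n x vs)) \<longlongrightarrow> 0) (at x within S))"

definition Cnb_on :: "nat \<Rightarrow> 'a::real_normed_vector set \<Rightarrow> 'b::real_normed_vector set \<Rightarrow>
    ('a \<Rightarrow> 'b) \<Rightarrow> (nat \<Rightarrow> 'a \<Rightarrow> 'a list \<Rightarrow> 'b) \<Rightarrow> bool" where
  "Cnb_on n S T f D \<longleftrightarrow> Cn_on n S T f D \<and>
     (\<forall>j\<le>n. bdd_above ((\<lambda>x. mnorm S j (D j x)) ` S))"

definition small_Cnb :: "nat \<Rightarrow> 'a::real_normed_vector set \<Rightarrow> 'b::real_normed_vector set \<Rightarrow>
    ('a \<Rightarrow> 'b) \<Rightarrow> real \<Rightarrow> bool" where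
  "small_Cnb n S T f L \<longleftrightarrow> (\<exists>D. Cnb_on n S T f D \<and> f 0 = 0 \<and>
     (\<forall>v\<in>S. D 1 0 [v] = 0) \<and> (\<forall>x\<in>S. mnorm S 1 (D 1 x) \<le> L))"

section \<open>Constants (ac = ||A_c||, aci = ||A_c^-1||, aui = ||A_u^-1||, as = ||A_s||)\<close>

definition cLr :: "real \<Rightarrow> real \<Rightarrow> real \<Rightarrow> real" where
  "cLr ac Lg Lc = (Lg + Lc * (2 * ac + Lg)) / (1 - Lc)"

definition cLt :: "real \<Rightarrow> real \<Rightarrow> real \<Rightarrow> real \<Rightarrow> real" where
  "cLt ac aci Lg Lc = aci ^ 2 * cLr ac Lg Lc / (1 - aci * cLr ac Lg Lc)"

definition cLu :: "real \<Rightarrow> real \<Rightarrow> real \<Rightarrow> real \<Rightarrow> real" where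
  "cLu ac aui Lg Lc = aui * (1 + Lc) * Lg / (1 - cLr ac Lg Lc * aui - ac * aui)"

definition cLs :: "real \<Rightarrow> real \<Rightarrow> real \<Rightarrow> real \<Rightarrow> real \<Rightarrow> real" where
  "cLs ac aci as Lg Lc = aci * (1 + Lc) * Lg / (1 - cLr ac Lg Lc * aci - as * aci)"

definition cLm1 :: "real \<Rightarrow> real \<Rightarrow> real \<Rightarrow> real \<Rightarrow> real" where
  "cLm1 ac aci Lg Lc = aci + cLt ac aci Lg Lc"

definition theta1 :: "nat \<Rightarrow> real \<Rightarrow> real \<Rightarrow> real" where
  "theta1 m Lg Lc = Lg + Lc"

definition theta2 :: "nat \<Rightarrow> real \<Rightarrow> real \<Rightarrow> real \<Rightarrow> real \<Rightarrow> real" where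
  "theta2 m ac aui Lg Lc = aui * ((ac + cLr ac Lg Lc) ^ m + Lg + cLu ac aui Lg Lc)"

definition theta3 :: "nat \<Rightarrow> real \<Rightarrow> real \<Rightarrow> real \<Rightarrow> real \<Rightarrow> real \<Rightarrow> real" where
  "theta3 m ac aci as Lg Lc =
     cLm1 ac aci Lg Lc ^ m *
       (as * (1 + cLm1 ac aci Lg Lc * cLs ac aci as Lg Lc)
        + Lg * (1 + cLm1 ac aci Lg Lc * (1 + Lc)))"

definition smallness :: "nat \<Rightarrow> real \<Rightarrow> real \<Rightarrow> real \<Rightarrow> real \<Rightarrow> real \<Rightarrow> real \<Rightarrow> bool" where
  "smallness N ac aci aui as Lg Lc \<longleftrightarrow>
     Lc < 1 \<and> cLr ac Lg Lc * aci < 1 \<and>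
     cLr ac Lg Lc * aui + ac * aui < 1 \<and>
     cLr ac Lg Lc * aci + as * aci < 1 \<and>
     (\<forall>m\<le>N. theta1 m Lg Lc < 1 \<and> theta2 m ac aui Lg Lc < 1 \<and> theta3 m ac aci as Lg Lc < 1)"

end

theory Submission
  imports Defs
begin

text \<open>Every function on the subspace of centre directions is precomposed with the projection
  onto it, so that all maps live on the whole space. Starting from zero, one iterates
  r \<mapsto> A kc + pc g K - kc R, t \<mapsto> - Ac^-1 r T, u \<mapsto> Au^-1 (u R - pu g K) and s \<mapsto> A s T + ps g K T, where
  R = Ac + r, T = Ac^-1 + t and K = id + kc + u + s; this contracts the sup norm. Since T is an
  unknown of its own, no inverse function is ever differentiated.

  In the chain rule of order j, only the terms containing a derivative of order j of an unknown
  matter, and their coefficients are contracted by the theta constants of order j. For sup norms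
  modulo constants this yields uniform bounds of the j-th derivatives along the iteration. The
  same estimate for the limit superior of the distance of the j-th derivatives of the m-th iterate
  at y and the l-th iterate at z, as m, l tend to infinity and y, z to x, shows that this
  oscillation vanishes. Hence the derivatives converge continuously at every point, although the
  highest derivative of g need not be uniformly continuous.\<close>

section \<open>The Banach space of multilinear maps of all orders\<close>

text \<open>The four maps come from projecting the conjugacy equation. Its centre component, solved
  for R, gives r; its unstable component is solved for u by inverting Au; its stable component A s +
  ps g K = s R is composed with T from the right, since As need not be invertible; and R T = id,
  solved for T, gives t. So a fixed point yields only a right inverse of R; that T is also a left
  inverse follows because R is injective for \<open>aci * lr < 1\<close>.

  So sizes of derivatives are estimated along the whole sequence and at moving points, lower orders
  being settled first.

  theta3 is the coefficient of the stable equation after t has been eliminated: if D^j r has size 1,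
  the equation d = aci (a^j + lr d) for the size d of D^j t has the solution a^(j+1), because a =
  aci / (1 - aci lr). Inserting it gives a^j (as + lg) + a^(j+1) (as ls + lg (1 + lc)), which is
  theta3.\<close>

definition pnorm :: "'a::real_normed_vector list \<Rightarrow> real"
  where "pnorm vs = prod_list (map norm vs)"

lemma pnorm_Nil [simp]: "pnorm [] = 1"
  and pnorm_Cons [simp]: "pnorm (v # vs) = norm v * pnorm vs"
  by (simp_all add: pnorm_def)

lemma pnorm_nonneg [simp]: "0 \<le> pnorm vs"
  by (induction vs) auto

lemma pnorm_le_1: "(\<And>v. v \<in> set vs \<Longrightarrow> norm v \<le> 1) \<Longrightarrow> pnorm vs \<le> 1"
  by (induction vs) (auto intro!: mult_le_one)

text \<open>A list with a zero entry contributes 0 by the convention on division, in accordance with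
  multilinearity. All lengths enter one supremum, so the norm of a family is the supremum of the
  norms of its homogeneous components.\<close>

definition msup :: "('a::real_normed_vector list \<Rightarrow> 'b::real_normed_vector) \<Rightarrow> real"
  where "msup w = (SUP vs. norm (w vs) / pnorm vs)"

lemma msup_bound:
  assumes "0 \<le> C" "\<And>vs. norm (w vs) \<le> C * pnorm vs"
  shows "msup w \<le> C"
  unfolding msup_def
proof (rule cSUP_least)
  fix vs :: "'a list"
  show "norm (w vs) / pnorm vs \<le> C"
    using assms(2)[of vs] assms(1) pnorm_nonneg[of vs]
    by (cases "pnorm vs = 0") (simp_all add: divide_le_eq less_le)
qed simp

lemma msup_upper:
  assumes "\<exists>C. \<forall>vs. norm (w vs) \<le> C * pnorm vs"
  shows "norm (w vs) \<le> msup w * pnorm vs" "0 \<le> msup w"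
proof -
  obtain C where C: "\<And>vs. norm (w vs) \<le> C * pnorm vs" using assms by blast
  have "norm (w []) \<le> C" using C[of "[]"] by simp
  then have C0: "0 \<le> C" using norm_ge_zero order_trans by blast
  have q: "norm (w vs) / pnorm vs \<le> C" for vs
    using C[of vs] C0 pnorm_nonneg[of vs]
    by (cases "pnorm vs = 0") (simp_all add: divide_le_eq less_le)
  have "bdd_above (range (\<lambda>vs. norm (w vs) / pnorm vs))"
    using q by (intro bdd_aboveI[of _ C]) auto
  then have u: "norm (w vs) / pnorm vs \<le> msup w" for vs
    unfolding msup_def by (intro cSUP_upper) auto
  \<comment> \<open>For \<open>pnorm vs = 0\<close> the quotient carries no information; then the
    bound by \<open>C\<close> forces \<open>w vs = 0\<close>.\<close>
  show "norm (w vs) \<le> msup w * pnorm vs"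
    using u[of vs] C[of vs] pnorm_nonneg[of vs]
    by (cases "pnorm vs = 0") (simp_all add: divide_le_eq less_le)
  have "0 \<le> norm (w []) / pnorm []" by simp
  then show "0 \<le> msup w" using u[of "[]"] order_trans by blast
qed

text \<open>Multilinear maps of all orders form one Banach space, so the derivative of a
  multilin-valued function is again multilin-valued, and the order of differentiability can vary
  in an induction.\<close>

typedef (overloaded) ('a, 'b) multilin =
  "{w :: 'a::real_normed_vector list \<Rightarrow> 'b::real_normed_vector.
     (\<forall>xs ys u v a. w (xs @ (a *\<^sub>R u + v) # ys) = a *\<^sub>R w (xs @ u # ys) + w (xs @ v # ys)) \<and>
     (\<exists>C. \<forall>vs. norm (w vs) \<le> C * pnorm vs)}"
  morphisms mapp Multilin
  by (rule exI[of _ "\<lambda>_. 0"]) (auto intro: exI[of _ 0])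

setup_lifting type_definition_multilin

lemma multilin_eqI: "(\<And>vs. mapp w vs = mapp w' vs) \<Longrightarrow> w = w'"
  by transfer auto

lemma mapp_lin: "mapp w (xs @ (a *\<^sub>R u + v) # ys) = a *\<^sub>R mapp w (xs @ u # ys) + mapp w (xs @ v # ys)"
  by transfer auto

lemma mapp_add: "mapp w (xs @ (u + v) # ys) = mapp w (xs @ u # ys) + mapp w (xs @ v # ys)"
  using mapp_lin[of w xs 1 u v ys] by simp

lemma mapp_zero: "mapp w (xs @ 0 # ys) = 0"
  using mapp_add[of w xs 0 0 ys] by simp

lemma mapp_scaleR: "mapp w (xs @ (a *\<^sub>R u) # ys) = a *\<^sub>R mapp w (xs @ u # ys)"
  using mapp_lin[of w xs a u 0 ys] mapp_zero[of w xs ys] by simp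

lemmas mapp_lin_hd = mapp_add[of _ "[]", simplified] mapp_scaleR[of _ "[]", simplified]
  mapp_zero[of _ "[]", simplified]

instantiation multilin :: (real_normed_vector, real_normed_vector) real_normed_vector
begin

lift_definition norm_multilin :: "('a, 'b) multilin \<Rightarrow> real" is msup .

lift_definition minus_multilin :: "('a, 'b) multilin \<Rightarrow> ('a, 'b) multilin \<Rightarrow> ('a, 'b) multilin"
  is "\<lambda>f g vs. f vs - g vs"
proof (intro conjI allI, goal_cases)
  case (1 f g xs ys u v a)
  then show ?case by (simp add: algebra_simps)
next
  case (2 f g)
  then obtain C D where "\<And>vs. norm (f vs) \<le> C * pnorm vs" "\<And>vs. norm (g vs) \<le> D * pnorm vs" by blast
  then have "norm (f vs - g vs) \<le> (C + D) * pnorm vs" for vs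
    using norm_triangle_ineq4[of "f vs" "g vs"] by (smt (verit) distrib_right)
  then show ?case by blast
qed

lift_definition plus_multilin :: "('a, 'b) multilin \<Rightarrow> ('a, 'b) multilin \<Rightarrow> ('a, 'b) multilin"
  is "\<lambda>f g vs. f vs + g vs"
proof (intro conjI allI, goal_cases)
  case (1 f g xs ys u v a)
  then show ?case by (simp add: algebra_simps)
next
  case (2 f g)
  then obtain C D where "\<And>vs. norm (f vs) \<le> C * pnorm vs" "\<And>vs. norm (g vs) \<le> D * pnorm vs" by blast
  then have "norm (f vs + g vs) \<le> (C + D) * pnorm vs" for vs
    using norm_triangle_ineq[of "f vs" "g vs"] by (smt (verit) distrib_right)
  then show ?case by blast
qed

lift_definition scaleR_multilin :: "real \<Rightarrow> ('a, 'b) multilin \<Rightarrow> ('a, 'b) multilin"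
  is "\<lambda>r f vs. r *\<^sub>R f vs"
proof (intro conjI allI, goal_cases)
  case (1 r f xs ys u v a)
  then show ?case by (simp add: algebra_simps)
next
  case (2 r f)
  then obtain C where "\<And>vs. norm (f vs) \<le> C * pnorm vs" by blast
  then have "norm (r *\<^sub>R f vs) \<le> (\<bar>r\<bar> * C) * pnorm vs" for vs
    by (simp add: mult.assoc mult_left_mono)
  then show ?case by blast
qed

lift_definition uminus_multilin :: "('a, 'b) multilin \<Rightarrow> ('a, 'b) multilin"
  is "\<lambda>f vs. - f vs"
  by (auto simp: algebra_simps)

lift_definition zero_multilin :: "('a, 'b) multilin" is "\<lambda>vs. 0"
  by (auto intro: exI[of _ 0])

definition dist_multilin :: "('a, 'b) multilin \<Rightarrow> ('a, 'b) multilin \<Rightarrow> real"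
  where "dist_multilin a b = norm (a - b)"

definition [code del]:
  "(uniformity :: (('a, 'b) multilin \<times> ('a, 'b) multilin) filter) = (INF e\<in>{0 <..}. principal {(x, y). dist x y < e})"

definition open_multilin :: "('a, 'b) multilin set \<Rightarrow> bool"
  where [code del]: "open_multilin S = (\<forall>x\<in>S. \<forall>\<^sub>F (x', y) in uniformity. x' = x \<longrightarrow> y \<in> S)"

definition sgn_multilin :: "('a, 'b) multilin \<Rightarrow> ('a, 'b) multilin"
  where "sgn_multilin x = scaleR (inverse (norm x)) x"

lemma norm_mapp: "norm (mapp w vs) \<le> norm w * pnorm vs"
  by transfer (rule msup_upper(1), blast)

lemma multilin_norm_bound:
  "0 \<le> C \<Longrightarrow> (\<And>vs. norm (mapp w vs) \<le> C * pnorm vs) \<Longrightarrow> norm w \<le> C"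
  by transfer (rule msup_bound)

lemma multilin_norm_nonneg: "0 \<le> norm (w :: ('a, 'b) multilin)"
  by transfer (rule msup_upper(2), blast)

lemma mapp_ops [simp]:
  "mapp (v + w) vs = mapp v vs + mapp w vs"
  "mapp (v - w) vs = mapp v vs - mapp w vs"
  "mapp (- w) vs = - mapp w vs"
  "mapp 0 vs = 0"
  "mapp (r *\<^sub>R w) vs = r *\<^sub>R mapp w vs"
  for v w :: "('a, 'b) multilin"
  by (transfer, simp)+

lemma multilin_norm_scaleR_le: "norm (r *\<^sub>R w) \<le> \<bar>r\<bar> * norm w" for w :: "('a, 'b) multilin"
  using norm_mapp[of w]
  by (intro multilin_norm_bound) (auto simp: multilin_norm_nonneg mult.assoc mult_left_mono)

instance
proof
  fix v w x :: "('a, 'b) multilin" and a b :: real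
  show "dist v w = norm (v - w)" by (rule dist_multilin_def)
  show "(uniformity :: (('a, 'b) multilin \<times> ('a, 'b) multilin) filter)
      = (INF e\<in>{0 <..}. principal {(x, y). dist x y < e})" by (rule uniformity_multilin_def)
  show "open U = (\<forall>x\<in>U. \<forall>\<^sub>F (x', y) in uniformity. x' = x \<longrightarrow> y \<in> U)" for U :: "('a, 'b) multilin set"
    by (rule open_multilin_def)
  show "sgn v = inverse (norm v) *\<^sub>R v" by (rule sgn_multilin_def)
  show "v + w + x = v + (w + x)" by (rule multilin_eqI) (simp add: algebra_simps)
  show "v + w = w + v" by (rule multilin_eqI) (simp add: algebra_simps)
  show "0 + v = v" "- v + v = 0" "v - w = v + - w" "1 *\<^sub>R v = v" by (rule multilin_eqI, simp)+
  show "a *\<^sub>R (v + w) = a *\<^sub>R v + a *\<^sub>R w" "(a + b) *\<^sub>R v = a *\<^sub>R v + b *\<^sub>R v"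
    "a *\<^sub>R b *\<^sub>R v = (a * b) *\<^sub>R v" by (rule multilin_eqI, simp add: algebra_simps)+
  show "norm v = 0 \<longleftrightarrow> v = 0"
  proof
    assume "norm v = 0"
    then show "v = 0" using norm_mapp[of v] by (intro multilin_eqI) simp
  next
    assume "v = 0"
    then have "norm v \<le> 0" by (intro multilin_norm_bound) auto
    then show "norm v = 0" using multilin_norm_nonneg[of v] by simp
  qed
  show "norm (v + w) \<le> norm v + norm w"
    using norm_mapp[of v] norm_mapp[of w] multilin_norm_nonneg[of v] multilin_norm_nonneg[of w]
    by (intro multilin_norm_bound) (auto simp: distrib_right intro: order_trans[OF norm_triangle_ineq add_mono])
  show "norm (a *\<^sub>R v) = \<bar>a\<bar> * norm v"
  proof (cases "a = 0")
    case True
    then show ?thesis using multilin_norm_scaleR_le[of a v] multilin_norm_nonneg[of "a *\<^sub>R v"] by simp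
  next
    case False
    have "norm (inverse a *\<^sub>R a *\<^sub>R v) \<le> \<bar>inverse a\<bar> * norm (a *\<^sub>R v)" by (rule multilin_norm_scaleR_le)
    moreover have "inverse a *\<^sub>R a *\<^sub>R v = v" using False by (intro multilin_eqI) simp
    ultimately have "\<bar>a\<bar> * norm v \<le> norm (a *\<^sub>R v)" using False by (simp add: field_simps)
    then show ?thesis using multilin_norm_scaleR_le[of a v] by simp
  qed
qed

end

lemma bounded_linear_mapp: "bounded_linear (\<lambda>w. mapp w vs)"
  by (rule bounded_linear_intro[of _ "pnorm vs"]) (auto simp: norm_mapp)

instance multilin :: (real_normed_vector, banach) banach
proof
  fix X :: "nat \<Rightarrow> ('a, 'b) multilin"
  assume "Cauchy X"
  define w where "w vs = lim (\<lambda>n. mapp (X n) vs)" for vs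
  have lim: "(\<lambda>n. mapp (X n) vs) \<longlonglongrightarrow> w vs" for vs
    unfolding w_def using bounded_linear.Cauchy[OF bounded_linear_mapp \<open>Cauchy X\<close>]
    by (simp add: Cauchy_convergent_iff convergent_LIMSEQ_iff)
  \<comment> \<open>The Cauchy estimate, taken relative to \<open>pnorm\<close> and passed to the
    limit in one index, yields both the boundedness of \<open>w\<close> and the convergence in
    norm.\<close>
  have close: "\<exists>M. \<forall>n\<ge>M. \<forall>vs. norm (mapp (X n) vs - w vs) \<le> e * pnorm vs" if "e > 0" for e
  proof -
    obtain M where M: "\<And>m n. m \<ge> M \<Longrightarrow> n \<ge> M \<Longrightarrow> norm (X m - X n) < e"
      using CauchyD[OF \<open>Cauchy X\<close> \<open>e > 0\<close>] by auto
    have "norm (mapp (X n) vs - w vs) \<le> e * pnorm vs" if "n \<ge> M" for n vs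
    proof (rule tendsto_upperbound)
      show "(\<lambda>m. norm (mapp (X n) vs - mapp (X m) vs)) \<longlonglongrightarrow> norm (mapp (X n) vs - w vs)"
        by (intro tendsto_intros lim)
      have "norm (mapp (X n) vs - mapp (X m) vs) \<le> e * pnorm vs" if "m \<ge> M" for m
        using norm_mapp[of "X n - X m" vs] M[OF \<open>n \<ge> M\<close> \<open>m \<ge> M\<close>] mult_right_mono[OF less_imp_le pnorm_nonneg]
        by (smt (verit) mapp_ops(2))
      then show "\<forall>\<^sub>F m in sequentially. norm (mapp (X n) vs - mapp (X m) vs) \<le> e * pnorm vs"
        by (auto simp: eventually_sequentially)
    qed simp
    then show ?thesis by blast
  qed
  have "w (xs @ (a *\<^sub>R u + v) # ys) = a *\<^sub>R w (xs @ u # ys) + w (xs @ v # ys)" for xs ys u v a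
  proof (rule LIMSEQ_unique[OF lim])
    show "(\<lambda>n. mapp (X n) (xs @ (a *\<^sub>R u + v) # ys)) \<longlonglongrightarrow> a *\<^sub>R w (xs @ u # ys) + w (xs @ v # ys)"
      unfolding mapp_lin by (intro tendsto_intros lim)
  qed
  moreover have "\<exists>C. \<forall>vs. norm (w vs) \<le> C * pnorm vs"
  proof -
    obtain n where n: "\<And>vs. norm (mapp (X n) vs - w vs) \<le> 1 * pnorm vs"
      using close[of 1] by auto
    have "norm (w vs) \<le> (norm (X n) + 1) * pnorm vs" for vs
      using n[of vs] norm_mapp[of "X n" vs] norm_triangle_ineq4[of "mapp (X n) vs" "mapp (X n) vs - w vs"]
      by (simp add: distrib_right)
    then show ?thesis by blast
  qed
  ultimately obtain W where W: "mapp W = w"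
    using Multilin_inverse[of w] by blast
  have "X \<longlonglongrightarrow> W"
  proof (rule LIMSEQ_I)
    fix r :: real assume "r > 0"
    then obtain M where M: "\<forall>n\<ge>M. \<forall>vs. norm (mapp (X n) vs - w vs) \<le> r/2 * pnorm vs"
      using close[of "r/2"] by auto
    have "norm (X n - W) < r" if "n \<ge> M" for n
      using multilin_norm_bound[of "r/2" "X n - W"] M that W \<open>r > 0\<close> by auto
    then show "\<exists>M. \<forall>n\<ge>M. norm (X n - W) < r" by blast
  qed
  then show "convergent X" by (auto simp: convergent_def)
qed

section \<open>Currying: linear maps into multilinear maps, and the embedding of vectors\<close>

lift_definition mslice :: "('a::real_normed_vector, 'b::real_normed_vector) multilin \<Rightarrow> 'a \<Rightarrow> ('a, 'b) multilin"
  is "\<lambda>w v vs. w (v # vs)"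
proof (intro conjI allI, goal_cases)
  case (1 w v xs ys u u' a)
  then show ?case by (metis append_Cons)
next
  case (2 w v)
  then obtain C where "\<And>vs. norm (w vs) \<le> C * pnorm vs" by blast
  then have "norm (w (v # vs)) \<le> (C * norm v) * pnorm vs" for vs
    by (metis mult.assoc pnorm_Cons)
  then show ?case by blast
qed

lemma mapp_mslice [simp]: "mapp (mslice w v) vs = mapp w (v # vs)"
  by transfer simp

lemma norm_mslice: "norm (mslice w v) \<le> norm w * norm v"
  by (rule multilin_norm_bound) (auto simp: mult.assoc intro: order_trans[OF norm_mapp])

lemma bounded_bilinear_mslice: "bounded_bilinear mslice"
  by standard (auto intro!: multilin_eqI exI[of _ 1] simp: mapp_lin_hd norm_mslice)

lemmas bounded_linear_mslice_right = bounded_bilinear.bounded_linear_right[OF bounded_bilinear_mslice]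

text \<open>The inverse of currying on families without a component of order 0. The value 0 at the
  empty list is a choice, so \<open>munslice (mslice w) = w\<close> holds exactly if
  \<open>mapp w []\<close> vanishes; this is why that condition travels with every
  derivative.\<close>

definition munslice :: "('a::real_normed_vector \<Rightarrow> ('a, 'b::real_normed_vector) multilin) \<Rightarrow> ('a, 'b) multilin"
  where "munslice l = Multilin (\<lambda>vs. case vs of [] \<Rightarrow> 0 | v # vs \<Rightarrow> mapp (l v) vs)"

lemma mapp_munslice:
  assumes "bounded_linear l"
  shows "mapp (munslice l) = (\<lambda>vs. case vs of [] \<Rightarrow> 0 | v # vs \<Rightarrow> mapp (l v) vs)"
  unfolding munslice_def
proof (rule Multilin_inverse, intro CollectI conjI allI)
  interpret bounded_linear l by fact
  fix xs ys u v a
  show "(case xs @ (a *\<^sub>R u + v) # ys of [] \<Rightarrow> 0 | v # vs \<Rightarrow> mapp (l v) vs) =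
       a *\<^sub>R (case xs @ u # ys of [] \<Rightarrow> 0 | v # vs \<Rightarrow> mapp (l v) vs) +
       (case xs @ v # ys of [] \<Rightarrow> 0 | v # vs \<Rightarrow> mapp (l v) vs)"
    by (cases xs) (auto simp: add scaleR mapp_add mapp_scaleR)
next
  obtain K where K: "K \<ge> 0" "\<And>v. norm (l v) \<le> norm v * K"
    using bounded_linear.nonneg_bounded[OF assms] by blast
  have "norm (case vs of [] \<Rightarrow> 0 | v # vs \<Rightarrow> mapp (l v) vs) \<le> K * pnorm vs" for vs
  proof (cases vs)
    case (Cons v vs')
    have "norm (mapp (l v) vs') \<le> norm (l v) * pnorm vs'" by (rule norm_mapp)
    also have "\<dots> \<le> norm v * K * pnorm vs'" by (intro mult_right_mono K) simp
    finally show ?thesis using Cons by (simp add: algebra_simps)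
  qed (use K in simp)
  then show "\<exists>C. \<forall>vs. norm (case vs of [] \<Rightarrow> 0 | v # vs \<Rightarrow> mapp (l v) vs) \<le> C * pnorm vs" by blast
qed

lemma mslice_munslice: "bounded_linear l \<Longrightarrow> mslice (munslice l) v = l v"
  by (rule multilin_eqI) (simp add: mapp_munslice)

lemma norm_munslice_le:
  assumes "bounded_linear l" "0 \<le> K" "\<And>v. norm (l v) \<le> K * norm v"
  shows "norm (munslice l) \<le> K"
proof (rule multilin_norm_bound)
  fix vs
  show "norm (mapp (munslice l) vs) \<le> K * pnorm vs"
  proof (cases vs)
    case (Cons v vs')
    have "norm (mapp (l v) vs') \<le> norm (l v) * pnorm vs'" by (rule norm_mapp)
    also have "\<dots> \<le> K * norm v * pnorm vs'" by (intro mult_right_mono assms) simp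
    finally show ?thesis using Cons assms(1) by (simp add: algebra_simps mapp_munslice)
  qed (use assms in \<open>simp add: mapp_munslice\<close>)
qed fact

lemma munslice_add: "bounded_linear l \<Longrightarrow> bounded_linear l' \<Longrightarrow> munslice (\<lambda>v. l v + l' v) = munslice l + munslice l'"
  by (rule multilin_eqI) (simp add: mapp_munslice bounded_linear_add split: list.split)

lemma munslice_scaleR: "bounded_linear l \<Longrightarrow> munslice (\<lambda>v. r *\<^sub>R l v) = r *\<^sub>R munslice l"
  by (rule multilin_eqI) (simp add: mapp_munslice bounded_linear_const_scaleR split: list.split)

text \<open>Embedding a vector isometrically as a component of order 0 turns every map into a
  \<open>multilin\<close>-valued one, so that one derivative operator serves all orders.\<close>

lift_definition mconst :: "'b::real_normed_vector \<Rightarrow> ('a::real_normed_vector, 'b) multilin"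
  is "\<lambda>x vs. if vs = [] then x else 0"
proof (intro conjI allI, goal_cases)
  case (2 x)
  show ?case by (rule exI[of _ "norm x"]) simp
qed auto

lemma mapp_mconst: "mapp (mconst x) vs = (if vs = [] then x else 0)"
  by transfer simp

lemma norm_mconst [simp]: "norm (mconst x) = norm x"
proof (rule antisym)
  show "norm (mconst x) \<le> norm x"
    by (rule multilin_norm_bound) (auto simp: mapp_mconst)
  show "norm x \<le> norm (mconst x)"
    using norm_mapp[of "mconst x" "[]"] by (simp add: mapp_mconst)
qed

lemma bounded_linear_mconst: "bounded_linear mconst"
  by (rule bounded_linear_intro[of _ 1]) (auto intro!: multilin_eqI simp: mapp_mconst)

lemmas mconst_simps = linear_simps[OF bounded_linear_mconst]

text \<open>Norm at most 1 is demanded rather than some bound, because it survives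
  \<open>liftL\<close> and \<open>liftR\<close>: repeated differentiation puts no extra factor in
  front of the top-order terms, for which the theta conditions would leave no room.\<close>

definition contr_bilinear :: "('a::real_normed_vector \<Rightarrow> 'b::real_normed_vector \<Rightarrow> 'c::real_normed_vector) \<Rightarrow> bool"
  where "contr_bilinear B \<longleftrightarrow> bounded_bilinear B \<and> (\<forall>a b. norm (B a b) \<le> norm a * norm b)"

text \<open>\<open>liftL\<close> and \<open>liftR\<close> are the two terms of the product rule for
  \<open>B (u x) (w x)\<close>, regarded as bilinear maps in one derivative and one undifferentiated
  factor. They are of the same kind as \<open>B\<close>, so Leibniz's rule of any order is an
  induction over \<open>B\<close>.\<close>

definition liftL where "liftL B b c = munslice (\<lambda>v. B (mslice b v) c)"
definition liftR where "liftR B b c = munslice (\<lambda>v. B b (mslice c v))"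
text \<open>The chain rule as a bilinear map in the outer and the inner derivative; of the latter
  only the linear component enters.\<close>

definition mcomp where "mcomp b c = munslice (\<lambda>v. mslice b (mapp c [v]))"

lemma contr_bilinear_munslice:
  assumes bl: "\<And>b c. bounded_linear (\<lambda>v. F b c v)"
    and "\<And>b b' c v. F (b + b') c v = F b c v + F b' c v" "\<And>b c c' v. F b (c + c') v = F b c v + F b c' v"
    and "\<And>r b c v. F (r *\<^sub>R b) c v = r *\<^sub>R F b c v" "\<And>r b c v. F b (r *\<^sub>R c) v = r *\<^sub>R F b c v"
    and "\<And>b c v. norm (F b c v) \<le> norm b * norm c * norm v"
  shows "contr_bilinear (\<lambda>b c. munslice (F b c))"
proof -
  have n: "norm (munslice (F b c)) \<le> norm b * norm c" for b c
    using assms by (intro norm_munslice_le) auto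
  have e: "F (b + b') c = (\<lambda>v. F b c v + F b' c v)" "F b (c + c') = (\<lambda>v. F b c v + F b c' v)"
    "F (r *\<^sub>R b) c = (\<lambda>v. r *\<^sub>R F b c v)" "F b (r *\<^sub>R c) = (\<lambda>v. r *\<^sub>R F b c v)" for b b' c c' r
    using assms by auto
  have "bounded_bilinear (\<lambda>b c. munslice (F b c))"
    by standard (use bl n in \<open>auto simp: e munslice_add munslice_scaleR intro!: exI[of _ 1]\<close>)
  then show ?thesis using n by (simp add: contr_bilinear_def)
qed

lemma contr_bilinear_liftL:
  fixes B :: "('a::real_normed_vector, 'b::real_normed_vector) multilin \<Rightarrow> ('a, 'c::real_normed_vector) multilin
    \<Rightarrow> ('a, 'd::real_normed_vector) multilin"
  assumes "contr_bilinear B" shows "contr_bilinear (liftL B)"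
proof -
  interpret B: bounded_bilinear B using assms by (simp add: contr_bilinear_def)
  interpret mslice: bounded_bilinear mslice by (rule bounded_bilinear_mslice)
  have nB: "norm (B a b) \<le> norm a * norm b" for a b using assms by (simp add: contr_bilinear_def)
  have "norm (B (mslice b v) c) \<le> norm b * norm c * norm v" for b :: "('a, 'b) multilin" and c v
    using nB[of "mslice b v" c] mult_right_mono[OF norm_mslice[of b v] norm_ge_zero[of c]]
    by (simp add: algebra_simps)
  then have "contr_bilinear (\<lambda>b c. munslice (\<lambda>v. B (mslice b v) c))"
    by (intro contr_bilinear_munslice bounded_linear_compose[OF B.bounded_linear_left bounded_linear_mslice_right])
      (simp_all add: mslice.add_left B.add_left B.add_right mslice.scaleR_left B.scaleR_left B.scaleR_right)
  then show ?thesis by (simp add: liftL_def[abs_def])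
qed

lemma contr_bilinear_liftR:
  fixes B :: "('a::real_normed_vector, 'b::real_normed_vector) multilin \<Rightarrow> ('a, 'c::real_normed_vector) multilin
    \<Rightarrow> ('a, 'd::real_normed_vector) multilin"
  assumes "contr_bilinear B" shows "contr_bilinear (liftR B)"
proof -
  interpret B: bounded_bilinear B using assms by (simp add: contr_bilinear_def)
  interpret mslice: bounded_bilinear mslice by (rule bounded_bilinear_mslice)
  have nB: "norm (B a b) \<le> norm a * norm b" for a b using assms by (simp add: contr_bilinear_def)
  have "norm (B b (mslice c v)) \<le> norm b * norm c * norm v" for b and c :: "('a, 'c) multilin" and v
    using nB[of b "mslice c v"] mult_left_mono[OF norm_mslice[of c v] norm_ge_zero[of b]]
    by (simp add: algebra_simps)
  then have "contr_bilinear (\<lambda>b c. munslice (\<lambda>v. B b (mslice c v)))"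
    by (intro contr_bilinear_munslice bounded_linear_compose[OF B.bounded_linear_right bounded_linear_mslice_right])
      (simp_all add: mslice.add_left B.add_left B.add_right mslice.scaleR_left B.scaleR_left B.scaleR_right)
  then show ?thesis by (simp add: liftR_def[abs_def])
qed

lemma contr_bilinear_mcomp: "contr_bilinear (mcomp :: ('a::real_normed_vector, 'b::real_normed_vector) multilin \<Rightarrow> ('a, 'a) multilin \<Rightarrow> _)"
proof -
  interpret mslice: bounded_bilinear "mslice :: ('a, 'b) multilin \<Rightarrow> _" by (rule bounded_bilinear_mslice)
  have bl: "bounded_linear (\<lambda>v. mapp c [v])" for c :: "('a, 'a) multilin"
    by (rule bounded_linear_intro[of _ "norm c"])
      (use norm_mapp[of c "[_]"] in \<open>auto simp: mapp_lin_hd mult.commute\<close>)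
  have "norm (mslice b (mapp c [v])) \<le> norm b * norm c * norm v" for b :: "('a, 'b) multilin" and c v
    using norm_mslice[of b "mapp c [v]"] mult_left_mono[OF norm_mapp[of c "[v]"] norm_ge_zero[of b]]
    by (simp add: algebra_simps)
  then have "contr_bilinear (\<lambda>b c. munslice (\<lambda>v. mslice (b :: ('a, 'b) multilin) (mapp c [v])))"
    by (intro contr_bilinear_munslice bounded_linear_compose[OF bounded_linear_mslice_right bl])
      (simp_all add: mslice.add_left mslice.add_right mslice.scaleR_left mslice.scaleR_right)
  then show ?thesis by (simp add: mcomp_def[abs_def])
qed

section \<open>Iterated derivatives\<close>

lemma mslice_zero [simp]: "mslice 0 v = 0" "mslice w 0 = 0"
  by (rule multilin_eqI, simp add: mapp_lin_hd)+

lemma munslice_mslice: "mapp w [] = 0 \<Longrightarrow> munslice (mslice w) = w"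
  by (rule multilin_eqI) (simp add: mapp_munslice bounded_linear_mslice_right split: list.split)

lemma mcomp_mslice:
  "mslice (mcomp b c) v = mslice b (mapp c [v])" for b :: "('a::real_normed_vector, 'b::real_normed_vector) multilin"
proof -
  have "bounded_linear (\<lambda>v. mapp c [v])"
    by (rule bounded_linear_intro[of _ "norm c"])
      (use norm_mapp[of c "[_]"] in \<open>auto simp: mapp_lin_hd mult.commute\<close>)
  then show ?thesis
    unfolding mcomp_def by (intro mslice_munslice bounded_linear_compose[OF bounded_linear_mslice_right])
qed

lemma mslice_munslice_eq: "bounded_linear l \<Longrightarrow> mslice (munslice l) = l"
  by (simp add: fun_eq_iff mslice_munslice)

text \<open>The derivative takes values in the same type as \<open>u\<close>, one order higher, and
  hence can be iterated.\<close>

definition mderiv :: "('a::real_normed_vector \<Rightarrow> ('a, 'b::real_normed_vector) multilin) \<Rightarrow> 'a \<Rightarrow> ('a, 'b) multilin"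
  where "mderiv u x = munslice (frechet_derivative u (at x))"

lemma mderiv_eq: "(u has_derivative l) (at x) \<Longrightarrow> mderiv u x = munslice l"
  unfolding mderiv_def by (simp add: frechet_derivative_at[symmetric])

lemma mderiv_works: "u differentiable (at x) \<Longrightarrow> (u has_derivative mslice (mderiv u x)) (at x)"
  using frechet_derivative_works[of u "at x"] has_derivative_bounded_linear[of u _ "at x"]
  by (simp add: mderiv_def mslice_munslice_eq)

lemma mapp_mderiv_Nil [simp]: "u differentiable (at x) \<Longrightarrow> mapp (mderiv u x) [] = 0"
  using frechet_derivative_works[of u "at x"]
  by (auto simp: mderiv_def mapp_munslice dest: has_derivative_bounded_linear)

lemma mderiv_eq_mslice: "(u has_derivative mslice w) (at x) \<Longrightarrow> mapp w [] = 0 \<Longrightarrow> mderiv u x = w"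
  by (simp add: mderiv_eq munslice_mslice)

lemma mderiv_add:
  assumes "u differentiable (at x)" "w differentiable (at x)"
  shows "mderiv (\<lambda>x. u x + w x) x = mderiv u x + mderiv w x"
proof (rule mderiv_eq_mslice)
  show "((\<lambda>x. u x + w x) has_derivative mslice (mderiv u x + mderiv w x)) (at x)"
    using has_derivative_add[OF assms[THEN mderiv_works]]
    by (simp add: bounded_bilinear.add_left[OF bounded_bilinear_mslice, abs_def])
qed (use assms in simp)

lemma mderiv_bil:
  fixes u :: "'a::real_normed_vector \<Rightarrow> ('a, 'b::real_normed_vector) multilin"
    and w :: "'a \<Rightarrow> ('a, 'c::real_normed_vector) multilin"
    and B :: "_ \<Rightarrow> _ \<Rightarrow> ('a, 'd::real_normed_vector) multilin"
  assumes "contr_bilinear B" "u differentiable (at x)" "w differentiable (at x)"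
  shows "(\<lambda>x. B (u x) (w x)) differentiable (at x)"
    and "mderiv (\<lambda>x. B (u x) (w x)) x = liftL B (mderiv u x) (w x) + liftR B (u x) (mderiv w x)"
proof -
  interpret B: bounded_bilinear B using assms by (simp add: contr_bilinear_def)
  have d: "((\<lambda>x. B (u x) (w x)) has_derivative (\<lambda>v. B (u x) (mslice (mderiv w x) v) + B (mslice (mderiv u x) v) (w x))) (at x)"
    using B.FDERIV[OF assms(2,3)[THEN mderiv_works]] .
  then show "(\<lambda>x. B (u x) (w x)) differentiable (at x)" by (auto simp: differentiable_def)
  have "munslice (\<lambda>v. B (u x) (mslice (mderiv w x) v) + B (mslice (mderiv u x) v) (w x))
    = liftR B (u x) (mderiv w x) + liftL B (mderiv u x) (w x)"
    unfolding liftL_def liftR_def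
    by (intro munslice_add bounded_linear_compose[OF B.bounded_linear_left bounded_linear_mslice_right]
        bounded_linear_compose[OF B.bounded_linear_right bounded_linear_mslice_right])
  then show "mderiv (\<lambda>x. B (u x) (w x)) x = liftL B (mderiv u x) (w x) + liftR B (u x) (mderiv w x)"
    using mderiv_eq[OF d] by simp
qed

lemma mconst_differentiable:
  fixes \<psi> :: "'a::real_normed_vector \<Rightarrow> 'b::real_normed_vector"
  assumes "(\<lambda>x. mconst (\<psi> x) :: ('a, 'b) multilin) differentiable (at x)"
  shows "(\<psi> has_derivative (\<lambda>v. mapp (mderiv (\<lambda>x. mconst (\<psi> x)) x) [v])) (at x)"
  using bounded_linear.has_derivative[OF bounded_linear_mapp[of "[]"] mderiv_works[OF assms]]
  by (simp add: mapp_mconst)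

lemma mderiv_comp:
  fixes u :: "'a::real_normed_vector \<Rightarrow> ('a, 'b::real_normed_vector) multilin"
  assumes "u differentiable (at (\<psi> x))" "(\<lambda>x. mconst (\<psi> x) :: ('a, 'a) multilin) differentiable (at x)"
  shows "(\<lambda>x. u (\<psi> x)) differentiable (at x)"
    and "mderiv (\<lambda>x. u (\<psi> x)) x = mcomp (mderiv u (\<psi> x)) (mderiv (\<lambda>x. mconst (\<psi> x)) x)"
proof -
  have d: "((\<lambda>x. u (\<psi> x)) has_derivative mslice (mcomp (mderiv u (\<psi> x)) (mderiv (\<lambda>x. mconst (\<psi> x)) x))) (at x)"
    using has_derivative_compose[OF mconst_differentiable[OF assms(2)] mderiv_works[OF assms(1)]]
    by (simp add: mcomp_mslice[abs_def])
  then show "(\<lambda>x. u (\<psi> x)) differentiable (at x)" by (auto simp: differentiable_def)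
  have "bounded_linear (\<lambda>v. mslice (mderiv u (\<psi> x)) (mapp (mderiv (\<lambda>x. mconst (\<psi> x)) x) [v]))"
    using has_derivative_bounded_linear[OF d] by (simp add: mcomp_mslice[abs_def])
  then have "mapp (mcomp (mderiv u (\<psi> x)) (mderiv (\<lambda>x. mconst (\<psi> x)) x)) [] = 0"
    by (simp add: mcomp_def mapp_munslice)
  then show "mderiv (\<lambda>x. u (\<psi> x)) x = mcomp (mderiv u (\<psi> x)) (mderiv (\<lambda>x. mconst (\<psi> x)) x)"
    by (rule mderiv_eq_mslice[OF d])
qed

section \<open>Post-composition with bounded linear maps\<close>

definition mpost :: "('b::real_normed_vector \<Rightarrow> 'c::real_normed_vector) \<Rightarrow>
    ('a::real_normed_vector, 'b) multilin \<Rightarrow> ('a, 'c) multilin"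
  where "mpost L w = Multilin (\<lambda>vs. L (mapp w vs))"

lemma mapp_mpost:
  assumes "bounded_linear L" shows "mapp (mpost L w) vs = L (mapp w vs)"
proof -
  interpret bounded_linear L by fact
  have "mapp (mpost L w) = (\<lambda>vs. L (mapp w vs))"
    unfolding mpost_def
  proof (rule Multilin_inverse, intro CollectI conjI allI)
    obtain K where K: "K \<ge> 0" "\<And>v. norm (L v) \<le> norm v * K"
      using nonneg_bounded by blast
    have "norm (L (mapp w vs)) \<le> (norm w * K) * pnorm vs" for vs
      using K(2)[of "mapp w vs"] mult_right_mono[OF norm_mapp[of w vs] K(1)] by (simp add: algebra_simps)
    then show "\<exists>C. \<forall>vs. norm (L (mapp w vs)) \<le> C * pnorm vs" by blast
  qed (simp add: mapp_lin add scaleR)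
  then show ?thesis by simp
qed

lemma norm_mpost_le:
  assumes "bounded_linear L" "0 \<le> l" "\<And>x. norm (L x) \<le> l * norm x"
  shows "norm (mpost L w) \<le> l * norm w"
proof (rule multilin_norm_bound)
  fix vs
  show "norm (mapp (mpost L w) vs) \<le> l * norm w * pnorm vs"
    using assms(3)[of "mapp w vs"] mult_left_mono[OF norm_mapp[of w vs] assms(2)] assms(1)
    by (simp add: mapp_mpost mult.assoc)
qed (use assms in simp)

lemma bounded_linear_mpost: assumes "bounded_linear L" shows "bounded_linear (mpost L)"
proof -
  interpret bounded_linear L by fact
  obtain K where K: "K \<ge> 0" "\<And>v. norm (L v) \<le> norm v * K" using nonneg_bounded by blast
  have "norm (mpost L w) \<le> K * norm w" for w :: "('x::real_normed_vector, 'a) multilin"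
    using norm_mpost_le[OF assms K(1)] K(2) by (simp add: mult.commute)
  then show ?thesis
    by (intro bounded_linear_intro[of _ K])
      (auto intro!: multilin_eqI simp: mapp_mpost assms add scaleR mult.commute)
qed

lemma mderiv_mpost:
  fixes u :: "'a::real_normed_vector \<Rightarrow> ('a, 'b::real_normed_vector) multilin"
    and L :: "'b \<Rightarrow> 'c::real_normed_vector"
  assumes "bounded_linear L" "u differentiable (at x)"
  shows "(\<lambda>x. mpost L (u x)) differentiable (at x)"
    and "mderiv (\<lambda>x. mpost L (u x)) x = mpost L (mderiv u x)"
proof -
  have "(\<lambda>v. mpost L (mslice w v)) = mslice (mpost L w)" for w :: "('a, 'b) multilin"
    by (intro HOL.ext multilin_eqI) (simp add: mapp_mpost assms)
  then have d: "((\<lambda>x. mpost L (u x)) has_derivative mslice (mpost L (mderiv u x))) (at x)"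
    using bounded_linear.has_derivative[OF bounded_linear_mpost[OF assms(1)] mderiv_works[OF assms(2)]] by simp
  then show "(\<lambda>x. mpost L (u x)) differentiable (at x)" by (auto simp: differentiable_def)
  have "mapp (mpost L (mderiv u x)) [] = 0"
    using assms by (simp add: mapp_mpost linear_simps)
  then show "mderiv (\<lambda>x. mpost L (u x)) x = mpost L (mderiv u x)" by (rule mderiv_eq_mslice[OF d])
qed

lemma mpost_mconst: "bounded_linear L \<Longrightarrow> mpost L (mconst x) = mconst (L x)"
  by (rule multilin_eqI) (simp add: mapp_mpost mapp_mconst linear_simps)

section \<open>Derivatives of order k of sums, products, compositions and linear maps\<close>

definition mderivs where "mderivs k u = (mderiv ^^ k) u"

lemma mderivs_0 [simp]: "mderivs 0 u = u" and mderivs_Suc: "mderivs (Suc k) u = mderivs k (mderiv u)"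
  and mderivs_Suc': "mderivs (Suc k) u = mderiv (mderivs k u)"
  by (simp_all add: mderivs_def funpow_swap1)

text \<open>Pure k-fold differentiability at every point; continuity of the last derivative is
  carried as a separate fact.\<close>

definition mdiff :: "nat \<Rightarrow> ('a::real_normed_vector \<Rightarrow> ('a, 'b::real_normed_vector) multilin) \<Rightarrow> bool"
  where "mdiff k u \<longleftrightarrow> (\<forall>j<k. \<forall>x. mderivs j u differentiable (at x))"

lemma mdiff_0 [simp]: "mdiff 0 u" by (simp add: mdiff_def)

lemma mdiff_Suc: "mdiff (Suc k) u \<longleftrightarrow> (\<forall>x. u differentiable (at x)) \<and> mdiff k (mderiv u)"
  unfolding mdiff_def by (auto simp: mderivs_Suc less_Suc_eq_0_disj)

lemma mdiff_mono: "mdiff k u \<Longrightarrow> j \<le> k \<Longrightarrow> mdiff j u" by (auto simp: mdiff_def)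

lemma mdiff_diff: "mdiff k u \<Longrightarrow> 0 < k \<Longrightarrow> u differentiable (at x)"
  unfolding mdiff_def by (metis mderivs_0)

lemma mdiff_add_mderivs:
  assumes "mdiff k u" "mdiff k w"
  shows "mdiff k (\<lambda>x. u x + w x) \<and> mderivs k (\<lambda>x. u x + w x) = (\<lambda>x. mderivs k u x + mderivs k w x)"
  using assms
proof (induction k arbitrary: u w)
  case (Suc k)
  then have "mderiv (\<lambda>x. u x + w x) = (\<lambda>x. mderiv u x + mderiv w x)"
    by (auto simp: mdiff_Suc mderiv_add)
  then show ?case using Suc by (simp add: mdiff_Suc mderivs_Suc)
qed simp

lemma mdiff_mpost_mderivs:
  assumes "bounded_linear L" "mdiff k u"
  shows "mdiff k (\<lambda>x. mpost L (u x)) \<and> mderivs k (\<lambda>x. mpost L (u x)) = (\<lambda>x. mpost L (mderivs k u x))"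
  using assms(2)
proof (induction k arbitrary: u)
  case (Suc k)
  then have "mderiv (\<lambda>x. mpost L (u x)) = (\<lambda>x. mpost L (mderiv u x))"
    by (auto simp: mdiff_Suc mderiv_mpost assms)
  then show ?case using Suc assms by (simp add: mdiff_Suc mderivs_Suc mderiv_mpost)
qed simp

lemmas mdiff_add = mdiff_add_mderivs[THEN conjunct1] and mderivs_add = mdiff_add_mderivs[THEN conjunct2]
lemmas mdiff_mpost = mdiff_mpost_mderivs[THEN conjunct1] and mderivs_mpost = mdiff_mpost_mderivs[THEN conjunct2]

text \<open>The induction runs over all bilinear maps of norm at most 1 simultaneously: the
  derivative of \<open>B (u x) (w x)\<close> is a sum of two such products, with
  \<open>liftL B\<close> and \<open>liftR B\<close>.\<close>

lemma mdiff_bil: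
  fixes u :: "'a::real_normed_vector \<Rightarrow> ('a, 'b::real_normed_vector) multilin"
    and w :: "'a \<Rightarrow> ('a, 'c::real_normed_vector) multilin"
    and B :: "_ \<Rightarrow> _ \<Rightarrow> ('a, 'd::real_normed_vector) multilin"
  assumes "contr_bilinear B" "mdiff k u" "mdiff k w"
  shows "mdiff k (\<lambda>x. B (u x) (w x))"
  using assms
proof (induction k arbitrary: B u w)
  case (Suc k)
  have d: "\<And>x. u differentiable (at x)" "\<And>x. w differentiable (at x)" using Suc.prems by (auto simp: mdiff_Suc)
  have "mdiff k (mderiv u)" "mdiff k (mderiv w)" "mdiff k u" "mdiff k w"
    using Suc.prems mdiff_mono[of "Suc k" _ k] by (auto simp: mdiff_Suc)
  then have "mdiff k (\<lambda>x. liftL B (mderiv u x) (w x) + liftR B (u x) (mderiv w x))"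
    by (intro mdiff_add Suc.IH contr_bilinear_liftL contr_bilinear_liftR Suc.prems(1))
  moreover have "mderiv (\<lambda>x. B (u x) (w x)) = (\<lambda>x. liftL B (mderiv u x) (w x) + liftR B (u x) (mderiv w x))"
    using mderiv_bil(2)[OF Suc.prems(1)] d by blast
  ultimately show ?case
    using d Suc.prems(1) by (simp add: mdiff_Suc mderiv_bil(1))
qed simp

lemma mderiv_comp_fun:
  fixes u :: "'a::real_normed_vector \<Rightarrow> ('a, 'b::real_normed_vector) multilin"
  assumes "mdiff (Suc k) u" "mdiff (Suc k) (\<lambda>x. mconst (\<psi> x) :: ('a, 'a) multilin)"
  shows "mderiv (\<lambda>x. u (\<psi> x)) = (\<lambda>x. mcomp (mderiv u (\<psi> x)) (mderiv (\<lambda>x. mconst (\<psi> x)) x))"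
  using assms by (auto simp: mdiff_Suc mderiv_comp)

text \<open>By the chain rule the derivative is a product, under \<open>mcomp\<close>, of
  \<open>mderiv u\<close> composed with \<psi> and the derivative of \<psi>. The induction
  hypothesis is applied to the former, hence the arbitrary \<open>u\<close>.\<close>

lemma mdiff_comp:
  fixes u :: "'a::real_normed_vector \<Rightarrow> ('a, 'b::real_normed_vector) multilin"
  assumes "mdiff k u" "mdiff k (\<lambda>x. mconst (\<psi> x) :: ('a, 'a) multilin)"
  shows "mdiff k (\<lambda>x. u (\<psi> x))"
  using assms
proof (induction k arbitrary: u)
  case (Suc k)
  have "mdiff k (\<lambda>x. mcomp (mderiv u (\<psi> x)) (mderiv (\<lambda>x. mconst (\<psi> x)) x))"
    using Suc.prems mdiff_mono[OF Suc.prems(2), of k]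
    by (intro mdiff_bil[OF contr_bilinear_mcomp] Suc.IH) (simp_all add: mdiff_Suc)
  moreover have "(\<lambda>x. u (\<psi> x)) differentiable (at x)" for x
    using Suc.prems by (simp add: mdiff_Suc mderiv_comp(1))
  ultimately show ?case using mderiv_comp_fun[OF Suc.prems] by (simp add: mdiff_Suc)
qed simp

text \<open>Uniqueness of derivatives, for chains constructed by other means: derivatives given on
  lists, and limits of derivatives along the iteration.\<close>

lemma tower_mderivs:
  assumes "\<And>j x. j < n \<Longrightarrow> (U j has_derivative mslice (U (Suc j) x)) (at x)"
    and "\<And>j x. j < n \<Longrightarrow> mapp (U (Suc j) x) [] = 0" "j \<le> n"
  shows "mderivs j (U 0) = U j"
  using assms(3)
proof (induction j)
  case (Suc j)
  then show ?case using assms(1,2)[of j] by (auto simp: mderivs_Suc' mderiv_eq_mslice)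
qed simp

lemma tower_mdiff:
  assumes "\<And>j x. j < n \<Longrightarrow> (U j has_derivative mslice (U (Suc j) x)) (at x)"
    and "\<And>j x. j < n \<Longrightarrow> mapp (U (Suc j) x) [] = 0"
  shows "mdiff n (U 0)"
  using tower_mderivs[of n U, OF assms] assms(1) unfolding mdiff_def differentiable_def
  by (metis less_imp_le)

lemma mdiff_works: "mdiff n u \<Longrightarrow> j < n \<Longrightarrow> (mderivs j u has_derivative mslice (mderivs (Suc j) u x)) (at x)"
  by (simp add: mdiff_def mderivs_Suc' mderiv_works)

lemma mapp_mderivs_Nil: "mdiff n u \<Longrightarrow> j < n \<Longrightarrow> mapp (mderivs (Suc j) u x) [] = 0"
  by (simp add: mdiff_def mderivs_Suc')

lemma linear_mderivs:
  fixes L :: "'a::real_normed_vector \<Rightarrow> 'b::real_normed_vector"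
  assumes "bounded_linear L"
  shows "mdiff k (\<lambda>x. mconst (L x) :: ('a, 'b) multilin)"
    and "\<exists>w. \<forall>x. mderivs (Suc k) (\<lambda>x. mconst (L x) :: ('a, 'b) multilin) x = w"
    and "mderiv (\<lambda>x. mconst (L x) :: ('a, 'b) multilin) x = munslice (\<lambda>v. mconst (L v))"
proof -
  let ?u = "\<lambda>x. mconst (L x) :: ('a, 'b) multilin"
  have bl: "bounded_linear ?u" by (rule bounded_linear_compose[OF bounded_linear_mconst assms])
  then have d: "(?u has_derivative ?u) (at x)" for x by (rule bounded_linear_imp_has_derivative)
  then show mderiv: "mderiv ?u x = munslice (\<lambda>v. mconst (L v))" for x by (rule mderiv_eq)
  have const: "mderivs j (\<lambda>x :: 'a. w) = (\<lambda>x. if j = 0 then w else 0)" for j and w :: "('a, 'b) multilin"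
  proof (induction j)
    case (Suc j)
    have ap0: "mslice (0 :: ('a, 'b) multilin) = (\<lambda>v. 0)" by (simp add: fun_eq_iff)
    have "((\<lambda>x :: 'a. w') has_derivative mslice 0) (at x)" for w' :: "('a, 'b) multilin" and x
      unfolding ap0 by (rule has_derivative_const)
    then have "mderiv (\<lambda>x :: 'a. w') x = 0" for w' :: "('a, 'b) multilin" and x by (rule mderiv_eq_mslice) simp
    then show ?case using Suc by (auto simp: mderivs_Suc')
  qed simp
  have dkS: "mderivs (Suc j) ?u = (\<lambda>x. if j = 0 then munslice (\<lambda>v. mconst (L v)) else 0)" for j
    by (simp add: mderivs_Suc mderiv[abs_def] const)
  then show "\<exists>w. \<forall>x. mderivs (Suc k) ?u x = w" by auto
  show "mdiff k ?u"
    unfolding mdiff_def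
  proof (intro allI impI)
    fix j x assume "j < k"
    show "mderivs j ?u differentiable (at x)"
      using d by (cases j) (auto simp: dkS differentiable_def)
  qed
qed

section \<open>Top-order estimates\<close>

text \<open>Evaluating at each list carries the maximum norm over to multilinear maps. Thereby the
  three components of K count with their maximum rather than their sum, as the coefficient
  \<open>lg\<close> in the theta conditions presupposes.\<close>

lemma mpost_split:
  fixes L1 L2 L3 :: "'b::real_normed_vector \<Rightarrow> 'b" and w :: "('a::real_normed_vector, 'b) multilin"
  assumes L: "bounded_linear L1" "bounded_linear L2" "bounded_linear L3"
    and mx: "\<And>x. norm x \<le> max (norm (L1 x)) (max (norm (L2 x)) (norm (L3 x)))"
    and C: "norm (mpost L1 w) \<le> C" "norm (mpost L2 w) \<le> C" "norm (mpost L3 w) \<le> C"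
  shows "norm w \<le> C"
proof (rule multilin_norm_bound)
  show "0 \<le> C" using C(1) norm_ge_zero order_trans by blast
  fix vs
  have "norm (L (mapp w vs)) \<le> C * pnorm vs" if "bounded_linear L" "norm (mpost L w) \<le> C" for L :: "'b \<Rightarrow> 'b"
    using norm_mapp[of "mpost L w" vs] mult_right_mono[OF that(2) pnorm_nonneg[of vs]] that(1)
    by (simp add: mapp_mpost)
  then show "norm (mapp w vs) \<le> C * pnorm vs"
    using mx[of "mapp w vs"] L C by (smt (verit, best))
qed

abbreviation embs :: "('i \<Rightarrow> 'a \<Rightarrow> 'a) \<Rightarrow> 'i \<Rightarrow> 'a \<Rightarrow> ('a::real_normed_vector, 'a) multilin"
  where "embs f \<equiv> (\<lambda>m x. mconst (f m x))"

text \<open>S u c bounds by c the part of the family u that is not yet under control, and S u 0 means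
  that u is negligible. The instances are boundedness modulo constants and the asymptotic
  oscillation.\<close>

locale size_system =
  fixes S :: "(nat \<Rightarrow> 'a::real_normed_vector \<Rightarrow> ('a, 'a) multilin) \<Rightarrow> real \<Rightarrow> bool"
    and adm :: "(nat \<Rightarrow> 'a \<Rightarrow> 'a) \<Rightarrow> bool"
  assumes S_mono: "S u c \<Longrightarrow> c \<le> d \<Longrightarrow> S u d"
    and S_add: "S u c \<Longrightarrow> S w d \<Longrightarrow> S (\<lambda>m x. u m x + w m x) (c + d)"
    and S_const: "S (\<lambda>m x. z) 0"
    and S_bounded: "S u 0 \<Longrightarrow> \<exists>\<alpha>. \<forall>m x. norm (u m x) \<le> \<alpha>"
    and S_bil_left: "contr_bilinear B \<Longrightarrow> S u c \<Longrightarrow> 0 \<le> c \<Longrightarrow> S w 0 \<Longrightarrow> (\<And>m x. norm (w m x) \<le> \<beta>)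
      \<Longrightarrow> S (\<lambda>m x. B (u m x) (w m x)) (c * \<beta>)"
    and S_bil_right: "contr_bilinear B \<Longrightarrow> S u 0 \<Longrightarrow> S w d \<Longrightarrow> 0 \<le> d \<Longrightarrow> (\<And>m x. norm (u m x) \<le> \<alpha>)
      \<Longrightarrow> S (\<lambda>m x. B (u m x) (w m x)) (\<alpha> * d)"
    and S_bil: "contr_bilinear B \<Longrightarrow> S u c \<Longrightarrow> 0 \<le> c \<Longrightarrow> S w d \<Longrightarrow> 0 \<le> d \<Longrightarrow>
      (\<And>m x. norm (u m x) \<le> \<alpha>) \<Longrightarrow> (\<And>m x. norm (w m x) \<le> \<beta>)
      \<Longrightarrow> S (\<lambda>m x. B (u m x) (w m x)) (c * \<beta> + \<alpha> * d)"
    and S_comp: "S u c \<Longrightarrow> adm \<psi> \<Longrightarrow> S (\<lambda>m x. u m (\<psi> m x)) c"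
    and S_mpost: "bounded_linear L \<Longrightarrow> (\<And>x. norm (L x) \<le> l * norm x) \<Longrightarrow> 0 \<le> l \<Longrightarrow> 0 \<le> c \<Longrightarrow> S u c
      \<Longrightarrow> S (\<lambda>m x. mpost L (u m x)) (l * c)"
    and S_split: "bounded_linear L1 \<Longrightarrow> bounded_linear L2 \<Longrightarrow> bounded_linear L3 \<Longrightarrow>
      (\<And>x. norm x \<le> max (norm (L1 x)) (max (norm (L2 x)) (norm (L3 x)))) \<Longrightarrow>
      S (\<lambda>m x. mpost L1 (u m x)) c \<Longrightarrow> S (\<lambda>m x. mpost L2 (u m x)) c \<Longrightarrow> S (\<lambda>m x. mpost L3 (u m x)) c
      \<Longrightarrow> S u c"
begin

text \<open>The situation of the induction on the order: everything below order k is negligible, and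
  the derivative of order k exists but remains to be estimated.\<close>

definition low :: "nat \<Rightarrow> (nat \<Rightarrow> 'a \<Rightarrow> ('a, 'a) multilin) \<Rightarrow> bool"
  where "low k u \<longleftrightarrow> (\<forall>m. mdiff k (u m)) \<and> (\<forall>j<k. S (\<lambda>m. mderivs j (u m)) 0)"

text \<open>Order zero is excluded for inner functions: maps such as R = Ac + r are not bounded.\<close>

definition lowp :: "nat \<Rightarrow> (nat \<Rightarrow> 'a \<Rightarrow> ('a, 'a) multilin) \<Rightarrow> bool"
  where "lowp k u \<longleftrightarrow> (\<forall>m. mdiff k (u m)) \<and> (\<forall>j<k. 1 \<le> j \<longrightarrow> S (\<lambda>m. mderivs j (u m)) 0)"

lemma low_lowp: "low k u \<Longrightarrow> lowp k u" by (auto simp: low_def lowp_def)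

lemma lowp_mderiv: "lowp (Suc k) u \<Longrightarrow> low k (\<lambda>m. mderiv (u m))"
  unfolding low_def lowp_def
  by (auto simp: mdiff_Suc mderivs_Suc[symmetric])

lemma low_mono: "low k u \<Longrightarrow> j \<le> k \<Longrightarrow> low j u"
  by (auto simp: low_def intro: mdiff_mono)

lemma low_mdiff: "low k u \<Longrightarrow> mdiff k (u m)" and lowp_mdiff: "lowp k u \<Longrightarrow> mdiff k (u m)"
  by (auto simp: low_def lowp_def)

lemma low_S: "low k u \<Longrightarrow> j < k \<Longrightarrow> S (\<lambda>m. mderivs j (u m)) 0"
  by (auto simp: low_def)

lemma low_S0: "low k u \<Longrightarrow> 0 < k \<Longrightarrow> S u 0"
  using low_S[of k u 0] by simp

text \<open>In Leibniz's rule only the two extreme terms, with all k derivatives on one factor,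
  carry a derivative of order k; the mixed ones are negligible. In the induction step each of the
  two lifted products has one factor whose derivative of order k is negligible, by
  \<open>low\<close>.\<close>

lemma bil_top:
  assumes "contr_bilinear B" "low k u" "low k w" "1 \<le> k" "0 \<le> c" "0 \<le> d"
    and "S (\<lambda>m. mderivs k (u m)) c" "S (\<lambda>m. mderivs k (w m)) d"
    and "\<And>m x. norm (u m x) \<le> \<alpha>" "\<And>m x. norm (w m x) \<le> \<beta>"
  shows "S (\<lambda>m. mderivs k (\<lambda>x. B (u m x) (w m x))) (c * \<beta> + \<alpha> * d)"
  using assms(4) assms(1-3,5-)
proof (induction k arbitrary: B u w c d \<alpha> \<beta> rule: nat_induct_at_least)
  case base
  have d: "u m differentiable (at x)" "w m differentiable (at x)" for m x
    using base low_mdiff mdiff_diff by (metis less_numeral_extra(1))+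
  have eq: "(\<lambda>m. mderivs 1 (\<lambda>x. B (u m x) (w m x)))
      = (\<lambda>m x. liftL B (mderiv (u m) x) (w m x) + liftR B (u m x) (mderiv (w m) x))"
    using mderiv_bil(2)[OF base(1) d] by (simp add: mderivs_Suc fun_eq_iff)
  have "S (\<lambda>m x. liftL B (mderiv (u m) x) (w m x)) (c * \<beta>)"
    using base low_S0[of 1 w] by (intro S_bil_left contr_bilinear_liftL) (simp_all add: mderivs_Suc)
  moreover have "S (\<lambda>m x. liftR B (u m x) (mderiv (w m) x)) (\<alpha> * d)"
    using base low_S0[of 1 u] by (intro S_bil_right contr_bilinear_liftR) (simp_all add: mderivs_Suc)
  ultimately show ?case unfolding eq by (rule S_add)
next
  case (Suc k)
  have d: "u m differentiable (at x)" "w m differentiable (at x)" for m x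
    using Suc.prems low_mdiff mdiff_diff by (metis zero_less_Suc)+
  have l: "low k (\<lambda>m. mderiv (u m))" "low k (\<lambda>m. mderiv (w m))" "low k u" "low k w"
    using Suc.prems low_lowp lowp_mderiv low_mono[of "Suc k" _ k] by auto
  have C: "mdiff k (\<lambda>x. liftL B (mderiv (u m) x) (w m x))" "mdiff k (\<lambda>x. liftR B (u m x) (mderiv (w m) x))" for m
    using mdiff_bil[OF contr_bilinear_liftL[OF Suc.prems(1)] low_mdiff[OF l(1)] low_mdiff[OF l(4)]]
      mdiff_bil[OF contr_bilinear_liftR[OF Suc.prems(1)] low_mdiff[OF l(3)] low_mdiff[OF l(2)]] by blast+
  have "mderiv (\<lambda>x. B (u m x) (w m x)) = (\<lambda>x. liftL B (mderiv (u m) x) (w m x) + liftR B (u m x) (mderiv (w m) x))" for m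
    using mderiv_bil(2)[OF Suc.prems(1) d] by (simp add: fun_eq_iff)
  then have eq: "(\<lambda>m. mderivs (Suc k) (\<lambda>x. B (u m x) (w m x)))
      = (\<lambda>m x. mderivs k (\<lambda>x. liftL B (mderiv (u m) x) (w m x)) x + mderivs k (\<lambda>x. liftR B (u m x) (mderiv (w m) x)) x)"
    using mderivs_add[OF C(1) C(2)] by (simp add: mderivs_Suc)
  \<comment> \<open>These two bounds get multiplied by size 0, so their mere existence
    suffices.\<close>
  obtain \<alpha>' where \<alpha>': "\<And>m x. norm (mderiv (u m) x) \<le> \<alpha>'"
    using S_bounded[OF low_S0[OF l(1)]] Suc.hyps by auto
  obtain \<beta>' where \<beta>': "\<And>m x. norm (mderiv (w m) x) \<le> \<beta>'"
    using S_bounded[OF low_S0[OF l(2)]] Suc.hyps by auto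
  have z: "S (\<lambda>m. mderivs k (u m)) 0" "S (\<lambda>m. mderivs k (w m)) 0"
    using low_S[OF Suc.prems(2), of k] low_S[OF Suc.prems(3), of k] by auto
  have "S (\<lambda>m. mderivs k (\<lambda>x. liftL B (mderiv (u m) x) (w m x))) (c * \<beta> + \<alpha>' * 0)"
    using Suc.prems(6) z \<alpha>' by (intro Suc.IH contr_bilinear_liftL l Suc.prems) (simp_all add: mderivs_Suc)
  moreover have "S (\<lambda>m. mderivs k (\<lambda>x. liftR B (u m x) (mderiv (w m) x))) (0 * \<beta>' + \<alpha> * d)"
    using Suc.prems(7) z \<beta>' by (intro Suc.IH contr_bilinear_liftR l Suc.prems) (simp_all add: mderivs_Suc)
  ultimately show ?case unfolding eq using S_add by fastforce
qed

lemma mderiv_comp_family: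
  assumes "low (Suc k) u" "lowp (Suc k) (embs \<psi>)"
  shows "mderiv (\<lambda>x. u m (\<psi> m x)) = (\<lambda>x. mcomp (mderiv (u m) (\<psi> m x)) (mderiv (embs \<psi> m) x))"
  using assms by (intro mderiv_comp_fun low_mdiff lowp_mdiff) auto

text \<open>If all derivatives of \<psi> of orders 1 to k are negligible, Faa di Bruno's formula has
  one relevant term, D^k u applied to k copies of D \<psi>, hence \<open>a ^ k\<close>. This case
  precedes the general one because there, after one derivative has been taken, the outer factor Du o
  \<psi> is differentiated only k - 1 times, and up to that order the derivatives of \<psi> are
  indeed negligible.\<close>

lemma comp_top0:
  assumes "1 \<le> k" "low k u" "lowp k (embs \<psi>)" "adm \<psi>" "0 \<le> c"
    and "S (\<lambda>m. mderivs k (u m)) c" "S (\<lambda>m. mderivs k (embs \<psi> m)) 0"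
    and a: "\<And>m x. norm (mderiv (embs \<psi> m) x) \<le> a"
  shows "S (\<lambda>m. mderivs k (\<lambda>x. u m (\<psi> m x))) (c * a ^ k)"
  using assms(1-7)
proof (induction k arbitrary: u c rule: less_induct)
  case (less k)
  obtain i where k: "k = Suc i" using less.prems by (cases k) auto
  have eq: "(\<lambda>m. mderivs k (\<lambda>x. u m (\<psi> m x))) = (\<lambda>m. mderivs i (\<lambda>x. mcomp (mderiv (u m) (\<psi> m x)) (mderiv (embs \<psi> m) x)))"
    using mderiv_comp_family less.prems unfolding k mderivs_Suc by presburger
  show ?case
  proof (cases "i = 0")
    case True
    have "S (\<lambda>m x. mcomp (mderiv (u m) (\<psi> m x)) (mderiv (embs \<psi> m) x)) (c * a)"
      using less.prems True
      by (intro S_bil_left[OF contr_bilinear_mcomp S_comp[of "\<lambda>m. mderiv (u m)"] _ _ a]) (simp_all add: k mderivs_Suc)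
    then show ?thesis unfolding eq using True by (simp add: k)
  next
    case False
    have low: "low i (\<lambda>m. mderiv (u m))" "low i (\<lambda>m. mderiv (embs \<psi> m))"
      using less.prems low_lowp lowp_mderiv unfolding k by auto
    have lp: "lowp j (embs \<psi>)" if "j \<le> k" for j
      using less.prems(3) that mdiff_mono[of k _ j] by (auto simp: lowp_def)
    have psi0: "S (\<lambda>m. mderivs j (embs \<psi> m)) 0" if "1 \<le> j" "j \<le> k" for j
      using less.prems(3,7) that by (cases "j = k") (auto simp: lowp_def)
    \<comment> \<open>Used twice: with e = 0 for the orders below i, and with e = c at order
      i.\<close>
    have v: "S (\<lambda>m. mderivs j (\<lambda>x. mderiv (u m) (\<psi> m x))) (e * a ^ j)"
      if "1 \<le> j" "j \<le> i" "0 \<le> e" "S (\<lambda>m. mderivs j (mderiv (u m))) e" for j e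
      using that low(1) less.prems(4) psi0[of j] lp[of j] low_mono[of i _ j]
      by (intro less.IH) (auto simp: k)
    have "S (\<lambda>m. mderivs j (\<lambda>x. mderiv (u m) (\<psi> m x))) 0" if "j < i" for j
    proof (cases "j = 0")
      case True
      then show ?thesis using S_comp[OF low_S0[OF low(1)] less.prems(4)] False by simp
    next
      case j: False
      then show ?thesis using v[of j 0] low_S[OF low(1) that] that by simp
    qed
    moreover have "mdiff i (\<lambda>x. mderiv (u m) (\<psi> m x))" for m
      using lp[of i] by (intro mdiff_comp[OF low_mdiff[OF low(1)] lowp_mdiff]) (auto simp: k)
    ultimately have lowv: "low i (\<lambda>m x. mderiv (u m) (\<psi> m x))"
      by (simp add: low_def)
    obtain \<alpha> where \<alpha>: "\<And>m x. norm (mderiv (u m) x) \<le> \<alpha>"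
      using S_bounded[OF low_S0[OF low(1)]] False by auto
    have "S (\<lambda>m. mderivs i (\<lambda>x. mcomp (mderiv (u m) (\<psi> m x)) (mderiv (embs \<psi> m) x))) ((c * a ^ i) * a + \<alpha> * 0)"
    proof (rule bil_top[OF contr_bilinear_mcomp lowv low(2) _ _ _ _ _ \<alpha> a])
      show "S (\<lambda>m. mderivs i (\<lambda>x. mderiv (u m) (\<psi> m x))) (c * a ^ i)"
        using v[of i c] False less.prems by (simp add: k mderivs_Suc)
      show "S (\<lambda>m. mderivs i (mderiv (embs \<psi> m))) 0" using less.prems by (simp add: k mderivs_Suc)
      show "0 \<le> c * a ^ i" using less.prems a norm_ge_zero order_trans
        by (meson mult_nonneg_nonneg zero_le_power)
    qed (use False in auto)
    then show ?thesis unfolding eq by (simp add: k mult_ac)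
  qed
qed

text \<open>The second relevant term of Faa di Bruno's formula is Du applied to D^k \<psi>. It
  arises when all remaining derivatives fall on the inner factor D \<psi> of the chain rule; the
  other extreme term of Leibniz's rule is left to \<open>comp_top0\<close>.\<close>

lemma comp_top:
  assumes "1 \<le> k" "low k u" "lowp k (embs \<psi>)" "adm \<psi>" "0 \<le> c" "0 \<le> d"
    and "S (\<lambda>m. mderivs k (u m)) c" "S (\<lambda>m. mderivs k (embs \<psi> m)) d"
    and a: "\<And>m x. norm (mderiv (embs \<psi> m) x) \<le> a"
    and b: "\<And>m x. norm (mderiv (u m) x) \<le> b"
  shows "S (\<lambda>m. mderivs k (\<lambda>x. u m (\<psi> m x))) (c * a ^ k + b * d)"
    and "low k (\<lambda>m x. u m (\<psi> m x))"
proof -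
  obtain i where k: "k = Suc i" using assms by (cases k) auto
  have eq: "(\<lambda>m. mderivs k (\<lambda>x. u m (\<psi> m x))) = (\<lambda>m. mderivs i (\<lambda>x. mcomp (mderiv (u m) (\<psi> m x)) (mderiv (embs \<psi> m) x)))"
    using mderiv_comp_family assms unfolding k mderivs_Suc by presburger
  have low: "low i (\<lambda>m. mderiv (u m))" "low i (\<lambda>m. mderiv (embs \<psi> m))"
    using assms low_lowp lowp_mderiv unfolding k by auto
  have lp: "lowp j (embs \<psi>)" if "j \<le> k" for j
    using assms(3) that mdiff_mono[of k _ j] by (auto simp: lowp_def)
  have psi0: "S (\<lambda>m. mderivs j (embs \<psi> m)) 0" if "1 \<le> j" "j < k" for j
    using assms(3) that by (auto simp: lowp_def)
  have lowv: "low j (\<lambda>m x. v m (\<psi> m x))" if "j \<le> k" "low j v" for j v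
    unfolding low_def
  proof (intro conjI allI impI)
    show "mdiff j (\<lambda>x. v m (\<psi> m x))" for m
      using mdiff_comp[OF low_mdiff[OF that(2)] lowp_mdiff[OF lp[OF that(1)]]] .
    fix l assume "l < j"
    show "S (\<lambda>m. mderivs l (\<lambda>x. v m (\<psi> m x))) 0"
    proof (cases "l = 0")
      case True
      then show ?thesis using S_comp[OF low_S0[OF that(2)] assms(4)] \<open>l < j\<close> by simp
    next
      case False
      then have "S (\<lambda>m. mderivs l (\<lambda>x. v m (\<psi> m x))) (0 * a ^ l)"
        using that \<open>l < j\<close> assms(4) low_S[OF that(2)] low_mono[OF that(2), of l] lp psi0
        by (intro comp_top0 a) auto
      then show ?thesis by simp
    qed
  qed
  then show "low k (\<lambda>m x. u m (\<psi> m x))" using assms(2) by simp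
  have ca: "0 \<le> c * a ^ i" using assms(5) a norm_ge_zero order_trans
    by (meson mult_nonneg_nonneg zero_le_power)
  show "S (\<lambda>m. mderivs k (\<lambda>x. u m (\<psi> m x))) (c * a ^ k + b * d)"
  proof (cases "i = 0")
    case True
    \<comment> \<open>At order 1 neither factor is negligible, so Leibniz's estimate does not apply;
      \<open>S_bil\<close> treats both factors as unknown.\<close>
    have "S (\<lambda>m x. mcomp (mderiv (u m) (\<psi> m x)) (mderiv (embs \<psi> m) x)) (c * a + b * d)"
      using assms True
      by (intro S_bil[OF contr_bilinear_mcomp S_comp[of "\<lambda>m. mderiv (u m)"] _ _ _ b a]) (simp_all add: k mderivs_Suc)
    then show ?thesis unfolding eq using True by (simp add: k)
  next
    case False
    have "S (\<lambda>m. mderivs i (\<lambda>x. mcomp (mderiv (u m) (\<psi> m x)) (mderiv (embs \<psi> m) x))) ((c * a ^ i) * a + b * d)"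
    proof (rule bil_top[OF contr_bilinear_mcomp lowv[OF _ low(1)] low(2) _ _ _ _ _ b a])
      show "S (\<lambda>m. mderivs i (\<lambda>x. mderiv (u m) (\<psi> m x))) (c * a ^ i)"
        using False assms low psi0[of i] lp[of i]
        by (intro comp_top0 a) (auto simp: k mderivs_Suc)
      show "S (\<lambda>m. mderivs i (mderiv (embs \<psi> m))) d" using assms by (simp add: k mderivs_Suc)
    qed (use False assms ca in \<open>auto simp: k\<close>)
    then show ?thesis unfolding eq by (simp add: k mult_ac)
  qed
qed

lemma add_top:
  assumes "\<And>m. mdiff k (u m)" "\<And>m. mdiff k (w m)" "S (\<lambda>m. mderivs k (u m)) c" "S (\<lambda>m. mderivs k (w m)) d"
  shows "S (\<lambda>m. mderivs k (\<lambda>x. u m x + w m x)) (c + d)"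
proof -
  have "(\<lambda>m. mderivs k (\<lambda>x. u m x + w m x)) = (\<lambda>m x. mderivs k (u m) x + mderivs k (w m) x)"
    using mderivs_add[OF assms(1,2)] by auto
  then show ?thesis using S_add[OF assms(3,4)] by simp
qed

lemma mpost_top:
  assumes "bounded_linear L" "\<And>x. norm (L x) \<le> l * norm x" "0 \<le> l" "0 \<le> c"
    "\<And>m. mdiff k (u m)" "S (\<lambda>m. mderivs k (u m)) c"
  shows "S (\<lambda>m. mderivs k (\<lambda>x. mpost L (u m x))) (l * c)"
proof -
  have "(\<lambda>m. mderivs k (\<lambda>x. mpost L (u m x))) = (\<lambda>m x. mpost L (mderivs k (u m) x))"
    using mderivs_mpost[OF assms(1,5)] by auto
  then show ?thesis using S_mpost[OF assms(1-4,6)] by simp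
qed

lemma linear_top:
  assumes "bounded_linear L" "1 \<le> k"
  shows "S (\<lambda>m. mderivs k (\<lambda>x. mconst (L x))) 0"
proof -
  obtain w where "\<forall>x. mderivs k (\<lambda>x. mconst (L x)) x = w"
    using linear_mderivs(2)[OF assms(1), of "k - 1"] assms(2) by auto
  then have "(\<lambda>m::nat. mderivs k (\<lambda>x. mconst (L x))) = (\<lambda>m x. w)" by (auto simp: fun_eq_iff)
  then show ?thesis using S_const by simp
qed

end

text \<open>\<open>N m\<close> is to be the weighted supremum of the derivatives of order j at the
  m-th iterate, and c the coefficient with which it enters; C absorbs all that is already bounded.
  For c = 0 this is boundedness uniform in m and x.\<close>

definition bounded_modulo :: "(nat \<Rightarrow> real) \<Rightarrow> (nat \<Rightarrow> 'a \<Rightarrow> 'b::real_normed_vector) \<Rightarrow> real \<Rightarrow> bool"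
  where "bounded_modulo N u c \<longleftrightarrow> (\<exists>C. \<forall>m x. norm (u m x) \<le> c * N m + C)"

lemma contr_bilinear_norm: "contr_bilinear B \<Longrightarrow> norm (B a b) \<le> norm a * norm b"
  by (simp add: contr_bilinear_def)

lemma bounded_modulo_size_system:
  assumes N: "\<And>m. 0 \<le> N m"
  shows "size_system (bounded_modulo N) (\<lambda>\<psi>. True)"
proof
  fix u w :: "nat \<Rightarrow> 'a::real_normed_vector \<Rightarrow> ('a, 'a) multilin" and c d :: real
  show "bounded_modulo N u d" if "bounded_modulo N u c" "c \<le> d"
    using that mult_right_mono[OF that(2) N] unfolding bounded_modulo_def by (meson add_right_mono order_trans)
  show "bounded_modulo N (\<lambda>m x. u m x + w m x) (c + d)" if uw: "bounded_modulo N u c" "bounded_modulo N w d"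
  proof -
    obtain C D where "\<And>m x. norm (u m x) \<le> c * N m + C" "\<And>m x. norm (w m x) \<le> d * N m + D"
      using uw unfolding bounded_modulo_def by metis
    then have "norm (u m x + w m x) \<le> (c + d) * N m + (C + D)" for m x
      using norm_triangle_ineq[of "u m x" "w m x"] by (smt (verit) distrib_right)
    then show ?thesis by (auto simp: bounded_modulo_def)
  qed
  show "bounded_modulo N (\<lambda>m x. z) 0" for z :: "('a, 'a) multilin" by (auto simp: bounded_modulo_def)
  show "\<exists>\<alpha>. \<forall>m x. norm (u m x) \<le> \<alpha>" if "bounded_modulo N u 0" using that by (auto simp: bounded_modulo_def)
  show left: "bounded_modulo N (\<lambda>m x. B (u m x) (w m x)) (c * \<beta>)"
    if B: "contr_bilinear B" and u: "bounded_modulo N u c" and \<beta>: "\<And>m x. norm (w m x) \<le> \<beta>"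
    for B :: "('a, 'a) multilin \<Rightarrow> ('a, 'a) multilin \<Rightarrow> ('a, 'a) multilin"
      and u w :: "nat \<Rightarrow> 'a \<Rightarrow> ('a, 'a) multilin" and \<beta> c
  proof -
    obtain C where C: "\<And>m x. norm (u m x) \<le> c * N m + C" using u by (auto simp: bounded_modulo_def)
    have "norm (B (u m x) (w m x)) \<le> (c * N m + C) * \<beta>" for m x
      using contr_bilinear_norm[OF B, of "u m x" "w m x"] mult_mono[OF C[of m x] \<beta>[of m x]]
        norm_ge_zero[of "u m x"] norm_ge_zero[of "w m x"] C[of m x] by linarith
    then have "norm (B (u m x) (w m x)) \<le> c * \<beta> * N m + C * \<beta>" for m x
      by (simp add: algebra_simps)
    then show ?thesis by (auto simp: bounded_modulo_def)
  qed
  show "bounded_modulo N (\<lambda>m x. B (u m x) (w m x)) (\<alpha> * d)"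
    if B: "contr_bilinear B" and w: "bounded_modulo N w d" and \<alpha>: "\<And>m x. norm (u m x) \<le> \<alpha>"
    for B :: "('a, 'a) multilin \<Rightarrow> ('a, 'a) multilin \<Rightarrow> ('a, 'a) multilin" and \<alpha>
  proof -
    obtain C where C: "\<And>m x. norm (w m x) \<le> d * N m + C" using w by (auto simp: bounded_modulo_def)
    have "norm (B (u m x) (w m x)) \<le> \<alpha> * (d * N m + C)" for m x
      using contr_bilinear_norm[OF B, of "u m x" "w m x"] mult_mono[OF \<alpha>[of m x] C[of m x]]
        norm_ge_zero[of "u m x"] norm_ge_zero[of "w m x"] \<alpha>[of m x] by linarith
    then have "norm (B (u m x) (w m x)) \<le> \<alpha> * d * N m + \<alpha> * C" for m x
      by (simp add: algebra_simps)
    then show ?thesis by (auto simp: bounded_modulo_def)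
  qed
  show "bounded_modulo N (\<lambda>m x. B (u m x) (w m x)) (c * \<beta> + \<alpha> * d)"
    if B: "contr_bilinear B" and c: "bounded_modulo N u c" and d: "0 \<le> d" and \<alpha>: "\<And>m x. norm (u m x) \<le> \<alpha>"
      and \<beta>: "\<And>m x. norm (w m x) \<le> \<beta>"
    for B :: "('a, 'a) multilin \<Rightarrow> ('a, 'a) multilin \<Rightarrow> ('a, 'a) multilin" and \<alpha> \<beta>
  proof -
    \<comment> \<open>Already \<open>c * \<beta>\<close> is a valid coefficient, because
      \<open>w\<close> is bounded by \<beta>; a nonnegative amount may be added to it.\<close>
    have "0 \<le> \<alpha> * d" using \<alpha> d norm_ge_zero order_trans by (meson mult_nonneg_nonneg)
    obtain C where C: "\<And>m x. norm (B (u m x) (w m x)) \<le> c * \<beta> * N m + C"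
      using left[OF B c, of w \<beta>] \<beta> unfolding bounded_modulo_def by blast
    have "norm (B (u m x) (w m x)) \<le> (c * \<beta> + \<alpha> * d) * N m + C" for m x
      using C[of m x] mult_nonneg_nonneg[OF \<open>0 \<le> \<alpha> * d\<close> N[of m]] by (simp add: distrib_right)
    then show ?thesis by (auto simp: bounded_modulo_def)
  qed
  show "bounded_modulo N (\<lambda>m x. u m (\<psi> m x)) c" if "bounded_modulo N u c" for \<psi> using that by (auto simp: bounded_modulo_def)
  show "bounded_modulo N (\<lambda>m x. mpost L (u m x)) (l * c)"
    if L: "bounded_linear L" "\<And>x. norm (L x) \<le> l * norm x" "0 \<le> l" and u: "bounded_modulo N u c" for L l
  proof -
    obtain C where C: "\<And>m x. norm (u m x) \<le> c * N m + C" using u by (auto simp: bounded_modulo_def)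
    have "norm (mpost L (u m x)) \<le> l * c * N m + l * C" for m x
      using norm_mpost_le[OF L(1,3,2), of "u m x"] mult_left_mono[OF C[of m x] L(3)]
      by (simp add: algebra_simps)
    then show ?thesis by (auto simp: bounded_modulo_def)
  qed
  show "bounded_modulo N u c"
    if L: "bounded_linear L1" "bounded_linear L2" "bounded_linear L3"
      "\<And>x. norm x \<le> max (norm (L1 x)) (max (norm (L2 x)) (norm (L3 x)))"
      and S: "bounded_modulo N (\<lambda>m x. mpost L1 (u m x)) c" "bounded_modulo N (\<lambda>m x. mpost L2 (u m x)) c"
      "bounded_modulo N (\<lambda>m x. mpost L3 (u m x)) c" for L1 L2 L3 :: "'a \<Rightarrow> 'a"
  proof -
    obtain C1 C2 C3 where C: "\<And>m x. norm (mpost L1 (u m x)) \<le> c * N m + C1"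
      "\<And>m x. norm (mpost L2 (u m x)) \<le> c * N m + C2" "\<And>m x. norm (mpost L3 (u m x)) \<le> c * N m + C3"
      using S unfolding bounded_modulo_def by metis
    have "norm (u m x) \<le> c * N m + max C1 (max C2 C3)" for m x
      using C[of m x] by (intro mpost_split[OF L(1-3), of "u m x"] L(4)) linarith+
    then show ?thesis by (auto simp: bounded_modulo_def)
  qed
qed

section \<open>The asymptotic oscillation as a notion of size\<close>

definition tail_nhds :: "'a::topological_space \<Rightarrow> (nat \<times> 'a) filter"
  where "tail_nhds x = sequentially \<times>\<^sub>F nhds x"

text \<open>A Cauchy condition in both the index and the point: c bounds the limit superior of the
  distances as (m, y) and (l, z) run along \<open>tail_nhds x\<close>. The points move because
  compositions evaluate iterates at iterates, and no limit function has to be known in advance.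
  Boundedness is included for the sake of products.\<close>

definition osc :: "(nat \<Rightarrow> 'a::topological_space \<Rightarrow> 'b::real_normed_vector) \<Rightarrow> real \<Rightarrow> bool"
  where "osc u c \<longleftrightarrow> (\<exists>\<alpha>. \<forall>m x. norm (u m x) \<le> \<alpha>) \<and>
    (\<forall>x. \<forall>e>0. \<exists>P. eventually P (tail_nhds x) \<and>
      (\<forall>m y l z. P (m, y) \<longrightarrow> P (l, z) \<longrightarrow> norm (u m y - u l z) \<le> c + e))"

text \<open>Continuous convergence of inner functions, with the index retained: the outer function
  carries the same index m, so the pair (m, \<psi> m y) has to follow
  \<open>tail_nhds x'\<close>.\<close>

definition cont_conv :: "(nat \<Rightarrow> 'a \<Rightarrow> 'a::topological_space) \<Rightarrow> bool"
  where "cont_conv \<psi> \<longleftrightarrow> (\<forall>x. \<exists>x'. filterlim (\<lambda>(m, y). (m, \<psi> m y)) (tail_nhds x') (tail_nhds x))"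

lemma oscI:
  assumes "\<And>m x. norm (u m x) \<le> \<alpha>"
    "\<And>x e. 0 < e \<Longrightarrow> \<exists>P. eventually P (tail_nhds x) \<and>
      (\<forall>m y l z. P (m, y) \<longrightarrow> P (l, z) \<longrightarrow> norm (u m y - u l z) \<le> c + e)"
  shows "osc u c"
  using assms unfolding osc_def by blast

lemma oscD:
  assumes "osc u c" "0 < e"
  obtains P where "eventually P (tail_nhds x)" "\<And>m y l z. P (m, y) \<Longrightarrow> P (l, z) \<Longrightarrow> norm (u m y - u l z) \<le> c + e"
  using assms unfolding osc_def by blast

lemma osc_bounded: "osc u c \<Longrightarrow> \<exists>\<alpha>. \<forall>m x. norm (u m x) \<le> \<alpha>"
  by (simp add: osc_def)

lemma osc_mono:
  assumes "osc u c" "c \<le> d" shows "osc u d"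
proof -
  obtain \<alpha> where "\<And>m x. norm (u m x) \<le> \<alpha>" using osc_bounded[OF assms(1)] by blast
  then show ?thesis
  proof (rule oscI)
    fix x and e :: real assume "0 < e"
    obtain P where P: "eventually P (tail_nhds x)" "\<And>m y l z. P (m, y) \<Longrightarrow> P (l, z) \<Longrightarrow> norm (u m y - u l z) \<le> c + e"
      using oscD[OF assms(1) \<open>0 < e\<close>] by blast
    have "norm (u m y - u l z) \<le> d + e" if "P (m, y)" "P (l, z)" for m y l z
      using P(2)[OF that] assms(2) by simp
    then show "\<exists>P. eventually P (tail_nhds x) \<and> (\<forall>m y l z. P (m, y) \<longrightarrow> P (l, z) \<longrightarrow> norm (u m y - u l z) \<le> d + e)"
      using P(1) by blast
  qed
qed

lemma osc_bil:
  fixes u w :: "nat \<Rightarrow> 'a::real_normed_vector \<Rightarrow> ('a, 'a) multilin"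
  assumes B: "contr_bilinear B" and u: "osc u c" and w: "osc w d"
    and \<alpha>: "\<And>m x. norm (u m x) \<le> \<alpha>" and \<beta>: "\<And>m x. norm (w m x) \<le> \<beta>"
  shows "osc (\<lambda>m x. B (u m x) (w m x)) (c * \<beta> + \<alpha> * d)"
proof (rule oscI)
  have \<alpha>0: "0 \<le> \<alpha>" and \<beta>0: "0 \<le> \<beta>" using \<alpha> \<beta> norm_ge_zero order_trans by blast+
  show "norm (B (u m x) (w m x)) \<le> \<alpha> * \<beta>" for m x
    using contr_bilinear_norm[OF B, of "u m x" "w m x"] mult_mono[OF \<alpha>[of m x] \<beta>[of m x] \<alpha>0] by simp
  fix x :: 'a and e :: real assume "0 < e"
  define e' where "e' = e / (\<alpha> + \<beta> + 1)"
  have e': "0 < e'" "e' * \<beta> + \<alpha> * e' \<le> e"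
    using \<open>0 < e\<close> \<alpha>0 \<beta>0 by (auto simp: e'_def field_simps add_pos_nonneg)
  obtain P where P: "eventually P (tail_nhds x)" "\<And>m y l z. P (m, y) \<Longrightarrow> P (l, z) \<Longrightarrow> norm (u m y - u l z) \<le> c + e'"
    using oscD[OF u e'(1)] by blast
  obtain Q where Q: "eventually Q (tail_nhds x)" "\<And>m y l z. Q (m, y) \<Longrightarrow> Q (l, z) \<Longrightarrow> norm (w m y - w l z) \<le> d + e'"
    using oscD[OF w e'(1)] by blast
  interpret B: bounded_bilinear B using B by (simp add: contr_bilinear_def)
  have "norm (B (u m y) (w m y) - B (u l z) (w l z)) \<le> (c * \<beta> + \<alpha> * d) + e"
    if "P (m, y)" "Q (m, y)" "P (l, z)" "Q (l, z)" for m y l z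
  proof -
    have "B (u m y) (w m y) - B (u l z) (w l z) = B (u m y - u l z) (w m y) + B (u l z) (w m y - w l z)"
      by (simp add: B.diff_left B.diff_right)
    note eq = this
    have "norm (B (u m y) (w m y) - B (u l z) (w l z))
      \<le> norm (u m y - u l z) * norm (w m y) + norm (u l z) * norm (w m y - w l z)"
      unfolding eq using norm_triangle_ineq[of "B (u m y - u l z) (w m y)" "B (u l z) (w m y - w l z)"]
        contr_bilinear_norm[OF B, of "u m y - u l z" "w m y"] contr_bilinear_norm[OF B, of "u l z" "w m y - w l z"] by linarith
    also have "\<dots> \<le> (c + e') * \<beta> + \<alpha> * (d + e')"
      using P(2)[OF that(1,3)] Q(2)[OF that(2,4)] \<alpha>[of l z] \<beta>[of m y] \<alpha>0 \<beta>0
      by (intro add_mono mult_mono) (auto intro: order_trans[OF norm_ge_zero])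
    also have "\<dots> \<le> (c * \<beta> + \<alpha> * d) + e" using e'(2) by (simp add: algebra_simps)
    finally show ?thesis .
  qed
  then show "\<exists>P. eventually P (tail_nhds x) \<and> (\<forall>m y l z. P (m, y) \<longrightarrow> P (l, z) \<longrightarrow>
      norm (B (u m y) (w m y) - B (u l z) (w l z)) \<le> c * \<beta> + \<alpha> * d + e)"
    using eventually_conj[OF P(1) Q(1)] by (intro exI[of _ "\<lambda>p. P p \<and> Q p"]) auto
qed

lemma osc_size_system: "size_system osc cont_conv"
proof
  fix u w :: "nat \<Rightarrow> 'a::real_normed_vector \<Rightarrow> ('a, 'a) multilin" and c d :: real
  show "osc u d" if "osc u c" "c \<le> d" using that by (rule osc_mono)
  show "osc (\<lambda>m x. u m x + w m x) (c + d)" if uw: "osc u c" "osc w d"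
  proof -
    obtain \<alpha> \<beta> where "\<And>m x. norm (u m x) \<le> \<alpha>" "\<And>m x. norm (w m x) \<le> \<beta>"
      using uw osc_bounded by metis
    then have "norm (u m x + w m x) \<le> \<alpha> + \<beta>" for m x
      using norm_triangle_mono by blast
    then show ?thesis
    proof (rule oscI)
      fix x :: 'a and e :: real assume "0 < e"
      then have e: "0 < e / 2" by simp
      obtain P where P: "eventually P (tail_nhds x)" "\<And>m y l z. P (m, y) \<Longrightarrow> P (l, z) \<Longrightarrow> norm (u m y - u l z) \<le> c + e/2"
        using oscD[OF uw(1) e] by blast
      obtain Q where Q: "eventually Q (tail_nhds x)" "\<And>m y l z. Q (m, y) \<Longrightarrow> Q (l, z) \<Longrightarrow> norm (w m y - w l z) \<le> d + e/2"
        using oscD[OF uw(2) e] by blast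
      have "norm ((u m y + w m y) - (u l z + w l z)) \<le> c + d + e"
        if "P (m, y)" "Q (m, y)" "P (l, z)" "Q (l, z)" for m y l z
        using P(2)[OF that(1,3)] Q(2)[OF that(2,4)] norm_triangle_ineq[of "u m y - u l z" "w m y - w l z"]
        by (simp add: algebra_simps)
      then show "\<exists>P. eventually P (tail_nhds x) \<and> (\<forall>m y l z. P (m, y) \<longrightarrow> P (l, z) \<longrightarrow>
          norm ((u m y + w m y) - (u l z + w l z)) \<le> c + d + e)"
        using eventually_conj[OF P(1) Q(1)] by (intro exI[of _ "\<lambda>p. P p \<and> Q p"]) auto
    qed
  qed
  show "osc (\<lambda>m (x::'a). z) 0" for z :: "('a, 'a) multilin"
    by (rule oscI[of _ "norm z"]) (auto intro: exI[of _ "\<lambda>_. True"])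
  show "\<exists>\<alpha>. \<forall>m x. norm (u m x) \<le> \<alpha>" if "osc u 0" using that by (rule osc_bounded)
  show "osc (\<lambda>m x. B (u m x) (w m x)) (c * \<beta> + \<alpha> * d)"
    if "contr_bilinear B" "osc u c" "osc w d" "\<And>m x. norm (u m x) \<le> \<alpha>" "\<And>m x. norm (w m x) \<le> \<beta>" for B \<alpha> \<beta>
    using that by (rule osc_bil)
  show "osc (\<lambda>m x. B (u m x) (w m x)) (c * \<beta>)"
    if h: "contr_bilinear B" "osc u c" "osc w 0" "\<And>m x. norm (w m x) \<le> \<beta>" for B \<beta>
  proof -
    obtain \<alpha> where "\<And>m x. norm (u m x) \<le> \<alpha>" using osc_bounded[OF h(2)] by blast
    then show ?thesis using osc_bil[OF h(1-3) _ h(4), of \<alpha>] by simp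
  qed
  show "osc (\<lambda>m x. B (u m x) (w m x)) (\<alpha> * d)"
    if h: "contr_bilinear B" "osc u 0" "osc w d" "\<And>m x. norm (u m x) \<le> \<alpha>" for B \<alpha>
  proof -
    obtain \<beta> where "\<And>m x. norm (w m x) \<le> \<beta>" using osc_bounded[OF h(3)] by blast
    then show ?thesis using osc_bil[OF h(1-4), of \<beta>] by simp
  qed
  show "osc (\<lambda>m x. u m (\<psi> m x)) c" if u: "osc u c" and \<psi>: "cont_conv \<psi>" for \<psi>
  proof -
    obtain \<alpha> where "\<And>m x. norm (u m x) \<le> \<alpha>" using osc_bounded[OF u] by blast
    then show ?thesis
    proof (intro oscI[of _ \<alpha>])
      fix x and e :: real assume "0 < e"
      obtain x' where x': "filterlim (\<lambda>(m, y). (m, \<psi> m y)) (tail_nhds x') (tail_nhds x)"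
        using \<psi> by (auto simp: cont_conv_def)
      obtain P where P: "eventually P (tail_nhds x')" "\<And>m y l z. P (m, y) \<Longrightarrow> P (l, z) \<Longrightarrow> norm (u m y - u l z) \<le> c + e"
        using oscD[OF u \<open>0 < e\<close>] by blast
      have "eventually (\<lambda>p. P (fst p, \<psi> (fst p) (snd p))) (tail_nhds x)"
        using x' P(1) by (auto simp: filterlim_iff case_prod_unfold)
      then show "\<exists>P. eventually P (tail_nhds x) \<and> (\<forall>m y l z. P (m, y) \<longrightarrow> P (l, z) \<longrightarrow>
          norm (u m (\<psi> m y) - u l (\<psi> l z)) \<le> c + e)"
        using P(2) by (intro exI[of _ "\<lambda>p. P (fst p, \<psi> (fst p) (snd p))"]) auto
    qed auto
  qed
  show "osc (\<lambda>m x. mpost L (u m x)) (l * c)"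
    if L: "bounded_linear L" "\<And>x. norm (L x) \<le> l * norm x" "0 \<le> l" and u: "osc u c" for L l
  proof -
    obtain \<alpha> where \<alpha>: "\<And>m x. norm (u m x) \<le> \<alpha>" using osc_bounded[OF u] by blast
    have "norm (mpost L (u m x)) \<le> l * \<alpha>" for m x
      using norm_mpost_le[OF L(1,3,2), of "u m x"] mult_left_mono[OF \<alpha> L(3), of m x] by linarith
    then show ?thesis
    proof (rule oscI)
      fix x :: 'a and e :: real assume "0 < e"
      then have e: "0 < e / (l + 1)" using L by simp
      obtain P where P: "eventually P (tail_nhds x)"
        "\<And>m y l' z. P (m, y) \<Longrightarrow> P (l', z) \<Longrightarrow> norm (u m y - u l' z) \<le> c + e / (l + 1)"
        using oscD[OF u e] by blast
      have "norm (mpost L (u m y) - mpost L (u l' z)) \<le> l * c + e" if "P (m, y)" "P (l', z)" for m y l' z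
      proof -
        have "norm (mpost L (u m y) - mpost L (u l' z)) = norm (mpost L (u m y - u l' z))"
          by (simp add: linear_simps[OF bounded_linear_mpost[OF L(1)]])
        also have "\<dots> \<le> l * (c + e / (l + 1))"
          using norm_mpost_le[OF L(1,3,2), of "u m y - u l' z"] mult_left_mono[OF P(2)[OF that] L(3)] by linarith
        also have "\<dots> \<le> l * c + e" using \<open>0 < e\<close> L(3) by (simp add: field_simps)
        finally show ?thesis .
      qed
      then show "\<exists>P. eventually P (tail_nhds x) \<and> (\<forall>m y l' z. P (m, y) \<longrightarrow> P (l', z) \<longrightarrow>
          norm (mpost L (u m y) - mpost L (u l' z)) \<le> l * c + e)"
        using P(1) by blast
    qed
  qed
  show "osc u c"
    if L: "bounded_linear L1" "bounded_linear L2" "bounded_linear L3"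
      "\<And>x. norm x \<le> max (norm (L1 x)) (max (norm (L2 x)) (norm (L3 x)))"
      and S: "osc (\<lambda>m x. mpost L1 (u m x)) c" "osc (\<lambda>m x. mpost L2 (u m x)) c"
      "osc (\<lambda>m x. mpost L3 (u m x)) c" for L1 L2 L3 :: "'a \<Rightarrow> 'a"
  proof -
    obtain C1 C2 C3 where C: "\<And>m x. norm (mpost L1 (u m x)) \<le> C1"
      "\<And>m x. norm (mpost L2 (u m x)) \<le> C2" "\<And>m x. norm (mpost L3 (u m x)) \<le> C3"
      using S osc_bounded by metis
    have "norm (u m x) \<le> max C1 (max C2 C3)" for m x
      using C[of m x] by (intro mpost_split[OF L(1-3), of "u m x"] L(4)) linarith+
    then show ?thesis
    proof (rule oscI)
      fix x :: 'a and e :: real assume e: "0 < e"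
      have ex: "\<exists>P. eventually P (tail_nhds x) \<and> (\<forall>m y l z. P (m, y) \<longrightarrow> P (l, z) \<longrightarrow> norm (mpost L (u m y - u l z)) \<le> c + e)"
        if "bounded_linear L" "osc (\<lambda>m x. mpost L (u m x)) c" for L
        using oscD[OF that(2) e] linear_simps(2)[OF bounded_linear_mpost[OF that(1)]] by metis
      obtain P1 where P1: "eventually P1 (tail_nhds x)"
        "\<And>m y l z. P1 (m, y) \<Longrightarrow> P1 (l, z) \<Longrightarrow> norm (mpost L1 (u m y - u l z)) \<le> c + e"
        using ex[OF L(1) S(1)] by blast
      obtain P2 where P2: "eventually P2 (tail_nhds x)"
        "\<And>m y l z. P2 (m, y) \<Longrightarrow> P2 (l, z) \<Longrightarrow> norm (mpost L2 (u m y - u l z)) \<le> c + e"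
        using ex[OF L(2) S(2)] by blast
      obtain P3 where P3: "eventually P3 (tail_nhds x)"
        "\<And>m y l z. P3 (m, y) \<Longrightarrow> P3 (l, z) \<Longrightarrow> norm (mpost L3 (u m y - u l z)) \<le> c + e"
        using ex[OF L(3) S(3)] by blast
      have "norm (u m y - u l z) \<le> c + e"
        if "P1 (m, y) \<and> P2 (m, y) \<and> P3 (m, y)" "P1 (l, z) \<and> P2 (l, z) \<and> P3 (l, z)" for m y l z
        using that by (intro mpost_split[OF L(1-3), of "u m y - u l z"] L(4) P1(2) P2(2) P3(2)) auto
      then show "\<exists>P. eventually P (tail_nhds x) \<and> (\<forall>m y l z. P (m, y) \<longrightarrow> P (l, z) \<longrightarrow> norm (u m y - u l z) \<le> c + e)"
        using eventually_conj[OF P1(1) eventually_conj[OF P2(1) P3(1)]]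
        by (intro exI[of _ "\<lambda>p. P1 p \<and> P2 p \<and> P3 p"]) auto
    qed
  qed
qed

section \<open>The invariance equation\<close>

abbreviation emb :: "('a \<Rightarrow> 'b) \<Rightarrow> 'a \<Rightarrow> ('a::real_normed_vector, 'b::real_normed_vector) multilin"
  where "emb f \<equiv> (\<lambda>x. mconst (f x))"

lemma norm_diff_le_mderiv:
  fixes f :: "'a::real_normed_vector \<Rightarrow> 'b::real_normed_vector"
  assumes "\<And>x. emb f differentiable (at x)" "\<And>x. norm (mderiv (emb f) x) \<le> L"
  shows "norm (f x - f y) \<le> L * norm (x - y)"
proof (rule differentiable_bound[of UNIV])
  show "(f has_derivative (\<lambda>v. mapp (mderiv (emb f) x) [v])) (at x within UNIV)" for x
    using mconst_differentiable[OF assms(1)] .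
  have "norm (mapp (mderiv (emb f) x) [v]) \<le> L * norm v" for x v
    using norm_mapp[of "mderiv (emb f) x" "[v]"] mult_right_mono[OF assms(2) norm_ge_zero, of x v] by simp
  then show "onorm (\<lambda>v. mapp (mderiv (emb f) x) [v]) \<le> L" for x
    by (intro onorm_bound) (use assms(2)[of x] norm_ge_zero order_trans in blast)+
qed auto

text \<open>The parameter n is one less than the order of smoothness, so that a first derivative
  always exists. Of the bounds on derivatives only the first is recorded, as it is the one with an
  explicit constant.\<close>

definition C1b :: "nat \<Rightarrow> real \<Rightarrow> ('a::real_normed_vector \<Rightarrow> ('a, 'b::real_normed_vector) multilin) \<Rightarrow> bool"
  where "C1b n b u \<longleftrightarrow> mdiff (Suc n) u \<and> (\<forall>x. norm (mderiv u x) \<le> b)"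

lemma C1b_diff: "C1b n b u \<Longrightarrow> u differentiable (at x)"
  by (simp add: C1b_def mdiff_Suc)

lemma C1b_mdiff: "C1b n b u \<Longrightarrow> mdiff (Suc n) u" and C1b_norm: "C1b n b u \<Longrightarrow> norm (mderiv u x) \<le> b"
  by (simp_all add: C1b_def)

lemma C1b_mono: "C1b n b u \<Longrightarrow> b \<le> c \<Longrightarrow> C1b n c u"
  unfolding C1b_def by (meson order_trans)

lemma C1b_add:
  assumes "C1b n b u" "C1b n c w"
  shows "C1b n (b + c) (\<lambda>x. u x + w x)" "mderiv (\<lambda>x. u x + w x) x = mderiv u x + mderiv w x"
  using assms mdiff_add[OF assms[THEN C1b_mdiff]] norm_triangle_mono[OF assms[THEN C1b_norm]]
  by (auto simp: C1b_def[of n "b + c"] mderiv_add C1b_diff)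

lemma C1b_mpost:
  assumes "bounded_linear L" "\<And>x. norm (L x) \<le> l * norm x" "0 \<le> l" "C1b n b u"
  shows "C1b n (l * b) (\<lambda>x. mpost L (u x))" "mderiv (\<lambda>x. mpost L (u x)) x = mpost L (mderiv u x)"
proof -
  show e: "mderiv (\<lambda>x. mpost L (u x)) x = mpost L (mderiv u x)" for x
    using mderiv_mpost(2)[OF assms(1) C1b_diff[OF assms(4)]] .
  have "norm (mpost L (mderiv u x)) \<le> l * b" for x
    using norm_mpost_le[OF assms(1,3,2), of "mderiv u x"] mult_left_mono[OF C1b_norm[OF assms(4)] assms(3), of x]
    by linarith
  then show "C1b n (l * b) (\<lambda>x. mpost L (u x))"
    using mdiff_mpost[OF assms(1) C1b_mdiff[OF assms(4)]] by (simp add: C1b_def e)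
qed

lemma C1b_comp:
  assumes "C1b n b u" "C1b n a (emb \<psi>)"
  shows "C1b n (b * a) (\<lambda>x. u (\<psi> x))"
    and "mderiv (\<lambda>x. u (\<psi> x)) x = mcomp (mderiv u (\<psi> x)) (mderiv (emb \<psi>) x)"
proof -
  show e: "mderiv (\<lambda>x. u (\<psi> x)) x = mcomp (mderiv u (\<psi> x)) (mderiv (emb \<psi>) x)" for x
    using mderiv_comp_fun[OF assms[THEN C1b_mdiff]] by simp
  have "norm (mcomp (mderiv u (\<psi> x)) (mderiv (emb \<psi>) x)) \<le> b * a" for x
    using contr_bilinear_norm[OF contr_bilinear_mcomp, of "mderiv u (\<psi> x)" "mderiv (emb \<psi>) x"]
      mult_mono[OF C1b_norm[OF assms(1), of "\<psi> x"] C1b_norm[OF assms(2), of x]]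
      norm_ge_zero order_trans[OF norm_ge_zero C1b_norm[OF assms(1)]] by fastforce
  then show "C1b n (b * a) (\<lambda>x. u (\<psi> x))"
    using mdiff_comp[OF assms[THEN C1b_mdiff]] by (simp add: C1b_def e)
qed

lemma C1b_linear:
  assumes "bounded_linear L" "\<And>x. norm (L x) \<le> l * norm x" "0 \<le> l"
  shows "C1b n l (emb L)"
  using assms linear_mderivs(1,3)[OF assms(1)] bounded_linear_compose[OF bounded_linear_mconst assms(1)]
  by (auto simp: C1b_def intro!: norm_munslice_le)

lemma mcomp_zero [simp]: "mcomp 0 c = 0"
  using contr_bilinear_mcomp bounded_bilinear.zero_left by (auto simp: contr_bilinear_def)

text \<open>Here Suc n is the order of smoothness, g is defined on the whole space, k is kc composed
  with the projection, and a, lr, lt, lu, ls stand for the constants L(-1), Lr, Lt, Lu, Ls.\<close>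

locale cm_setting =
  fixes n :: nat and Pc Pu Ps Ac Ic Iu As g k :: "'a::banach \<Rightarrow> 'a"
    and ac aci aui as lg lc lr lt lu ls a :: real
  assumes lin: "bounded_linear Pc" "bounded_linear Pu" "bounded_linear Ps"
      "bounded_linear Ac" "bounded_linear Ic" "bounded_linear Iu" "bounded_linear As"
    and nrm: "\<And>x. norm (Pc x) \<le> 1 * norm x" "\<And>x. norm (Pu x) \<le> 1 * norm x" "\<And>x. norm (Ps x) \<le> 1 * norm x"
      "\<And>x. norm (Ac x) \<le> ac * norm x" "\<And>x. norm (Ic x) \<le> aci * norm x"
      "\<And>x. norm (Iu x) \<le> aui * norm x" "\<And>x. norm (As x) \<le> as * norm x"
    and nn: "0 \<le> ac" "0 \<le> aci" "0 \<le> aui" "0 \<le> as" "0 \<le> lg" "0 \<le> lc" "0 \<le> lr" "0 \<le> lt" "0 \<le> lu" "0 \<le> ls" "0 \<le> a"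
    and mx: "\<And>x. norm x \<le> max (norm (Pc x)) (max (norm (Pu x)) (norm (Ps x)))"
    and proj: "\<And>x. Pc (Pc x) = Pc x" "\<And>x. Pu (Pc x) = 0" "\<And>x. Ps (Pc x) = 0"
      "\<And>x. Ps (Ps x) = Ps x" "\<And>x. Pc (Ps x) = 0" "\<And>x. Pu (Ps x) = 0"
      "\<And>x. Pc (Ac x) = Ac x" "\<And>x. Pu (Ac x) = 0" "\<And>x. Ps (Ac x) = 0" "\<And>x. Pc (Ic x) = Ic x"
      "\<And>x. Pu (Iu x) = Iu x" "\<And>x. Pc (Iu x) = 0" "\<And>x. Ps (Iu x) = 0"
      "\<And>x. Ps (As x) = As x" "\<And>x. Pc (As x) = 0" "\<And>x. Pu (As x) = 0"
      "\<And>x. Pc (k x) = k x" "\<And>x. Pu (k x) = 0" "\<And>x. Ps (k x) = 0"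
    and gC: "C1b n lg (emb g)" "g 0 = 0" "mderiv (emb g) 0 = 0"
    and kC: "C1b n lc (emb k)" "k 0 = 0" "mderiv (emb k) 0 = 0"
    and gB: "\<And>j. j \<le> Suc n \<Longrightarrow> \<exists>C. \<forall>x. norm (mderivs j (emb g) x) \<le> C"
    and kB: "\<And>j. j \<le> Suc n \<Longrightarrow> \<exists>C. \<forall>x. norm (mderivs j (emb k) x) \<le> C"
    and gcont: "continuous_on UNIV (mderivs (Suc n) (emb g))" and kcont: "continuous_on UNIV (mderivs (Suc n) (emb k))"
    and q1: "aci * lr < 1" and a_eq: "a * (1 - aci * lr) = aci" and lt_eq: "a = aci + lt"
    and lr_eq: "lr = ac * lc + lg * (1 + lc) + lc * (ac + lr)"
    and lu_eq: "lu = aui * (lu * (ac + lr) + lg * (1 + lc))"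
    and ls_eq: "ls = (as * ls + lg * (1 + lc)) * a"
    and lu_le: "lu \<le> 1 + lc" and ls_le: "ls \<le> 1 + lc"
    and th1: "lg + lc < 1"
    and th2: "\<And>j. j \<le> Suc n \<Longrightarrow> aui * ((ac + lr) ^ j + lg + lu) < 1"
    and th3: "\<And>j. j \<le> Suc n \<Longrightarrow> a ^ j * (as * (1 + a * ls) + lg * (1 + a * (1 + lc))) < 1"
begin

definition Rf where "Rf r x = Ac x + r x"
definition Tf where "Tf t x = Ic x + t x"
definition Kf where "Kf u s x = Pc x + k x + u x + s x"
text \<open>Differences are written as sums with negated linear maps, so that every summand is
  \<open>mpost\<close> of a given or composed map. In the application \<open>Ic\<close> and
  \<open>Iu\<close> contain the projections onto the centre and the unstable part, hence
  \<open>Iu\<close> selects the unstable component of g K by itself.\<close>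

definition nr where "nr r u s x = Ac (k x) + Pc (g (Kf u s x)) + - k (Rf r x)"
definition nt where "nt r t x = - Ic (r (Tf t x))"
definition nu where "nu r u s x = Iu (u (Rf r x)) + - Iu (g (Kf u s x))"
definition ns where "ns t u s x = As (s (Tf t x)) + Ps (g (Kf u s (Tf t x)))"

lemmas linm = lin(4) bounded_linear_minus[OF lin(5)] bounded_linear_minus[OF lin(6)] bounded_linear_minus[OF bounded_linear_ident]

lemma emb_Rf: "emb (Rf r) = (\<lambda>x. emb Ac x + emb r x)"
  and emb_Tf: "emb (Tf t) = (\<lambda>x. emb Ic x + emb t x)"
  and emb_Kf: "emb (Kf u s) = (\<lambda>x. emb Pc x + emb k x + emb u x + emb s x)"
  and emb_nr: "emb (nr r u s) = (\<lambda>x. mpost Ac (emb k x) + mpost Pc (emb g (Kf u s x)) + mpost (\<lambda>x. - x) (emb k (Rf r x)))"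
  and emb_nt: "emb (nt r t) = (\<lambda>x. mpost (\<lambda>x. - Ic x) (emb r (Tf t x)))"
  and emb_nu: "emb (nu r u s) = (\<lambda>x. mpost Iu (emb u (Rf r x)) + mpost (\<lambda>x. - Iu x) (emb g (Kf u s x)))"
  and emb_ns: "emb (ns t u s) = (\<lambda>x. mpost As (emb s (Tf t x)) + mpost Ps (emb g (Kf u s (Tf t x))))"
  by (simp_all add: fun_eq_iff Rf_def Tf_def Kf_def nr_def nt_def nu_def ns_def mpost_mconst lin linm mconst_simps)

text \<open>The set in which the iteration lives: values in the proper subspaces, the Lipschitz
  constants of the theorem, and vanishing to first order at the origin. A step preserves it, and the
  limit of the iterates belongs to it.\<close>

definition admissible :: "('a \<Rightarrow> 'a) \<Rightarrow> ('a \<Rightarrow> 'a) \<Rightarrow> ('a \<Rightarrow> 'a) \<Rightarrow> ('a \<Rightarrow> 'a) \<Rightarrow> bool" where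
  "admissible r t u s \<longleftrightarrow>
    (\<forall>x. Pc (r x) = r x \<and> Pu (r x) = 0 \<and> Ps (r x) = 0 \<and> Pc (t x) = t x \<and>
         Pc (u x) = 0 \<and> Pu (u x) = u x \<and> Ps (u x) = 0 \<and>
         Pc (s x) = 0 \<and> Pu (s x) = 0 \<and> Ps (s x) = s x) \<and>
    C1b n lr (emb r) \<and> C1b n lt (emb t) \<and> C1b n lu (emb u) \<and> C1b n ls (emb s) \<and>
    r 0 = 0 \<and> t 0 = 0 \<and> u 0 = 0 \<and> s 0 = 0 \<and>
    mderiv (emb r) 0 = 0 \<and> mderiv (emb t) 0 = 0 \<and> mderiv (emb u) 0 = 0 \<and> mderiv (emb s) 0 = 0"

lemma goodD:
  assumes "admissible r t u s"
  shows "C1b n lr (emb r)" "C1b n lt (emb t)" "C1b n lu (emb u)" "C1b n ls (emb s)"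
    "r 0 = 0" "t 0 = 0" "u 0 = 0" "s 0 = 0"
    "mderiv (emb r) 0 = 0" "mderiv (emb t) 0 = 0" "mderiv (emb u) 0 = 0" "mderiv (emb s) 0 = 0"
    "Pc (r x) = r x" "Pu (r x) = 0" "Ps (r x) = 0" "Pc (t x) = t x"
    "Pc (u x) = 0" "Pu (u x) = u x" "Ps (u x) = 0" "Pc (s x) = 0" "Pu (s x) = 0" "Ps (s x) = s x"
  using assms by (auto simp: admissible_def)

lemma mpost_Kf:
  assumes "admissible r t u s"
  shows "mpost Pc (emb (Kf u s) x) = emb Pc x + emb k x"
    "mpost Pu (emb (Kf u s) x) = emb u x" "mpost Ps (emb (Kf u s) x) = emb s x"
  unfolding mpost_mconst[OF lin(1)] mpost_mconst[OF lin(2)] mpost_mconst[OF lin(3)]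
  by (simp_all add: Kf_def linear_simps[OF lin(1)] linear_simps[OF lin(2)]
      linear_simps[OF lin(3)] proj goodD[OF assms] mconst_simps)

lemma C1b_R: "C1b n lr (emb r) \<Longrightarrow> C1b n (ac + lr) (emb (Rf r))"
  unfolding emb_Rf by (rule C1b_add(1)[OF C1b_linear[OF lin(4) nrm(4) nn(1)]])

lemma C1b_T: "C1b n lt (emb t) \<Longrightarrow> C1b n a (emb (Tf t))"
  unfolding emb_Tf lt_eq by (rule C1b_add(1)[OF C1b_linear[OF lin(5) nrm(5) nn(2)]])

text \<open>The sum of the bounds, 1 + lc + lu + ls, is too coarse. Componentwise the bounds are 1 +
  lc, lu and ls, and since lu and ls do not exceed 1 + lc, the maximum norm leaves 1 + lc.\<close>

lemma C1b_K:
  assumes "admissible r t u s" shows "C1b n (1 + lc) (emb (Kf u s))"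
proof -
  note G = goodD[OF assms]
  have Pk: "C1b n (1 + lc) (\<lambda>x. emb Pc x + emb k x)"
    by (rule C1b_add(1)[OF C1b_linear[OF lin(1) nrm(1)] kC(1)]) simp
  have 0: "C1b n (1 + lc + lu + ls) (emb (Kf u s))"
    unfolding emb_Kf by (rule C1b_add(1)[OF C1b_add(1)[OF Pk G(3)] G(4)])
  have "norm (mderiv (emb (Kf u s)) x) \<le> 1 + lc" for x
  proof (rule mpost_split[OF lin(1-3) mx])
    show "norm (mpost Pc (mderiv (emb (Kf u s)) x)) \<le> 1 + lc"
      using C1b_norm[OF Pk, of x]
      unfolding C1b_mpost(2)[OF lin(1) nrm(1) zero_le_one 0, symmetric] mpost_Kf(1)[OF assms] .
    show "norm (mpost Pu (mderiv (emb (Kf u s)) x)) \<le> 1 + lc"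
      using C1b_norm[OF C1b_mono[OF G(3) lu_le], of x]
      unfolding C1b_mpost(2)[OF lin(2) nrm(2) zero_le_one 0, symmetric] mpost_Kf(2)[OF assms] .
    show "norm (mpost Ps (mderiv (emb (Kf u s)) x)) \<le> 1 + lc"
      using C1b_norm[OF C1b_mono[OF G(4) ls_le], of x]
      unfolding C1b_mpost(2)[OF lin(3) nrm(3) zero_le_one 0, symmetric] mpost_Kf(3)[OF assms] .
  qed
  then show ?thesis using 0 by (simp add: C1b_def)
qed

text \<open>The bounds reproduce themselves: the chain rule for the four components yields the
  right-hand sides of \<open>lr_eq\<close>, \<open>lu_eq\<close> and \<open>ls_eq\<close>, and for t
  the product \<open>aci * lr * a\<close>, which equals \<open>a - aci = lt\<close> by
  \<open>a_eq\<close>.\<close>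

lemma admissible_step:
  assumes "admissible r t u s"
  shows "admissible (nr r u s) (nt r t) (nu r u s) (ns t u s)"
proof -
  note G = goodD[OF assms]
  note R = C1b_R[OF G(1)] and T = C1b_T[OF G(2)] and K = C1b_K[OF assms]
  note l0 = linear_simps(3)[OF lin(1)] linear_simps(3)[OF lin(3)] linear_simps(3)[OF lin(4)]
    linear_simps(3)[OF lin(5)] linear_simps(3)[OF lin(6)] linear_simps(3)[OF lin(7)]
  have z: "Rf r 0 = 0" "Tf t 0 = 0" "Kf u s 0 = 0"
    by (simp_all add: Rf_def Tf_def Kf_def G kC l0)
  note Gm = C1b_comp[OF gC(1) K] and kR = C1b_comp[OF kC(1) R] and rT = C1b_comp[OF G(1) T]
    and uR = C1b_comp[OF G(3) R] and sT = C1b_comp[OF G(4) T]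
  note GT = C1b_comp[OF Gm(1) T]
  have nm: "\<And>x. norm (- Ic x) \<le> aci * norm x" "\<And>x. norm (- Iu x) \<le> aui * norm x"
    "\<And>x. norm (- x) \<le> 1 * norm (x::'a)" using nrm by auto
  note pk = C1b_mpost[OF lin(4) nrm(4) nn(1) kC(1)]
    and pG = C1b_mpost[OF lin(1) nrm(1) zero_le_one Gm(1)]
    and pkR = C1b_mpost[OF linm(4) nm(3) zero_le_one kR(1)]
    and prT = C1b_mpost[OF linm(2) nm(1) nn(2) rT(1)]
    and puR = C1b_mpost[OF lin(6) nrm(6) nn(3) uR(1)]
    and pGu = C1b_mpost[OF linm(3) nm(2) nn(3) Gm(1)]
    and psT = C1b_mpost[OF lin(7) nrm(7) nn(4) sT(1)]
    and pGT = C1b_mpost[OF lin(3) nrm(3) zero_le_one GT(1)]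
  note nr1 = C1b_add[OF pk(1) pG(1)]
  note nr2 = C1b_add[OF nr1(1) pkR(1)] and nu2 = C1b_add[OF puR(1) pGu(1)] and ns2 = C1b_add[OF psT(1) pGT(1)]
  have post0: "mpost L 0 = 0" if "bounded_linear L" for L :: "'a \<Rightarrow> 'a"
    using linear_simps(3)[OF bounded_linear_mpost[OF that]] .
  note p0 = post0[OF lin(1)] post0[OF lin(3)] post0[OF lin(4)] post0[OF lin(6)] post0[OF lin(7)]
    post0[OF linm(2)] post0[OF linm(3)] post0[OF linm(4)]
  have "C1b n lr (emb (nr r u s))"
    using nr2(1) unfolding emb_nr by (rule C1b_mono) (use lr_eq in \<open>simp add: algebra_simps\<close>)
  moreover have "C1b n lt (emb (nt r t))"
    using prT(1) unfolding emb_nt by (rule C1b_mono) (use a_eq lt_eq in \<open>simp add: algebra_simps\<close>)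
  moreover have "C1b n lu (emb (nu r u s))"
    using nu2(1) unfolding emb_nu by (rule C1b_mono) (use lu_eq in \<open>simp add: algebra_simps\<close>)
  moreover have "C1b n ls (emb (ns t u s))"
    using ns2(1) unfolding emb_ns by (rule C1b_mono) (use ls_eq in \<open>simp add: algebra_simps\<close>)
  moreover have "mderiv (emb (nr r u s)) 0 = 0" "mderiv (emb (nt r t)) 0 = 0" "mderiv (emb (nu r u s)) 0 = 0" "mderiv (emb (ns t u s)) 0 = 0"
    unfolding emb_nr emb_nt emb_nu emb_ns nr2(2) nr1(2) nu2(2) ns2(2) pk(2) pG(2) pkR(2) prT(2) puR(2) pGu(2) psT(2) pGT(2)
      Gm(2) kR(2) rT(2) uR(2) sT(2) GT(2) z gC kC G(5-12) by (simp_all add: p0)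
  ultimately show ?thesis
    unfolding admissible_def
    by (simp add: nr_def nt_def nu_def ns_def z gC(2) kC(2) G(5-8) l0 proj
        linear_simps[OF lin(1)] linear_simps[OF lin(2)] linear_simps[OF lin(3)])
qed

end

section \<open>Continuous convergence of derivatives\<close>

lemma osc_of_tendsto:
  assumes "\<And>m x. norm (u m x) \<le> \<alpha>" "\<And>x. ((\<lambda>(m, y). u m y) \<longlongrightarrow> w x) (tail_nhds x)"
  shows "osc u 0"
proof (rule oscI[OF assms(1)])
  fix x and e :: real assume "0 < e"
  then have "eventually (\<lambda>p. dist ((\<lambda>(m, y). u m y) p) (w x) < e / 2) (tail_nhds x)"
    using tendstoD[OF assms(2), of "e/2" x] by simp
  moreover have "norm (u m y - u l z) \<le> 0 + e" if "dist (u m y) (w x) < e/2" "dist (u l z) (w x) < e/2" for m y l z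
    using that dist_triangle_half_l[of "u m y" "w x" e "u l z"] by (simp add: dist_norm)
  ultimately show "\<exists>P. eventually P (tail_nhds x) \<and> (\<forall>m y l z. P (m, y) \<longrightarrow> P (l, z) \<longrightarrow> norm (u m y - u l z) \<le> 0 + e)"
    by (intro exI[of _ "\<lambda>p. dist ((\<lambda>(m, y). u m y) p) (w x) < e / 2"]) auto
qed

lemma tail_nhds_eventually:
  assumes "eventually P (tail_nhds x)"
  obtains M B where "eventually B (nhds x)" "\<And>m y. M \<le> m \<Longrightarrow> B y \<Longrightarrow> P (m, y)"
  using assms unfolding tail_nhds_def eventually_prod_filter eventually_sequentially by blast

lemma ctailI:
  assumes "eventually B (nhds x)" "\<And>m y. M \<le> m \<Longrightarrow> B y \<Longrightarrow> P (m, y)"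
  shows "eventually P (tail_nhds x)"
  unfolding tail_nhds_def eventually_prod_filter eventually_sequentially
  using assms by blast

text \<open>Oscillation 0 is the Cauchy criterion for continuous convergence. Fixing z = x and
  letting l tend to infinity compares \<open>u m y\<close> with \<open>w x\<close> for all y near x
  at once; letting then m tend to infinity gives the continuity of \<open>w\<close>.\<close>

lemma osc_limit:
  fixes u :: "nat \<Rightarrow> 'a::real_normed_vector \<Rightarrow> 'b::banach"
  assumes "osc u 0"
  obtains w where "\<And>x. ((\<lambda>(m, y). u m y) \<longlongrightarrow> w x) (tail_nhds x)" "\<And>x. (\<lambda>m. u m x) \<longlonglongrightarrow> w x"
    "continuous_on UNIV w"
proof -
  have near: "\<exists>M B. eventually B (nhds x) \<and> (\<forall>m l y z. M \<le> m \<longrightarrow> M \<le> l \<longrightarrow> B y \<longrightarrow> B z \<longrightarrow> norm (u m y - u l z) \<le> e)"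
    if pos: "0 < e" for e x
  proof -
    obtain P where P: "eventually P (tail_nhds x)" "\<And>m y l z. P (m, y) \<Longrightarrow> P (l, z) \<Longrightarrow> norm (u m y - u l z) \<le> 0 + e"
      using oscD[OF assms pos] by blast
    obtain M B where "eventually B (nhds x)" "\<And>m y. M \<le> m \<Longrightarrow> B y \<Longrightarrow> P (m, y)"
      by (rule tail_nhds_eventually[OF P(1)]) blast
    then show ?thesis using P(2) by (intro exI[of _ M] exI[of _ B]) auto
  qed
  define w where "w x = lim (\<lambda>m. u m x)" for x
  have lim: "(\<lambda>m. u m x) \<longlonglongrightarrow> w x" for x
  proof -
    have "Cauchy (\<lambda>m. u m x)"
    proof (rule CauchyI)
      fix e :: real assume "0 < e"
      obtain M B where "eventually B (nhds x)"
        "\<And>m l y z. M \<le> m \<Longrightarrow> M \<le> l \<Longrightarrow> B y \<Longrightarrow> B z \<Longrightarrow> norm (u m y - u l z) \<le> e / 2"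
        using near[OF half_gt_zero[OF \<open>0 < e\<close>], of x] by blast
      then show "\<exists>M. \<forall>m\<ge>M. \<forall>n\<ge>M. norm (u m x - u n x) < e"
        using \<open>0 < e\<close> by (intro exI[of _ M]) (smt (verit, best) eventually_nhds_x_imp_x field_sum_of_halves)
    qed
    then show ?thesis unfolding w_def by (simp add: Cauchy_convergent_iff convergent_LIMSEQ_iff)
  qed
  have close: "\<exists>M B. eventually B (nhds x) \<and> (\<forall>m y. M \<le> m \<longrightarrow> B y \<longrightarrow> norm (u m y - w x) \<le> e)"
    if pos: "0 < e" for e x
  proof -
    obtain M B where MB: "eventually B (nhds x)"
      "\<And>m l y z. M \<le> m \<Longrightarrow> M \<le> l \<Longrightarrow> B y \<Longrightarrow> B z \<Longrightarrow> norm (u m y - u l z) \<le> e"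
      using near[OF pos, of x] by blast
    have "norm (u m y - w x) \<le> e" if "M \<le> m" "B y" for m y
    proof (rule tendsto_upperbound)
      show "(\<lambda>l. norm (u m y - u l x)) \<longlonglongrightarrow> norm (u m y - w x)" by (intro tendsto_intros lim)
      show "\<forall>\<^sub>F l in sequentially. norm (u m y - u l x) \<le> e"
        using MB(2)[OF that(1) _ that(2) eventually_nhds_x_imp_x[OF MB(1)]]
        by (auto simp: eventually_sequentially)
    qed simp
    then show ?thesis using MB(1) by blast
  qed
  show ?thesis
  proof
    show "((\<lambda>(m, y). u m y) \<longlongrightarrow> w x) (tail_nhds x)" for x
    proof (rule tendstoI)
      fix e :: real assume "0 < e"
      then obtain M B where MB: "eventually B (nhds x)" "\<And>m y. M \<le> m \<Longrightarrow> B y \<Longrightarrow> norm (u m y - w x) \<le> e/2"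
        using close[of "e/2" x] half_gt_zero by blast
      have "norm (u m y - w x) < e" if "M \<le> m" "B y" for m y
        using MB(2)[OF that] \<open>0 < e\<close> by simp
      then show "\<forall>\<^sub>F p in tail_nhds x. dist (case p of (m, y) \<Rightarrow> u m y) (w x) < e"
        by (intro ctailI[OF MB(1)]) (auto simp: dist_norm)
    qed
    show "(\<lambda>m. u m x) \<longlonglongrightarrow> w x" for x by (rule lim)
    have "isCont w x" for x
      unfolding isCont_def tendsto_at_iff_tendsto_nhds
    proof (rule tendstoI)
      fix e :: real assume "0 < e"
      then obtain M B where MB: "eventually B (nhds x)" "\<And>m y. M \<le> m \<Longrightarrow> B y \<Longrightarrow> norm (u m y - w x) \<le> e/2"
        using close[of "e/2" x] half_gt_zero by blast
      have "norm (w y - w x) \<le> e/2" if "B y" for y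
      proof (rule tendsto_upperbound)
        show "(\<lambda>l. norm (u l y - w x)) \<longlonglongrightarrow> norm (w y - w x)" by (intro tendsto_intros lim)
        show "\<forall>\<^sub>F l in sequentially. norm (u l y - w x) \<le> e/2"
          using MB(2) that by (auto simp: eventually_sequentially)
      qed simp
      then have "dist (w y) (w x) < e" if "B y" for y
        using that \<open>0 < e\<close> by (force simp: dist_norm)
      then show "\<forall>\<^sub>F y in nhds x. dist (w y) (w x) < e"
        using MB(1) by (auto elim: eventually_mono)
    qed
    then show "continuous_on UNIV w" by (simp add: continuous_on_eq_continuous_at)
  qed
qed

lemma osc_closed:
  assumes "\<And>e. 0 < e \<Longrightarrow> osc u e" shows "osc u 0"
proof -
  obtain \<alpha> where "\<And>m x. norm (u m x) \<le> \<alpha>" using osc_bounded[OF assms[of 1]] by auto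
  then show ?thesis
  proof (rule oscI)
    fix x and e :: real assume "0 < e"
    then have e: "0 < e/2" by simp
    obtain P where P: "eventually P (tail_nhds x)" "\<And>m y l z. P (m, y) \<Longrightarrow> P (l, z) \<Longrightarrow> norm (u m y - u l z) \<le> e/2 + e/2"
      using oscD[OF assms[OF e] e, of x] by blast
    have "norm (u m y - u l z) \<le> 0 + e" if "P (m, y)" "P (l, z)" for m y l z
      using P(2)[OF that] by simp
    then show "\<exists>P. eventually P (tail_nhds x) \<and> (\<forall>m y l z. P (m, y) \<longrightarrow> P (l, z) \<longrightarrow> norm (u m y - u l z) \<le> 0 + e)"
      using P(1) by blast
  qed
qed

text \<open>The oscillation ignores any initial segment of indices; the bound for \<open>u 0\<close>
  restores the boundedness that \<open>osc\<close> contains. In this way an estimate of a step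
  becomes an estimate of the sequence itself.\<close>

lemma osc_shift:
  assumes "osc (\<lambda>m. u (Suc m)) c" "\<And>x. norm (u 0 x) \<le> \<beta>"
  shows "osc u c"
proof -
  obtain \<alpha> where \<alpha>: "\<And>m x. norm (u (Suc m) x) \<le> \<alpha>" using osc_bounded[OF assms(1)] by auto
  have "norm (u m x) \<le> max \<alpha> \<beta>" for m x
    using \<alpha>[of "m - 1" x] assms(2)[of x] by (cases m) auto
  then show ?thesis
  proof (rule oscI)
    fix x and e :: real assume "0 < e"
    obtain P where P: "eventually P (tail_nhds x)"
      "\<And>m y l z. P (m, y) \<Longrightarrow> P (l, z) \<Longrightarrow> norm (u (Suc m) y - u (Suc l) z) \<le> c + e"
      using oscD[OF assms(1) \<open>0 < e\<close>] by blast
    obtain M B where MB: "eventually B (nhds x)" "\<And>m y. M \<le> m \<Longrightarrow> B y \<Longrightarrow> P (m, y)"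
      by (rule tail_nhds_eventually[OF P(1)]) blast
    have "norm (u m y - u l z) \<le> c + e" if "Suc M \<le> m" "B y" "Suc M \<le> l" "B z" for m y l z
      using P(2)[OF MB(2)[of "m - 1" y] MB(2)[of "l - 1" z]] that by auto
    moreover have "eventually (\<lambda>p. Suc M \<le> fst p \<and> B (snd p)) (tail_nhds x)"
      by (rule ctailI[OF MB(1), of "Suc M"]) auto
    ultimately show "\<exists>P. eventually P (tail_nhds x) \<and> (\<forall>m y l z. P (m, y) \<longrightarrow> P (l, z) \<longrightarrow> norm (u m y - u l z) \<le> c + e)"
      by (intro exI[of _ "\<lambda>p. Suc M \<le> fst p \<and> B (snd p)"]) auto
  qed
qed

lemma osc_bounded_le:
  assumes "\<And>m x. norm (u m x) \<le> \<alpha>" shows "osc u (2 * \<alpha>)"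
proof (rule oscI[OF assms])
  fix x and e :: real assume "0 < e"
  have "norm (u m y - u l z) \<le> 2 * \<alpha> + e" for m y l z
    using norm_triangle_ineq4[of "u m y" "u l z"] assms[of m y] assms[of l z] \<open>0 < e\<close> by linarith
  then show "\<exists>P. eventually P (tail_nhds x) \<and> (\<forall>m y l z. P (m, y) \<longrightarrow> P (l, z) \<longrightarrow> norm (u m y - u l z) \<le> 2 * \<alpha> + e)"
    by (intro exI[of _ "\<lambda>_. True"]) auto
qed

text \<open>A common Lipschitz constant upgrades pointwise convergence to continuous
  convergence.\<close>

lemma tendsto_tail_nhds:
  fixes \<psi> :: "nat \<Rightarrow> 'a::real_normed_vector \<Rightarrow> 'b::real_normed_vector"
  assumes "\<And>m y z. norm (\<psi> m y - \<psi> m z) \<le> L * norm (y - z)" "(\<lambda>m. \<psi> m x) \<longlonglongrightarrow> p"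
  shows "((\<lambda>(m, y). \<psi> m y) \<longlongrightarrow> p) (tail_nhds x)"
proof (rule Lim_null_comparison[THEN LIM_zero_cancel])
  have "norm (\<psi> m y - p) \<le> L * norm (y - x) + norm (\<psi> m x - p)" for m y
    using norm_triangle_ineq[of "\<psi> m y - \<psi> m x" "\<psi> m x - p"] assms(1)[of m y x] by simp
  then show "\<forall>\<^sub>F q in tail_nhds x. norm ((case q of (m, y) \<Rightarrow> \<psi> m y) - p)
      \<le> L * norm (snd q - x) + norm (\<psi> (fst q) x - p)"
    by (auto intro!: always_eventually)
  have f: "filterlim fst sequentially (tail_nhds x)" and s: "filterlim snd (nhds x) (tail_nhds x)"
    unfolding tail_nhds_def by (rule filterlim_fst filterlim_snd)+
  have "((\<lambda>q. L * norm (snd q - x) + norm (\<psi> (fst q) x - p)) \<longlongrightarrow> L * norm (x - x) + norm (p - p)) (tail_nhds x)"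
    using filterlim_compose[OF assms(2) f] s by (intro tendsto_intros) auto
  then show "((\<lambda>q. L * norm (snd q - x) + norm (\<psi> (fst q) x - p)) \<longlongrightarrow> 0) (tail_nhds x)" by simp
qed

lemma cconvI:
  assumes "\<And>x. ((\<lambda>(m, y). \<psi> m y) \<longlongrightarrow> w x) (tail_nhds x)"
  shows "cont_conv \<psi>"
  unfolding cont_conv_def
proof
  fix x
  have "filterlim (\<lambda>p. (fst p, case p of (m, y) \<Rightarrow> \<psi> m y)) (tail_nhds (w x)) (tail_nhds x)"
    using assms[of x] filterlim_fst[of sequentially "nhds x"]
    unfolding tail_nhds_def by (intro filterlim_Pair) auto
  then show "\<exists>x'. filterlim (\<lambda>(m, y). (m, \<psi> m y)) (tail_nhds x') (tail_nhds x)"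
    by (auto simp: case_prod_unfold)
qed

text \<open>Continuous convergence at x puts \<open>v m q\<close> within e/2 of z for all large m
  and all q in one ball around x. The mean value inequality for \<open>u m\<close> minus the linear
  map \<open>mslice z\<close> on that ball is then uniform in m, and m may tend to infinity.\<close>

lemma limit_derivative:
  fixes u :: "nat \<Rightarrow> 'a::real_normed_vector \<Rightarrow> ('a, 'b::banach) multilin"
  assumes d: "\<And>m x. (u m has_derivative mslice (v m x)) (at x)"
    and uw: "\<And>x. (\<lambda>m. u m x) \<longlonglongrightarrow> w x" and v: "((\<lambda>(m, y). v m y) \<longlongrightarrow> z) (tail_nhds x)"
  shows "(w has_derivative mslice z) (at x)"
  unfolding has_derivative_within
proof
  show "bounded_linear (mslice z)" by (rule bounded_linear_mslice_right)
  have key: "\<exists>d>0. \<forall>y. norm (y - x) < d \<longrightarrow> norm (w y - w x - mslice z (y - x)) \<le> e * norm (y - x)" if "0 < e" for e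
  proof -
    have "eventually (\<lambda>p. dist (case p of (m, y) \<Rightarrow> v m y) z < e / 2) (tail_nhds x)"
      using tendstoD[OF v, of "e/2"] that by simp
    then obtain M B where MB: "eventually B (nhds x)" "\<And>m y. M \<le> m \<Longrightarrow> B y \<Longrightarrow> dist (v m y) z < e / 2"
      by (elim tail_nhds_eventually) auto
    obtain d where d0: "0 < d" "\<And>y. dist y x < d \<Longrightarrow> B y"
      using MB(1) unfolding eventually_nhds_metric by auto
    have "norm (w y - w x - mslice z (y - x)) \<le> e * norm (y - x)" if y: "norm (y - x) < d" for y
    proof (rule tendsto_upperbound)
      show "(\<lambda>m. norm (u m y - u m x - mslice z (y - x))) \<longlonglongrightarrow> norm (w y - w x - mslice z (y - x))"
        by (intro tendsto_intros uw)
      have "norm (u m y - u m x - mslice z (y - x)) \<le> e * norm (y - x)" if m: "M \<le> m" for m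
      proof -
        let ?S = "ball x d"
        have "norm ((u m y - mslice z y) - (u m x - mslice z x)) \<le> e * norm (y - x)"
        proof (rule differentiable_bound[of ?S _ "\<lambda>q h. mslice (v m q) h - mslice z h"])
          show "((\<lambda>y. u m y - mslice z y) has_derivative (\<lambda>h. mslice (v m q) h - mslice z h)) (at q within ?S)" for q
            using has_derivative_diff[OF d bounded_linear_imp_has_derivative[OF bounded_linear_mslice_right]]
              has_derivative_at_withinI by blast
          fix q assume "q \<in> ?S"
          then have "dist q x < d" by (simp add: dist_commute)
          then have "norm (v m q - z) \<le> e / 2"
            using less_imp_le[OF MB(2)[OF m d0(2)]] unfolding dist_norm by blast
          then have "norm (mslice (v m q - z) h) \<le> e * norm h" for h
            using norm_mslice[of "v m q - z" h] mult_right_mono[OF _ norm_ge_zero[of h], of "norm (v m q - z)" e] \<open>0 < e\<close>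
            by linarith
          then show "onorm (\<lambda>h. mslice (v m q) h - mslice z h) \<le> e"
            using \<open>0 < e\<close> by (intro onorm_bound) (simp_all add: bounded_bilinear.diff_left[OF bounded_bilinear_mslice])
        qed (use y d0 in \<open>auto simp: dist_norm norm_minus_commute\<close>)
        then show ?thesis by (simp add: bounded_bilinear.diff_right[OF bounded_bilinear_mslice] algebra_simps)
      qed
      then show "\<forall>\<^sub>F m in sequentially. norm (u m y - u m x - mslice z (y - x)) \<le> e * norm (y - x)"
        by (auto simp: eventually_sequentially)
    qed simp
    then show ?thesis using d0 by blast
  qed
  show "((\<lambda>y. (1 / norm (y - x)) *\<^sub>R (w y - (w x + mslice z (y - x)))) \<longlongrightarrow> 0) (at x)"
  proof (rule tendstoI)
    fix e :: real assume "0 < e"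
    then obtain d where d: "d > 0" "\<And>y. norm (y - x) < d \<Longrightarrow> norm (w y - w x - mslice z (y - x)) \<le> e / 2 * norm (y - x)"
      using key[of "e/2"] by auto
    have "dist ((1 / norm (y - x)) *\<^sub>R (w y - (w x + mslice z (y - x)))) 0 < e" if "y \<noteq> x" "dist y x < d" for y
    proof -
      have "norm (w y - (w x + mslice z (y - x))) \<le> e / 2 * norm (y - x)"
        using d(2)[of y] that by (simp add: dist_norm diff_diff_eq)
      also have "\<dots> < e * norm (y - x)" using that \<open>0 < e\<close> by simp
      finally have "norm (w y - (w x + mslice z (y - x))) / norm (y - x) < e"
        using that by (simp add: divide_less_eq)
      then show ?thesis by simp
    qed
    then show "\<forall>\<^sub>F y in at x. dist ((1 / norm (y - x)) *\<^sub>R (w y - (w x + mslice z (y - x)))) 0 < e"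
      unfolding eventually_at using d(1) by auto
  qed
qed

text \<open>By \<open>limit_derivative\<close> each limit has the next one as its derivative, so
  \<open>tower_mderivs\<close> identifies the limits as the derivatives of \<open>w\<close>.\<close>

lemma limit_tower:
  fixes u :: "nat \<Rightarrow> 'a::real_normed_vector \<Rightarrow> ('a, 'b::banach) multilin"
  assumes mdiff: "\<And>m. mdiff N (u m)" and osc: "\<And>j. j \<le> N \<Longrightarrow> osc (\<lambda>m. mderivs j (u m)) 0"
    and lim: "\<And>x. (\<lambda>m. u m x) \<longlonglongrightarrow> w x"
  shows "mdiff N w" "\<And>j x. j \<le> N \<Longrightarrow> (\<lambda>m. mderivs j (u m) x) \<longlonglongrightarrow> mderivs j w x"
    "\<And>j. j \<le> N \<Longrightarrow> continuous_on UNIV (mderivs j w)"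
    "\<And>j. j \<le> N \<Longrightarrow> \<exists>C. \<forall>x. norm (mderivs j w x) \<le> C"
proof -
  have "\<forall>j. \<exists>W. j \<le> N \<longrightarrow> (\<forall>x. ((\<lambda>(m, y). mderivs j (u m) y) \<longlongrightarrow> W x) (tail_nhds x)) \<and>
      (\<forall>x. (\<lambda>m. mderivs j (u m) x) \<longlonglongrightarrow> W x) \<and> continuous_on UNIV W"
    using osc_limit[OF osc] by metis
  then obtain W where W: "\<And>j x. j \<le> N \<Longrightarrow> ((\<lambda>(m, y). mderivs j (u m) y) \<longlongrightarrow> W j x) (tail_nhds x)"
    "\<And>j x. j \<le> N \<Longrightarrow> (\<lambda>m. mderivs j (u m) x) \<longlonglongrightarrow> W j x" "\<And>j. j \<le> N \<Longrightarrow> continuous_on UNIV (W j)"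
    by metis
  have W0: "W 0 = w"
    using LIMSEQ_unique[OF W(2)[of 0] ] lim by (auto simp: fun_eq_iff)
  have d: "(W j has_derivative mslice (W (Suc j) x)) (at x)" if "j < N" for j x
    using that by (intro limit_derivative[OF mdiff_works[OF mdiff] W(2) W(1)]) auto
  have z: "mapp (W (Suc j) x) [] = 0" if "j < N" for j x
    using bounded_linear.tendsto[OF bounded_linear_mapp W(2), of "Suc j" x "[]"] mapp_mderivs_Nil[OF mdiff that] that
    by (simp add: LIMSEQ_const_iff)
  show "mdiff N w" using tower_mdiff[of N W, OF d z] W0 by simp
  have eq: "mderivs j w = W j" if "j \<le> N" for j
    using tower_mderivs[of N W, OF d z that] W0 by simp
  show "\<And>j x. j \<le> N \<Longrightarrow> (\<lambda>m. mderivs j (u m) x) \<longlonglongrightarrow> mderivs j w x"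
    "\<And>j. j \<le> N \<Longrightarrow> continuous_on UNIV (mderivs j w)"
    using W eq by auto
  fix j assume j: "j \<le> N"
  obtain C where "\<And>m x. norm (mderivs j (u m) x) \<le> C" using osc_bounded[OF osc[OF j]] by blast
  then have "norm (W j x) \<le> C" for x
    using tendsto_upperbound[OF tendsto_norm[OF W(2)[OF j]]] by (simp add: always_eventually)
  then show "\<exists>C. \<forall>x. norm (mderivs j w x) \<le> C" using eq[OF j] by auto
qed

lemma geometric_limit:
  fixes f :: "nat \<Rightarrow> 'a \<Rightarrow> 'b::banach"
  assumes "0 \<le> \<rho>" "\<rho> < 1" "\<And>m x. norm (f (Suc m) x - f m x) \<le> C * \<rho> ^ m" "\<And>x. f 0 x = 0"
  shows "(\<lambda>m. f m x) \<longlonglongrightarrow> lim (\<lambda>m. f m x)" "norm (f m x) \<le> C / (1 - \<rho>)"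
proof -
  have sm: "summable (\<lambda>m. C * \<rho> ^ m)" using assms by (intro summable_mult summable_geometric) auto
  have f: "f m x = (\<Sum>i<m. f (Suc i) x - f i x)" for m
    using sum_lessThan_telescope[of "\<lambda>i. f i x" m] assms(4) by simp
  have "summable (\<lambda>m. f (Suc m) x - f m x)"
    by (rule summable_comparison_test[OF _ sm]) (use assms in auto)
  then have "convergent (\<lambda>m. \<Sum>i<m. f (Suc i) x - f i x)"
    unfolding summable_iff_convergent .
  then have "convergent (\<lambda>m. f m x)" by (simp only: f[symmetric])
  then show "(\<lambda>m. f m x) \<longlonglongrightarrow> lim (\<lambda>m. f m x)" by (simp add: convergent_LIMSEQ_iff)
  have C: "0 \<le> C" using order_trans[OF norm_ge_zero assms(3)[of 0 x]] by simp
  have "norm (f m x) \<le> (\<Sum>i<m. C * \<rho> ^ i)"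
    by (subst f) (rule order_trans[OF norm_sum sum_mono[OF assms(3)]])
  also have "\<dots> \<le> (\<Sum>i. C * \<rho> ^ i)" using C assms by (intro sum_le_suminf sm) auto
  also have "\<dots> = C / (1 - \<rho>)" using assms by (simp add: suminf_mult suminf_geometric summable_geometric)
  finally show "norm (f m x) \<le> C / (1 - \<rho>)" .
qed

section \<open>Convergence of the iteration\<close>

context cm_setting
begin

text \<open>The weight w of t is slightly larger than a ^ (j + 1): with that exact value, the equation
  for t would be merely nonexpansive.\<close>

lemma contraction_constants:
  assumes "j \<le> Suc n"
  obtains w \<kappa> where "0 < w" "0 \<le> \<kappa>" "\<kappa> < 1" "lg + lc \<le> \<kappa>" "aui * ((ac + lr) ^ j + lg + lu) \<le> \<kappa>"
    "a ^ j * (as + lg) + (as * ls + lg * (1 + lc)) * w \<le> \<kappa>" "aci * (a ^ j + lr * w) \<le> \<kappa> * w"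
proof -
  define B where "B = as * ls + lg * (1 + lc)"
  define th where "th = a ^ j * (as + lg) + B * a ^ Suc j"
  have B: "0 \<le> B" using nn by (simp add: B_def)
  have th: "th < 1" using th3[OF assms] by (simp add: th_def B_def algebra_simps)
  \<comment> \<open>Then \<open>B * \<delta>\<close> uses up at most half of the gap 1 - th; the 1
    added to B covers the case B = 0.\<close>
  define \<delta> where "\<delta> = (1 - th) / (2 * (B + 1))"
  have \<delta>: "0 < \<delta>" using th B by (simp add: \<delta>_def)
  define w where "w = a ^ Suc j + \<delta>"
  have w: "0 < w" using \<delta> nn by (simp add: w_def add_nonneg_pos)
  have "B * \<delta> \<le> (1 - th) / 2" using B th by (simp add: \<delta>_def field_simps)
  then have c3: "a ^ j * (as + lg) + B * w < 1" using th by (simp add: w_def th_def algebra_simps)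
  have "aci * a ^ j = a * (1 - aci * lr) * a ^ j" by (simp add: a_eq)
  \<comment> \<open>This is a convex combination of \<open>a ^ Suc j\<close> and w, hence smaller
    than w by (1 - aci lr) \<delta>; that gap relative to w is the contraction of the equation for
    t.\<close>
  then have "aci * (a ^ j + lr * w) = (1 - aci * lr) * a ^ Suc j + aci * lr * w"
    by (simp add: algebra_simps)
  also have "\<dots> = (1 - (1 - aci * lr) * \<delta> / w) * w"
    using w by (simp add: w_def field_simps)
  finally have c4: "aci * (a ^ j + lr * w) = (1 - (1 - aci * lr) * \<delta> / w) * w" .
  define \<kappa> where "\<kappa> = max (max (lg + lc) (aui * ((ac + lr) ^ j + lg + lu)))
    (max (a ^ j * (as + lg) + B * w) (1 - (1 - aci * lr) * \<delta> / w))"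
  have "0 < (1 - aci * lr) * \<delta> / w" using q1 \<delta> w by simp
  then have "\<kappa> < 1" using th1 th2[OF assms] c3 by (simp add: \<kappa>_def)
  moreover have "0 \<le> \<kappa>" using nn by (simp add: \<kappa>_def le_max_iff_disj)
  moreover have "aci * (a ^ j + lr * w) \<le> \<kappa> * w"
    unfolding c4 using w by (intro mult_right_mono) (simp_all add: \<kappa>_def)
  ultimately show ?thesis
    using w by (intro that[of w \<kappa>]) (simp_all add: \<kappa>_def B_def)
qed

text \<open>The calculus of \<open>comp_top\<close> at order j in each equation. c measures r, u and
  s, and d measures t, which gets a weight of its own. g and k have size 0, so they contribute their
  Lipschitz constants times the derivative of order j of the inner map; K has the size c of its
  unknown components. For s, the map g o K of size lg c is itself the outer map of a composition
  with T.\<close>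

lemma step_size:
  fixes r t u s :: "nat \<Rightarrow> 'a \<Rightarrow> 'a"
  assumes S: "size_system S adm" and j: "1 \<le> j" "j \<le> Suc n"
    and admissible: "\<And>m. admissible (r m) (t m) (u m) (s m)"
    and low: "\<And>i. i < j \<Longrightarrow> S (\<lambda>m. mderivs i (emb (r m))) 0" "\<And>i. i < j \<Longrightarrow> S (\<lambda>m. mderivs i (emb (t m))) 0"
      "\<And>i. i < j \<Longrightarrow> S (\<lambda>m. mderivs i (emb (u m))) 0" "\<And>i. i < j \<Longrightarrow> S (\<lambda>m. mderivs i (emb (s m))) 0"
    and gS: "\<And>i. i \<le> j \<Longrightarrow> S (\<lambda>m. mderivs i (emb g)) 0" and kS: "\<And>i. i \<le> j \<Longrightarrow> S (\<lambda>m. mderivs i (emb k)) 0"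
    and adm: "adm (\<lambda>m. Rf (r m))" "adm (\<lambda>m. Tf (t m))" "adm (\<lambda>m. Kf (u m) (s m))"
    and c: "0 \<le> c" "0 \<le> d"
    and top: "S (\<lambda>m. mderivs j (emb (r m))) c" "S (\<lambda>m. mderivs j (emb (t m))) d"
      "S (\<lambda>m. mderivs j (emb (u m))) c" "S (\<lambda>m. mderivs j (emb (s m))) c"
  shows "S (\<lambda>m. mderivs j (emb (nr (r m) (u m) (s m)))) ((lg + lc) * c)"
    and "S (\<lambda>m. mderivs j (emb (nt (r m) (t m)))) (aci * (a ^ j * c + lr * d))"
    and "S (\<lambda>m. mderivs j (emb (nu (r m) (u m) (s m)))) (aui * ((ac + lr) ^ j + lg + lu) * c)"
    and "S (\<lambda>m. mderivs j (emb (ns (t m) (u m) (s m)))) (a ^ j * (as + lg) * c + (as * ls + lg * (1 + lc)) * d)"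
proof -
  interpret Z: size_system S adm by fact
  note G = goodD(1-4)[OF admissible]
  have ccr: "mdiff i (emb (r m))" and cct: "mdiff i (emb (t m))" and ccu: "mdiff i (emb (u m))" and ccs: "mdiff i (emb (s m))"
    and ccg: "mdiff i (emb g)" and cck: "mdiff i (emb k)"
    and ccK: "mdiff i (emb (Kf (u m) (s m)))" and ccR: "mdiff i (emb (Rf (r m)))" and ccT: "mdiff i (emb (Tf (t m)))"
    if "i \<le> j" for i m
    using mdiff_mono[OF C1b_mdiff[OF G(1)], of i m] mdiff_mono[OF C1b_mdiff[OF G(2)], of i m] mdiff_mono[OF C1b_mdiff[OF G(3)], of i m]
      mdiff_mono[OF C1b_mdiff[OF G(4)], of i m] mdiff_mono[OF C1b_mdiff[OF gC(1)], of i] mdiff_mono[OF C1b_mdiff[OF kC(1)], of i]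
      mdiff_mono[OF C1b_mdiff[OF C1b_K[OF admissible]], of i m] mdiff_mono[OF C1b_mdiff[OF C1b_R[OF G(1)]], of i m]
      mdiff_mono[OF C1b_mdiff[OF C1b_T[OF G(2)]], of i m] that j by auto
  have lowS: "Z.low j (\<lambda>m. emb (r m))" "Z.low j (\<lambda>m. emb (u m))" "Z.low j (\<lambda>m. emb (s m))"
    "Z.low j (\<lambda>m. emb g)" "Z.low j (\<lambda>m. emb k)"
    using low ccr ccu ccs ccg cck gS kS by (auto simp: Z.low_def)
  have RS: "S (\<lambda>m. mderivs i (emb (Rf (r m)))) e" if "1 \<le> i" "i \<le> j" "S (\<lambda>m. mderivs i (emb (r m))) e" for i e
    using Z.add_top[OF linear_mderivs(1)[OF lin(4)] ccr[OF that(2)] Z.linear_top[OF lin(4) that(1)] that(3)]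
    unfolding emb_Rf by simp
  have TS: "S (\<lambda>m. mderivs i (emb (Tf (t m)))) e" if "1 \<le> i" "i \<le> j" "S (\<lambda>m. mderivs i (emb (t m))) e" for i e
    using Z.add_top[OF linear_mderivs(1)[OF lin(5)] cct[OF that(2)] Z.linear_top[OF lin(5) that(1)] that(3)]
    unfolding emb_Tf by simp
  have KS: "S (\<lambda>m. mderivs i (emb (Kf (u m) (s m)))) e"
    if i: "1 \<le> i" "i \<le> j" and us: "S (\<lambda>m. mderivs i (emb (u m))) e" "S (\<lambda>m. mderivs i (emb (s m))) e" and e: "0 \<le> e" for i e
  proof (rule Z.S_split[OF lin(1-3) mx])
    have "S (\<lambda>m. mderivs i (\<lambda>x. emb Pc x + emb k x)) (0 + 0)"
      by (rule Z.add_top[OF linear_mderivs(1)[OF lin(1)] cck[OF i(2)] Z.linear_top[OF lin(1) i(1)] kS[OF i(2)]])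
    then have "S (\<lambda>m. mderivs i (\<lambda>x. emb Pc x + emb k x)) e" using e Z.S_mono by fastforce
    then show "S (\<lambda>m x. mpost Pc (mderivs i (emb (Kf (u m) (s m))) x)) e"
      using mderivs_mpost[OF lin(1) ccK[OF i(2)]] mpost_Kf(1)[OF admissible] by simp
    show "S (\<lambda>m x. mpost Pu (mderivs i (emb (Kf (u m) (s m))) x)) e"
      using mderivs_mpost[OF lin(2) ccK[OF i(2)]] mpost_Kf(2)[OF admissible] us(1) by simp
    show "S (\<lambda>m x. mpost Ps (mderivs i (emb (Kf (u m) (s m))) x)) e"
      using mderivs_mpost[OF lin(3) ccK[OF i(2)]] mpost_Kf(3)[OF admissible] us(2) by simp
  qed
  have lowp: "Z.lowp j (\<lambda>m. emb (Rf (r m)))" "Z.lowp j (\<lambda>m. emb (Tf (t m)))" "Z.lowp j (\<lambda>m. emb (Kf (u m) (s m)))"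
    using RS TS KS low ccR ccT ccK by (auto simp: Z.lowp_def)
  note Gm = Z.comp_top[OF j(1) lowS(4) lowp(3) adm(3) order_refl c(1) gS[OF order_refl]
      KS[OF j(1) order_refl top(3,4) c(1)] C1b_norm[OF C1b_K[OF admissible]] C1b_norm[OF gC(1)]]
  note kR = Z.comp_top[OF j(1) lowS(5) lowp(1) adm(1) order_refl c(1) kS[OF order_refl]
      RS[OF j(1) order_refl top(1)] C1b_norm[OF C1b_R[OF G(1)]] C1b_norm[OF kC(1)]]
  note uR = Z.comp_top[OF j(1) lowS(2) lowp(1) adm(1) c(1) c(1) top(3)
      RS[OF j(1) order_refl top(1)] C1b_norm[OF C1b_R[OF G(1)]] C1b_norm[OF G(3)]]
  note rT = Z.comp_top[OF j(1) lowS(1) lowp(2) adm(2) c(1) c(2) top(1)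
      TS[OF j(1) order_refl top(2)] C1b_norm[OF C1b_T[OF G(2)]] C1b_norm[OF G(1)]]
  note sT = Z.comp_top[OF j(1) lowS(3) lowp(2) adm(2) c(1) c(2) top(4)
      TS[OF j(1) order_refl top(2)] C1b_norm[OF C1b_T[OF G(2)]] C1b_norm[OF G(4)]]
  have lgc: "0 \<le> 0 * (1 + lc) ^ j + lg * c" using nn c by simp
  note GT = Z.comp_top[OF j(1) Gm(2) lowp(2) adm(2) lgc c(2) Gm(1)
      TS[OF j(1) order_refl top(2)] C1b_norm[OF C1b_T[OF G(2)]] C1b_norm[OF C1b_comp(1)[OF gC(1) C1b_K[OF admissible]]]]
  have nm: "\<And>x. norm (- Ic x) \<le> aci * norm x" "\<And>x. norm (- Iu x) \<le> aui * norm x"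
    "\<And>x. norm (- x) \<le> 1 * norm (x::'a)" using nrm by auto
  have ccGm: "mdiff j (\<lambda>x. emb g (Kf (u m) (s m) x))" and cckR: "mdiff j (\<lambda>x. emb k (Rf (r m) x))"
    and ccuR: "mdiff j (\<lambda>x. emb (u m) (Rf (r m) x))" and ccrT: "mdiff j (\<lambda>x. emb (r m) (Tf (t m) x))"
    and ccsT: "mdiff j (\<lambda>x. emb (s m) (Tf (t m) x))" and ccGT: "mdiff j (\<lambda>x. emb g (Kf (u m) (s m) (Tf (t m) x)))" for m
    using Z.low_mdiff[OF Gm(2)] Z.low_mdiff[OF kR(2)] Z.low_mdiff[OF uR(2)] Z.low_mdiff[OF rT(2)] Z.low_mdiff[OF sT(2)] Z.low_mdiff[OF GT(2)]
    by auto
  have nnp: "0 \<le> a ^ j" "0 \<le> (ac + lr) ^ j" using nn by simp_all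
  note z1 = zero_le_one[where 'a = real]
  have p: "S (\<lambda>m. mderivs j (\<lambda>x. mpost Ac (emb k x))) (ac * 0)"
    "S (\<lambda>m. mderivs j (\<lambda>x. mpost Pc (emb g (Kf (u m) (s m) x)))) (1 * (0 * (1 + lc) ^ j + lg * c))"
    "S (\<lambda>m. mderivs j (\<lambda>x. mpost uminus (emb k (Rf (r m) x)))) (1 * (0 * (ac + lr) ^ j + lc * c))"
    "S (\<lambda>m. mderivs j (\<lambda>x. mpost (\<lambda>x. - Ic x) (emb (r m) (Tf (t m) x)))) (aci * (c * a ^ j + lr * d))"
    "S (\<lambda>m. mderivs j (\<lambda>x. mpost Iu (emb (u m) (Rf (r m) x)))) (aui * (c * (ac + lr) ^ j + lu * c))"
    "S (\<lambda>m. mderivs j (\<lambda>x. mpost (\<lambda>x. - Iu x) (emb g (Kf (u m) (s m) x)))) (aui * (0 * (1 + lc) ^ j + lg * c))"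
    "S (\<lambda>m. mderivs j (\<lambda>x. mpost As (emb (s m) (Tf (t m) x)))) (as * (c * a ^ j + ls * d))"
    "S (\<lambda>m. mderivs j (\<lambda>x. mpost Ps (emb g (Kf (u m) (s m) (Tf (t m) x))))) (1 * ((0 * (1 + lc) ^ j + lg * c) * a ^ j + (lg * (1 + lc)) * d))"
    using nn c nnp
    by (intro Z.mpost_top[OF lin(4) nrm(4) nn(1) _ cck[OF order_refl] kS[OF order_refl]]
        Z.mpost_top[OF lin(1) nrm(1) z1 _ ccGm Gm(1)]
        Z.mpost_top[OF linm(4) nm(3) z1 _ cckR kR(1)]
        Z.mpost_top[OF linm(2) nm(1) nn(2) _ ccrT rT(1)]
        Z.mpost_top[OF lin(6) nrm(6) nn(3) _ ccuR uR(1)]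
        Z.mpost_top[OF linm(3) nm(2) nn(3) _ ccGm Gm(1)]
        Z.mpost_top[OF lin(7) nrm(7) nn(4) _ ccsT sT(1)]
        Z.mpost_top[OF lin(3) nrm(3) z1 _ ccGT GT(1)]; simp)+
  have cp: "mdiff j (\<lambda>x. mpost Ac (emb k x))" "mdiff j (\<lambda>x. mpost Pc (emb g (Kf (u m) (s m) x)))"
    "mdiff j (\<lambda>x. mpost uminus (emb k (Rf (r m) x)))" "mdiff j (\<lambda>x. mpost Iu (emb (u m) (Rf (r m) x)))"
    "mdiff j (\<lambda>x. mpost (\<lambda>x. - Iu x) (emb g (Kf (u m) (s m) x)))" "mdiff j (\<lambda>x. mpost As (emb (s m) (Tf (t m) x)))"
    "mdiff j (\<lambda>x. mpost Ps (emb g (Kf (u m) (s m) (Tf (t m) x))))" for m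
    using mdiff_mpost[OF lin(4) cck[OF order_refl]] mdiff_mpost[OF lin(1) ccGm] mdiff_mpost[OF linm(4) cckR] mdiff_mpost[OF lin(6) ccuR]
      mdiff_mpost[OF linm(3) ccGm] mdiff_mpost[OF lin(7) ccsT] mdiff_mpost[OF lin(3) ccGT] by auto
  show "S (\<lambda>m. mderivs j (emb (nr (r m) (u m) (s m)))) ((lg + lc) * c)"
    using Z.add_top[OF mdiff_add[OF cp(1,2)] cp(3) Z.add_top[OF cp(1,2) p(1,2)] p(3)]
    unfolding emb_nr by (rule Z.S_mono) (simp add: algebra_simps)
  show "S (\<lambda>m. mderivs j (emb (nt (r m) (t m)))) (aci * (a ^ j * c + lr * d))"
    using p(4) unfolding emb_nt by (simp add: mult.commute)
  show "S (\<lambda>m. mderivs j (emb (nu (r m) (u m) (s m)))) (aui * ((ac + lr) ^ j + lg + lu) * c)"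
    using Z.add_top[OF cp(4,5) p(5,6)] unfolding emb_nu by (rule Z.S_mono) (simp add: algebra_simps)
  show "S (\<lambda>m. mderivs j (emb (ns (t m) (u m) (s m)))) (a ^ j * (as + lg) * c + (as * ls + lg * (1 + lc)) * d)"
    using Z.add_top[OF cp(6,7) p(7,8)] unfolding emb_ns by (rule Z.S_mono) (simp add: algebra_simps)
qed

text \<open>The counterpart at order 0, with differences in the sup norm in place of derivatives. A
  changed inner function costs the Lipschitz constant of the outer one, so the coefficients are
  those of \<open>step_size\<close> with j = 0.\<close>

lemma step_diff:
  assumes g1: "admissible r t u s" and g2: "admissible r' t' u' s'"
    and d: "\<And>x. norm (r x - r' x) \<le> c" "\<And>x. norm (t x - t' x) \<le> d"
      "\<And>x. norm (u x - u' x) \<le> c" "\<And>x. norm (s x - s' x) \<le> c"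
  shows "norm (nr r u s x - nr r' u' s' x) \<le> (lg + lc) * c"
    and "norm (nt r t x - nt r' t' x) \<le> aci * (c + lr * d)"
    and "norm (nu r u s x - nu r' u' s' x) \<le> aui * (1 + lg + lu) * c"
    and "norm (ns t u s x - ns t' u' s' x) \<le> (as + lg) * c + (as * ls + lg * (1 + lc)) * d"
proof -
  note G = goodD[OF g1] and G' = goodD[OF g2]
  have lip: "norm (f y - f z) \<le> L * norm (y - z)" if "C1b n L (emb f)" for f :: "'a \<Rightarrow> 'a" and y z L
    using norm_diff_le_mderiv[OF C1b_diff[OF that] C1b_norm[OF that]] .
  \<comment> \<open>First the argument is exchanged, at the cost of the Lipschitz constant of f,
    then the function.\<close>
  have two: "norm (f y - f' z) \<le> e + L * q"
    if "C1b n L (emb f)" "0 \<le> L" "norm (f z - f' z) \<le> e" "norm (y - z) \<le> q" for f f' :: "'a \<Rightarrow> 'a" and y z L e q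
    using norm_triangle_ineq[of "f y - f z" "f z - f' z"] lip[OF that(1), of y z] mult_left_mono[OF that(4,2)] that(3)
    by simp
  have R: "norm (Rf r x - Rf r' x) \<le> c" and T: "norm (Tf t x - Tf t' x) \<le> d" for x
    using d by (simp_all add: Rf_def Tf_def)
  have K: "norm (Kf u s x - Kf u' s' x) \<le> c" for x
  proof -
    have e: "Kf u s x - Kf u' s' x = (u x - u' x) + (s x - s' x)" by (simp add: Kf_def)
    have "norm (Pc (Kf u s x - Kf u' s' x)) \<le> c" "norm (Pu (Kf u s x - Kf u' s' x)) \<le> c"
      "norm (Ps (Kf u s x - Kf u' s' x)) \<le> c"
      unfolding e using d(3,4)[of x] order_trans[OF norm_ge_zero d(1)]
      by (simp_all add: linear_simps[OF lin(1)] linear_simps[OF lin(2)] linear_simps[OF lin(3)] G G')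
    then show ?thesis using mx[of "Kf u s x - Kf u' s' x"] by linarith
  qed
  have gK: "norm (g (Kf u s x) - g (Kf u' s' x)) \<le> lg * c" for x
    using two[OF gC(1) nn(5), of "Kf u' s' x" g 0 "Kf u s x" c] K by simp
  have kR: "norm (k (Rf r x) - k (Rf r' x)) \<le> lc * c" for x
    using two[OF kC(1) nn(6), of "Rf r' x" k 0 "Rf r x" c] R by simp
  have uR: "norm (u (Rf r x) - u' (Rf r' x)) \<le> c + lu * c" for x
    by (rule two[OF G(3) nn(9)]) (rule d R T)+
  have rT: "norm (r (Tf t x) - r' (Tf t' x)) \<le> c + lr * d" for x
    by (rule two[OF G(1) nn(7)]) (rule d R T)+
  have sT: "norm (s (Tf t x) - s' (Tf t' x)) \<le> c + ls * d" for x
    by (rule two[OF G(4) nn(10)]) (rule d R T)+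
  have KT: "norm (g (Kf u s (Tf t x)) - g (Kf u' s' (Tf t' x))) \<le> lg * (c + (1 + lc) * d)" for x
  proof -
    have "norm (Kf u s (Tf t x) - Kf u' s' (Tf t' x)) \<le> c + (1 + lc) * d"
      by (rule two[OF C1b_K[OF g1]]) (use K T nn in auto)
    then show ?thesis
      using two[OF gC(1) nn(5), of "Kf u' s' (Tf t' x)" g 0 "Kf u s (Tf t x)" "c + (1 + lc) * d"] by simp
  qed
  have L: "norm (L (y - z)) \<le> l * e" if "norm (y - z) \<le> e" "\<And>x. norm (L x) \<le> l * norm x" "0 \<le> l" for L :: "'a \<Rightarrow> 'a" and y z l e
    using that(2)[of "y - z"] mult_left_mono[OF that(1,3)] by linarith
  have e1: "nr r u s x - nr r' u' s' x = Pc (g (Kf u s x) - g (Kf u' s' x)) - (k (Rf r x) - k (Rf r' x))"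
    by (simp add: nr_def linear_simps[OF lin(1)])
  show "norm (nr r u s x - nr r' u' s' x) \<le> (lg + lc) * c"
    unfolding e1 using norm_triangle_ineq4[of "Pc (g (Kf u s x) - g (Kf u' s' x))" "k (Rf r x) - k (Rf r' x)"]
      L[OF gK nrm(1), of x] kR[of x] by (simp add: distrib_right)
  have e2: "nt r t x - nt r' t' x = - Ic (r (Tf t x) - r' (Tf t' x))"
    by (simp add: nt_def linear_simps[OF lin(5)])
  show "norm (nt r t x - nt r' t' x) \<le> aci * (c + lr * d)"
    unfolding e2 using L[OF rT nrm(5) nn(2), of x] by simp
  have e3: "nu r u s x - nu r' u' s' x = Iu (u (Rf r x) - u' (Rf r' x)) - Iu (g (Kf u s x) - g (Kf u' s' x))"
    by (simp add: nu_def linear_simps[OF lin(6)])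
  show "norm (nu r u s x - nu r' u' s' x) \<le> aui * (1 + lg + lu) * c"
    unfolding e3 using norm_triangle_ineq4[of "Iu (u (Rf r x) - u' (Rf r' x))" "Iu (g (Kf u s x) - g (Kf u' s' x))"]
      L[OF uR nrm(6) nn(3), of x] L[OF gK nrm(6) nn(3), of x] by (simp add: algebra_simps)
  have e4: "ns t u s x - ns t' u' s' x = As (s (Tf t x) - s' (Tf t' x)) + Ps (g (Kf u s (Tf t x)) - g (Kf u' s' (Tf t' x)))"
    by (simp add: ns_def linear_simps[OF lin(7)] linear_simps[OF lin(3)])
  show "norm (ns t u s x - ns t' u' s' x) \<le> (as + lg) * c + (as * ls + lg * (1 + lc)) * d"
    unfolding e4 using norm_triangle_ineq[of "As (s (Tf t x) - s' (Tf t' x))" "Ps (g (Kf u s (Tf t x)) - g (Kf u' s' (Tf t' x)))"]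
      L[OF sT nrm(7) nn(4), of x] L[OF KT nrm(3), of x] by (simp add: algebra_simps)
qed

end

lemma tendsto_along_tail_nhds:
  assumes "((\<lambda>(m, y). u m y) \<longlongrightarrow> w) (tail_nhds p)" "\<psi> \<longlonglongrightarrow> p"
  shows "(\<lambda>m. u m (\<psi> m)) \<longlonglongrightarrow> w"
proof -
  have "filterlim (\<lambda>m. (m, \<psi> m)) (tail_nhds p) sequentially"
    unfolding tail_nhds_def using assms(2) by (intro filterlim_Pair filterlim_ident)
  from filterlim_compose[OF assms(1) this] show ?thesis by simp
qed

context cm_setting
begin

section \<open>The iterates: invariance, boundedness, convergence order by order, and the
  limit\<close>

primrec iter :: "nat \<Rightarrow> ('a \<Rightarrow> 'a) \<times> ('a \<Rightarrow> 'a) \<times> ('a \<Rightarrow> 'a) \<times> ('a \<Rightarrow> 'a)" where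
  "iter 0 = (\<lambda>x. 0, \<lambda>x. 0, \<lambda>x. 0, \<lambda>x. 0)"
| "iter (Suc m) = (case iter m of (r, t, u, s) \<Rightarrow> (nr r u s, nt r t, nu r u s, ns t u s))"

definition rr where "rr m = fst (iter m)"
definition tt where "tt m = fst (snd (iter m))"
definition uu where "uu m = fst (snd (snd (iter m)))"
definition ss where "ss m = snd (snd (snd (iter m)))"

lemma iter_0: "rr 0 = (\<lambda>x. 0)" "tt 0 = (\<lambda>x. 0)" "uu 0 = (\<lambda>x. 0)" "ss 0 = (\<lambda>x. 0)"
  by (simp_all add: rr_def tt_def uu_def ss_def)

lemma iter_Suc: "rr (Suc m) = nr (rr m) (uu m) (ss m)" "tt (Suc m) = nt (rr m) (tt m)"
  "uu (Suc m) = nu (rr m) (uu m) (ss m)" "ss (Suc m) = ns (tt m) (uu m) (ss m)"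
  by (simp_all add: rr_def tt_def uu_def ss_def case_prod_unfold)

lemma admissible_zero: "admissible (\<lambda>x. 0) (\<lambda>x. 0) (\<lambda>x. 0) (\<lambda>x. 0)"
proof -
  have z: "C1b n l (emb (\<lambda>x :: 'a. 0 :: 'a))" if "0 \<le> l" for l
    by (rule C1b_linear) (use that in auto)
  have "mderiv (emb (\<lambda>x :: 'a. 0 :: 'a)) 0 = 0"
    using C1b_norm[OF z[OF order_refl], of 0] by simp
  then show ?thesis
    using z nn unfolding admissible_def by (simp add: linear_simps[OF lin(1)] linear_simps[OF lin(2)] linear_simps[OF lin(3)])
qed

lemma admissible_iter: "admissible (rr m) (tt m) (uu m) (ss m)"
  by (induction m) (simp_all only: iter_0 admissible_zero iter_Suc admissible_step)

definition bounded_deriv :: "nat \<Rightarrow> ('a \<Rightarrow> 'a) \<Rightarrow> bool"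
  where "bounded_deriv j f \<longleftrightarrow> (\<exists>C. \<forall>x. norm (mderivs j (emb f) x) \<le> C)"

lemma bounded_deriv_bounded_modulo: "bounded_deriv j f \<longleftrightarrow> bounded_modulo (\<lambda>_. 0) (\<lambda>m. mderivs j (emb f)) c"
  by (simp add: bounded_deriv_def bounded_modulo_def)

lemma bounded_deriv_0: "bounded_deriv 0 f \<longleftrightarrow> (\<exists>C. \<forall>x. norm (f x) \<le> C)"
  by (simp add: bounded_deriv_def)

text \<open>A qualitative statement, without uniformity in the iterates: with N = 0, any size in the
  sense of \<open>bounded_modulo\<close> means boundedness, so for orders above 0
  \<open>step_size\<close> applies with sizes 0. It guarantees that the suprema formed in
  \<open>iter_uniform_bound\<close> are finite.\<close>

lemma bounded_deriv_step:
  assumes admissible: "admissible r t u s"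
    and b: "\<And>i. i \<le> Suc n \<Longrightarrow> bounded_deriv i r \<and> bounded_deriv i t \<and> bounded_deriv i u \<and> bounded_deriv i s" and j: "j \<le> Suc n"
  shows "bounded_deriv j (nr r u s) \<and> bounded_deriv j (nt r t) \<and> bounded_deriv j (nu r u s) \<and> bounded_deriv j (ns t u s)"
proof (cases "j = 0")
  case True
  obtain Cr Ct Cu Cs Cg Ck where C: "\<And>x. norm (r x) \<le> Cr" "\<And>x. norm (u x) \<le> Cu" "\<And>x. norm (s x) \<le> Cs"
    "\<And>x. norm (g x) \<le> Cg" "\<And>x. norm (k x) \<le> Ck"
    using b[of 0] gB[of 0] kB[of 0] unfolding bounded_deriv_0 by (simp del: all_simps) blast
  have L: "norm (L y) \<le> l * e" if "norm y \<le> e" "\<And>x. norm (L x) \<le> l * norm x" "0 \<le> l" for L :: "'a \<Rightarrow> 'a" and y l e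
    using that(2)[of "y"] mult_left_mono[OF that(1,3)] by linarith
  have "norm (nr r u s x) \<le> ac * Ck + 1 * Cg + Ck" for x
    unfolding nr_def using L[OF C(5) nrm(4) nn(1)] L[OF C(4) nrm(1)] C(5)
    by (intro norm_triangle_mono) auto
  moreover have "norm (nt r t x) \<le> aci * Cr" for x
    unfolding nt_def using L[OF C(1) nrm(5) nn(2)] by simp
  moreover have "norm (nu r u s x) \<le> aui * Cu + aui * Cg" for x
    unfolding nu_def using L[OF C(2) nrm(6) nn(3)] L[OF C(4) nrm(6) nn(3)]
    by (intro norm_triangle_mono) auto
  moreover have "norm (ns t u s x) \<le> as * Cs + 1 * Cg" for x
    unfolding ns_def using L[OF C(3) nrm(7) nn(4)] L[OF C(4) nrm(3)]
    by (intro norm_triangle_mono) auto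
  ultimately show ?thesis unfolding True bounded_deriv_0 by blast
next
  case False
  have *: "size_system (bounded_modulo (\<lambda>_. 0)) (\<lambda>\<psi>. True)" by (rule bounded_modulo_size_system) simp
  have bb: "bounded_modulo (\<lambda>_. 0) (\<lambda>m. mderivs i (emb r)) c" "bounded_modulo (\<lambda>_. 0) (\<lambda>m. mderivs i (emb t)) c"
    "bounded_modulo (\<lambda>_. 0) (\<lambda>m. mderivs i (emb u)) c" "bounded_modulo (\<lambda>_. 0) (\<lambda>m. mderivs i (emb s)) c"
    "bounded_modulo (\<lambda>_. 0) (\<lambda>m. mderivs i (emb g)) c" "bounded_modulo (\<lambda>_. 0) (\<lambda>m. mderivs i (emb k)) c" if "i \<le> j" for i c
    using b[of i] gB[of i] kB[of i] that j bounded_deriv_bounded_modulo[of i] unfolding bounded_deriv_def by auto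
  note st = step_size[OF *, of j "\<lambda>_. r" "\<lambda>_. t" "\<lambda>_. u" "\<lambda>_. s" 0 0]
  show ?thesis
  proof (intro conjI)
    show "bounded_deriv j (nr r u s)"
      by (rule bounded_deriv_bounded_modulo[THEN iffD2], rule st(1)) (use admissible False j bb in auto)
    show "bounded_deriv j (nt r t)"
      by (rule bounded_deriv_bounded_modulo[THEN iffD2], rule st(2)) (use admissible False j bb in auto)
    show "bounded_deriv j (nu r u s)"
      by (rule bounded_deriv_bounded_modulo[THEN iffD2], rule st(3)) (use admissible False j bb in auto)
    show "bounded_deriv j (ns t u s)"
      by (rule bounded_deriv_bounded_modulo[THEN iffD2], rule st(4)) (use admissible False j bb in auto)
  qed
qed

lemma bounded_deriv_iter:
  "j \<le> Suc n \<Longrightarrow> bounded_deriv j (rr m) \<and> bounded_deriv j (tt m) \<and> bounded_deriv j (uu m) \<and> bounded_deriv j (ss m)"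
proof (induction m arbitrary: j)
  case 0
  have "bounded_deriv j (\<lambda>x. 0)"
  proof (cases j)
    case (Suc i)
    obtain w where "\<forall>x. mderivs j (emb (\<lambda>x::'a. 0 :: 'a)) x = w"
      using linear_mderivs(2)[of "\<lambda>x::'a. 0 :: 'a" i] Suc by auto
    then show ?thesis by (auto simp: bounded_deriv_def)
  qed (auto simp: bounded_deriv_0)
  then show ?case by (simp add: iter_0)
next
  case (Suc m)
  show ?case unfolding iter_Suc by (rule bounded_deriv_step[OF admissible_iter Suc.IH Suc.prems])
qed

lemma iter_geometric:
  obtains C \<kappa> where "0 \<le> \<kappa>" "\<kappa> < 1"
    "\<And>m x. norm (rr (Suc m) x - rr m x) \<le> C * \<kappa> ^ m" "\<And>m x. norm (tt (Suc m) x - tt m x) \<le> C * \<kappa> ^ m"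
    "\<And>m x. norm (uu (Suc m) x - uu m x) \<le> C * \<kappa> ^ m" "\<And>m x. norm (ss (Suc m) x - ss m x) \<le> C * \<kappa> ^ m"
proof -
  obtain w \<kappa> where k: "0 < w" "0 \<le> \<kappa>" "\<kappa> < 1" "lg + lc \<le> \<kappa>" "aui * ((ac + lr) ^ 0 + lg + lu) \<le> \<kappa>"
    "a ^ 0 * (as + lg) + (as * ls + lg * (1 + lc)) * w \<le> \<kappa>" "aci * (a ^ 0 + lr * w) \<le> \<kappa> * w"
    by (rule contraction_constants[of 0]) auto
  obtain C1 C2 C3 C4 where C: "\<And>x. norm (rr 1 x) \<le> C1" "\<And>x. norm (tt 1 x) \<le> C2"
    "\<And>x. norm (uu 1 x) \<le> C3" "\<And>x. norm (ss 1 x) \<le> C4"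
    using bounded_deriv_iter[of 0 1] unfolding bounded_deriv_0 by auto
  \<comment> \<open>The iteration starts at zero, so the first differences are the first iterates; c
    bounds them in the product norm where t counts with weight 1/w.\<close>
  define c where "c = max (max C1 C3) (max C4 (C2 / w))"
  have "C2 \<le> w * c" using k(1) by (simp add: c_def pos_divide_le_eq[symmetric] mult.commute[of w])
  have c0: "0 \<le> c" using C(1) norm_ge_zero order_trans unfolding c_def by (meson max.coboundedI1)
  have main: "(\<forall>x. norm (rr (Suc m) x - rr m x) \<le> c * \<kappa> ^ m) \<and> (\<forall>x. norm (tt (Suc m) x - tt m x) \<le> w * (c * \<kappa> ^ m)) \<and>
      (\<forall>x. norm (uu (Suc m) x - uu m x) \<le> c * \<kappa> ^ m) \<and> (\<forall>x. norm (ss (Suc m) x - ss m x) \<le> c * \<kappa> ^ m)" for m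
  proof (induction m)
    case 0
    have "C1 \<le> c" "C3 \<le> c" "C4 \<le> c" by (simp_all add: c_def)
    then show ?case
      using order_trans[OF C(1)] order_trans[OF C(2) \<open>C2 \<le> w * c\<close>] order_trans[OF C(3)] order_trans[OF C(4)]
      by (simp add: iter_0)
  next
    case (Suc m)
    define e where "e = c * \<kappa> ^ m"
    have e: "0 \<le> e" using c0 k by (simp add: e_def)
    have IH: "\<And>x. norm (rr (Suc m) x - rr m x) \<le> e" "\<And>x. norm (tt (Suc m) x - tt m x) \<le> w * e"
      "\<And>x. norm (uu (Suc m) x - uu m x) \<le> e" "\<And>x. norm (ss (Suc m) x - ss m x) \<le> e"
      using Suc by (simp_all add: e_def)
    note st = step_diff[OF admissible_iter admissible_iter IH, folded iter_Suc]
    have "(lg + lc) * e \<le> \<kappa> * e" "aui * (1 + lg + lu) * e \<le> \<kappa> * e"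
      "((as + lg) + (as * ls + lg * (1 + lc)) * w) * e \<le> \<kappa> * e" "aci * (1 + lr * w) * e \<le> \<kappa> * w * e"
      using k e by (intro mult_right_mono; simp)+
    then have "norm (rr (Suc (Suc m)) x - rr (Suc m) x) \<le> \<kappa> * e" "norm (tt (Suc (Suc m)) x - tt (Suc m) x) \<le> w * (\<kappa> * e)"
      "norm (uu (Suc (Suc m)) x - uu (Suc m) x) \<le> \<kappa> * e" "norm (ss (Suc (Suc m)) x - ss (Suc m) x) \<le> \<kappa> * e" for x
      using st[of x] by (simp_all add: algebra_simps)
    then show ?case by (simp add: e_def mult_ac)
  qed
  define D where "D = max c (w * c)"
  have cD: "c * \<kappa> ^ m \<le> D * \<kappa> ^ m" "w * (c * \<kappa> ^ m) \<le> D * \<kappa> ^ m" for m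
    using mult_right_mono[of "w * c" D "\<kappa> ^ m"] mult_right_mono[of c D "\<kappa> ^ m"] k(2) by (simp_all add: D_def mult.assoc)
  show ?thesis
    by (rule that[of \<kappa> D]) (use k main cD order_trans in blast)+
qed

text \<open>The oscillation is taken at each x separately, so a fixed continuous map has oscillation
  0 even where its continuity is not uniform. This is how the top-order derivatives of g and k
  enter.\<close>

lemma osc_const:
  fixes f :: "'b::real_normed_vector \<Rightarrow> 'c::real_normed_vector"
  assumes "continuous_on UNIV f" "\<And>x. norm (f x) \<le> C"
  shows "osc (\<lambda>m. f) 0"
proof (rule osc_of_tendsto)
  fix x :: 'b
  have "filterlim snd (nhds x) (tail_nhds x)" unfolding tail_nhds_def by (rule filterlim_snd)
  moreover have "(f \<longlongrightarrow> f x) (nhds x)"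
    using assms(1) by (simp add: continuous_on_eq_continuous_at isCont_def tendsto_at_iff_tendsto_nhds)
  ultimately have "((\<lambda>p. f (snd p)) \<longlongrightarrow> f x) (tail_nhds x)" by (rule filterlim_compose[rotated])
  then show "((\<lambda>(m, y). f y) \<longlongrightarrow> f x) (tail_nhds x)" by (simp add: case_prod_unfold)
qed (use assms in auto)

lemma cont_mderivs:
  assumes "mdiff (Suc n) u" "continuous_on UNIV (mderivs (Suc n) u)" "j \<le> Suc n"
  shows "continuous_on UNIV (mderivs j u)"
proof (cases "j = Suc n")
  case False
  then show ?thesis
    using assms has_derivative_continuous[OF mdiff_works[OF assms(1)], of j]
    by (auto simp: continuous_on_eq_continuous_at)
qed (use assms in simp)

lemma osc_g: assumes "j \<le> Suc n" shows "osc (\<lambda>m. mderivs j (emb g)) 0"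
proof -
  obtain C where "\<And>x. norm (mderivs j (emb g) x) \<le> C" using gB[OF assms] by blast
  then show ?thesis by (rule osc_const[OF cont_mderivs[OF C1b_mdiff[OF gC(1)] gcont assms]])
qed

lemma osc_k: assumes "j \<le> Suc n" shows "osc (\<lambda>m. mderivs j (emb k)) 0"
proof -
  obtain C where "\<And>x. norm (mderivs j (emb k) x) \<le> C" using kB[OF assms] by blast
  then show ?thesis by (rule osc_const[OF cont_mderivs[OF C1b_mdiff[OF kC(1)] kcont assms]])
qed

definition rlim where "rlim x = lim (\<lambda>m. rr m x)"
definition tlim where "tlim x = lim (\<lambda>m. tt m x)"
definition ulim where "ulim x = lim (\<lambda>m. uu m x)"
definition slim where "slim x = lim (\<lambda>m. ss m x)"

lemma iter_lim: "(\<lambda>m. rr m x) \<longlonglongrightarrow> rlim x" "(\<lambda>m. tt m x) \<longlonglongrightarrow> tlim x"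
  "(\<lambda>m. uu m x) \<longlonglongrightarrow> ulim x" "(\<lambda>m. ss m x) \<longlonglongrightarrow> slim x"
  and iter_bdd: "\<exists>C. \<forall>m x. norm (rr m x) \<le> C \<and> norm (tt m x) \<le> C \<and> norm (uu m x) \<le> C \<and> norm (ss m x) \<le> C"
proof -
  obtain C \<kappa> where g: "0 \<le> \<kappa>" "\<kappa> < 1"
    "\<And>m x. norm (rr (Suc m) x - rr m x) \<le> C * \<kappa> ^ m" "\<And>m x. norm (tt (Suc m) x - tt m x) \<le> C * \<kappa> ^ m"
    "\<And>m x. norm (uu (Suc m) x - uu m x) \<le> C * \<kappa> ^ m" "\<And>m x. norm (ss (Suc m) x - ss m x) \<le> C * \<kappa> ^ m"
    by (rule iter_geometric) blast
  note l = geometric_limit[where f=rr, OF g(1-3)] geometric_limit[where f=tt, OF g(1,2,4)]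
    geometric_limit[where f=uu, OF g(1,2,5)] geometric_limit[where f=ss, OF g(1,2,6)]
  show "(\<lambda>m. rr m x) \<longlonglongrightarrow> rlim x" "(\<lambda>m. tt m x) \<longlonglongrightarrow> tlim x"
    "(\<lambda>m. uu m x) \<longlonglongrightarrow> ulim x" "(\<lambda>m. ss m x) \<longlonglongrightarrow> slim x"
    using l(1,3,5,7) by (simp_all add: iter_0 rlim_def tlim_def ulim_def slim_def)
  show "\<exists>C. \<forall>m x. norm (rr m x) \<le> C \<and> norm (tt m x) \<le> C \<and> norm (uu m x) \<le> C \<and> norm (ss m x) \<le> C"
    using l(2,4,6,8) by (intro exI[of _ "C / (1 - \<kappa>)"]) (simp add: iter_0)
qed

lemma C1b_lip: "C1b n L (emb f) \<Longrightarrow> norm (f y - f z) \<le> L * norm (y - z)"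
  using norm_diff_le_mderiv[of f] C1b_diff C1b_norm by blast

lemmas iter_admissible = goodD(1-4)[OF admissible_iter]

lemma iter_tail_nhds: "((\<lambda>(m, y). rr m y) \<longlongrightarrow> rlim x) (tail_nhds x)" "((\<lambda>(m, y). tt m y) \<longlongrightarrow> tlim x) (tail_nhds x)"
  "((\<lambda>(m, y). uu m y) \<longlongrightarrow> ulim x) (tail_nhds x)" "((\<lambda>(m, y). ss m y) \<longlongrightarrow> slim x) (tail_nhds x)"
  by (rule tendsto_tail_nhds, rule C1b_lip, rule iter_admissible, rule iter_lim)+

lemma RTK_lim: "(\<lambda>m. Rf (rr m) x) \<longlonglongrightarrow> Rf rlim x" "(\<lambda>m. Tf (tt m) x) \<longlonglongrightarrow> Tf tlim x"
  "(\<lambda>m. Kf (uu m) (ss m) x) \<longlonglongrightarrow> Kf ulim slim x"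
  unfolding Rf_def Tf_def Kf_def by (intro tendsto_intros iter_lim)+

lemma RTK_cont_conv: "cont_conv (\<lambda>m. Rf (rr m))" "cont_conv (\<lambda>m. Tf (tt m))" "cont_conv (\<lambda>m. Kf (uu m) (ss m))"
  by (rule cconvI, rule tendsto_tail_nhds, rule C1b_lip, rule C1b_R[OF iter_admissible(1)] C1b_T[OF iter_admissible(2)] C1b_K[OF admissible_iter],
      rule RTK_lim)+

lemma osc_0: "osc (\<lambda>m. mderivs 0 (emb (rr m))) 0" "osc (\<lambda>m. mderivs 0 (emb (tt m))) 0"
  "osc (\<lambda>m. mderivs 0 (emb (uu m))) 0" "osc (\<lambda>m. mderivs 0 (emb (ss m))) 0"
proof -
  obtain C where C: "\<And>m x. norm (rr m x) \<le> C" "\<And>m x. norm (tt m x) \<le> C" "\<And>m x. norm (uu m x) \<le> C" "\<And>m x. norm (ss m x) \<le> C"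
    using iter_bdd by auto
  have "osc (\<lambda>m. emb (f m)) 0" if "\<And>m x. norm (f m x) \<le> C" "\<And>x. ((\<lambda>(m, y). f m y) \<longlongrightarrow> w x) (tail_nhds x)"
    for f :: "nat \<Rightarrow> 'a \<Rightarrow> 'a" and w
  proof (rule osc_of_tendsto)
    show "((\<lambda>(m, y). emb (f m) y) \<longlongrightarrow> mconst (w x)) (tail_nhds x)" for x
      using bounded_linear.tendsto[OF bounded_linear_mconst that(2)] by (simp add: case_prod_unfold)
  qed (use that in auto)
  then show "osc (\<lambda>m. mderivs 0 (emb (rr m))) 0" "osc (\<lambda>m. mderivs 0 (emb (tt m))) 0"
  "osc (\<lambda>m. mderivs 0 (emb (uu m))) 0" "osc (\<lambda>m. mderivs 0 (emb (ss m))) 0"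
    unfolding mderivs_0 using C iter_tail_nhds by blast+
qed

definition osc4 where
  "osc4 j c d \<longleftrightarrow> osc (\<lambda>m. mderivs j (emb (rr m))) c \<and> osc (\<lambda>m. mderivs j (emb (tt m))) d \<and>
    osc (\<lambda>m. mderivs j (emb (uu m))) c \<and> osc (\<lambda>m. mderivs j (emb (ss m))) c"

text \<open>Taking suprema over x turns the coefficients of \<open>step_size\<close> into a
  recursion N (m + 1) \<le> \<kappa> N m + D for the weighted norm of the derivatives of order j.
  The lower orders, already bounded uniformly along the iteration, go into D.\<close>

lemma iter_uniform_bound:
  assumes j: "1 \<le> j" "j \<le> Suc n" and low: "\<And>i. i < j \<Longrightarrow> osc4 i 0 0"
  obtains C where "\<And>m x. norm (mderivs j (emb (rr m)) x) \<le> C" "\<And>m x. norm (mderivs j (emb (tt m)) x) \<le> C"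
    "\<And>m x. norm (mderivs j (emb (uu m)) x) \<le> C" "\<And>m x. norm (mderivs j (emb (ss m)) x) \<le> C"
proof -
  obtain w \<kappa> where k: "0 < w" "0 \<le> \<kappa>" "\<kappa> < 1" "lg + lc \<le> \<kappa>" "aui * ((ac + lr) ^ j + lg + lu) \<le> \<kappa>"
    "a ^ j * (as + lg) + (as * ls + lg * (1 + lc)) * w \<le> \<kappa>" "aci * (a ^ j + lr * w) \<le> \<kappa> * w"
    by (rule contraction_constants[OF j(2)]) auto
  define f where "f m x = max (max (norm (mderivs j (emb (rr m)) x)) (norm (mderivs j (emb (uu m)) x)))
    (max (norm (mderivs j (emb (ss m)) x)) (norm (mderivs j (emb (tt m)) x) / w))" for m x
  define N where "N m = (SUP x. f m x)" for m
  have f_le: "f m x \<le> b \<longleftrightarrow> norm (mderivs j (emb (rr m)) x) \<le> b \<and> norm (mderivs j (emb (uu m)) x) \<le> b \<and>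
      norm (mderivs j (emb (ss m)) x) \<le> b \<and> norm (mderivs j (emb (tt m)) x) \<le> w * b" for m x b
    using k(1) by (auto simp: f_def pos_divide_le_eq mult.commute)
  have fN: "f m x \<le> N m" for m x
  proof -
    obtain C1 C2 C3 C4 where C: "\<And>x. norm (mderivs j (emb (rr m)) x) \<le> C1" "\<And>x. norm (mderivs j (emb (tt m)) x) \<le> C2"
      "\<And>x. norm (mderivs j (emb (uu m)) x) \<le> C3" "\<And>x. norm (mderivs j (emb (ss m)) x) \<le> C4"
      using bounded_deriv_iter[OF j(2), of m] unfolding bounded_deriv_def by auto
    have "f m x \<le> max (max C1 C3) (max C4 (C2 / w))" for x
      unfolding f_def using C k(1) by (intro max.mono divide_right_mono) auto
    then show ?thesis unfolding N_def by (intro cSUP_upper bdd_aboveI2) auto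
  qed
  then have N: "norm (mderivs j (emb (rr m)) x) \<le> N m" "norm (mderivs j (emb (uu m)) x) \<le> N m"
    "norm (mderivs j (emb (ss m)) x) \<le> N m" "norm (mderivs j (emb (tt m)) x) \<le> w * N m" for m x
    using f_le[of m x "N m"] by auto
  have N0: "0 \<le> N m" for m using N(1)[of m 0] norm_ge_zero order_trans by blast
  note sys = bounded_modulo_size_system[OF N0]
  have bdm0: "bounded_modulo N u 0" if "osc u 0" for u :: "nat \<Rightarrow> 'a \<Rightarrow> ('a, 'a) multilin"
    using osc_bounded[OF that] by (simp add: bounded_modulo_def)
  have top: "bounded_modulo N (\<lambda>m. mderivs j (emb (rr m))) 1" "bounded_modulo N (\<lambda>m. mderivs j (emb (tt m))) w"
    "bounded_modulo N (\<lambda>m. mderivs j (emb (uu m))) 1" "bounded_modulo N (\<lambda>m. mderivs j (emb (ss m))) 1"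
    unfolding bounded_modulo_def using N by (auto intro!: exI[of _ 0])
  have st: "bounded_modulo N (\<lambda>m. mderivs j (emb (rr (Suc m)))) ((lg + lc) * 1)"
    "bounded_modulo N (\<lambda>m. mderivs j (emb (tt (Suc m)))) (aci * (a ^ j * 1 + lr * w))"
    "bounded_modulo N (\<lambda>m. mderivs j (emb (uu (Suc m)))) (aui * ((ac + lr) ^ j + lg + lu) * 1)"
    "bounded_modulo N (\<lambda>m. mderivs j (emb (ss (Suc m)))) (a ^ j * (as + lg) * 1 + (as * ls + lg * (1 + lc)) * w)"
    unfolding iter_Suc
    by (rule step_size[OF sys j admissible_iter _ _ _ _ _ _ _ _ _ _ _ top];
        use low j osc_g osc_k k(1) in \<open>auto simp: osc4_def intro!: bdm0\<close>)+
  have "\<exists>C. \<forall>m x. norm (mderivs j (emb (rr (Suc m))) x) \<le> \<kappa> * N m + C" "\<exists>C. \<forall>m x. norm (mderivs j (emb (tt (Suc m))) x) \<le> \<kappa> * w * N m + C"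
    "\<exists>C. \<forall>m x. norm (mderivs j (emb (uu (Suc m))) x) \<le> \<kappa> * N m + C" "\<exists>C. \<forall>m x. norm (mderivs j (emb (ss (Suc m))) x) \<le> \<kappa> * N m + C"
    using st[THEN size_system.S_mono[OF sys]] k unfolding bounded_modulo_def by simp_all
  then obtain C1 C2 C3 C4 where C: "\<And>m x. norm (mderivs j (emb (rr (Suc m))) x) \<le> \<kappa> * N m + C1"
    "\<And>m x. norm (mderivs j (emb (tt (Suc m))) x) \<le> \<kappa> * w * N m + C2"
    "\<And>m x. norm (mderivs j (emb (uu (Suc m))) x) \<le> \<kappa> * N m + C3" "\<And>m x. norm (mderivs j (emb (ss (Suc m))) x) \<le> \<kappa> * N m + C4"
    by auto
  define D where "D = max (max C1 C3) (max C4 (C2 / w))"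
  have D: "C1 \<le> D" "C3 \<le> D" "C4 \<le> D" "C2 \<le> w * D"
    using k(1) by (simp_all add: D_def pos_divide_le_eq[symmetric] mult.commute[of w])
  have NS: "N (Suc m) \<le> \<kappa> * N m + D" for m
    unfolding N_def[of "Suc m"]
  proof (rule cSUP_least)
    fix x
    have "\<kappa> * w * N m + C2 \<le> w * (\<kappa> * N m + D)" using D(4) by (simp add: algebra_simps)
    then show "f (Suc m) x \<le> \<kappa> * N m + D"
      unfolding f_le using C[of m x] D by linarith
  qed simp
  \<comment> \<open>The values up to M are invariant under x \<mapsto> \<kappa> x + D and include
    the start \<open>N 0\<close>.\<close>
  define M where "M = max (N 0) (D / (1 - \<kappa>))"
  have "D / (1 - \<kappa>) \<le> M" by (simp add: M_def)
  then have "D \<le> (1 - \<kappa>) * M" using k(3) by (simp add: pos_divide_le_eq mult.commute)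
  have NM: "N m \<le> M" for m
  proof (induction m)
    case (Suc m)
    show ?case using NS[of m] mult_left_mono[OF Suc k(2)] \<open>D \<le> (1 - \<kappa>) * M\<close> by (simp add: algebra_simps)
  qed (simp add: M_def)
  show ?thesis
  proof (rule that[of "max M (w * M)"])
    fix m x
    have "w * N m \<le> w * M" using NM[of m] k(1) by simp
    then show "norm (mderivs j (emb (rr m)) x) \<le> max M (w * M)" "norm (mderivs j (emb (tt m)) x) \<le> max M (w * M)"
      "norm (mderivs j (emb (uu m)) x) \<le> max M (w * M)" "norm (mderivs j (emb (ss m)) x) \<le> max M (w * M)"
      using N[where m=m and x=x] NM[of m] by linarith+
  qed
qed

text \<open>Suppose the weighted oscillation at order j is at most c. A step bounds it by \<kappa> c
  for the shifted sequence, whose oscillation is that of the sequence itself; so c improves to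
  \<kappa> c, and by repetition to 0. The finite c to begin with is supplied by
  \<open>iter_uniform_bound\<close>.\<close>

lemma iter_osc: "j \<le> Suc n \<Longrightarrow> osc4 j 0 0"
proof (induction j rule: less_induct)
  case (less j)
  show ?case
  proof (cases "j = 0")
    case True
    then show ?thesis using osc_0 by (simp add: osc4_def)
  next
    case False
    then have j: "1 \<le> j" "j \<le> Suc n" using less by auto
    have low: "osc4 i 0 0" if "i < j" for i using less that by auto
    obtain C where C: "\<And>m x. norm (mderivs j (emb (rr m)) x) \<le> C" "\<And>m x. norm (mderivs j (emb (tt m)) x) \<le> C"
      "\<And>m x. norm (mderivs j (emb (uu m)) x) \<le> C" "\<And>m x. norm (mderivs j (emb (ss m)) x) \<le> C"
      using iter_uniform_bound[OF j low] by blast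
    obtain w \<kappa> where k: "0 < w" "0 \<le> \<kappa>" "\<kappa> < 1" "lg + lc \<le> \<kappa>" "aui * ((ac + lr) ^ j + lg + lu) \<le> \<kappa>"
      "a ^ j * (as + lg) + (as * ls + lg * (1 + lc)) * w \<le> \<kappa>" "aci * (a ^ j + lr * w) \<le> \<kappa> * w"
      by (rule contraction_constants[OF j(2)]) auto
    have contr: "osc4 j (\<kappa> * c) (w * (\<kappa> * c))" if o: "osc4 j c (w * c)" and c: "0 \<le> c" for c
    proof -
      have top: "osc (\<lambda>m. mderivs j (emb (rr m))) c" "osc (\<lambda>m. mderivs j (emb (tt m))) (w * c)"
        "osc (\<lambda>m. mderivs j (emb (uu m))) c" "osc (\<lambda>m. mderivs j (emb (ss m))) c"
        using o by (auto simp: osc4_def)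
      have st: "osc (\<lambda>m. mderivs j (emb (rr (Suc m)))) ((lg + lc) * c)"
        "osc (\<lambda>m. mderivs j (emb (tt (Suc m)))) (aci * (a ^ j * c + lr * (w * c)))"
        "osc (\<lambda>m. mderivs j (emb (uu (Suc m)))) (aui * ((ac + lr) ^ j + lg + lu) * c)"
        "osc (\<lambda>m. mderivs j (emb (ss (Suc m)))) (a ^ j * (as + lg) * c + (as * ls + lg * (1 + lc)) * (w * c))"
        unfolding iter_Suc
        by (rule step_size[OF osc_size_system j admissible_iter _ _ _ _ _ _ RTK_cont_conv c _ top];
            use low j osc_g osc_k k(1) c in \<open>auto simp: osc4_def\<close>)+
      have "(lg + lc) * c \<le> \<kappa> * c" "aui * ((ac + lr) ^ j + lg + lu) * c \<le> \<kappa> * c"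
        "(a ^ j * (as + lg) + (as * ls + lg * (1 + lc)) * w) * c \<le> \<kappa> * c" "aci * (a ^ j + lr * w) * c \<le> \<kappa> * w * c"
        using k c by (intro mult_right_mono; simp)+
      then have le: "(lg + lc) * c \<le> \<kappa> * c" "aui * ((ac + lr) ^ j + lg + lu) * c \<le> \<kappa> * c"
        "a ^ j * (as + lg) * c + (as * ls + lg * (1 + lc)) * (w * c) \<le> \<kappa> * c"
        "aci * (a ^ j * c + lr * (w * c)) \<le> w * (\<kappa> * c)"
        by (simp_all add: algebra_simps)
      show ?thesis
        unfolding osc4_def
        by (intro conjI osc_shift[OF osc_mono[OF st(1) le(1)] C(1)] osc_shift[OF osc_mono[OF st(2) le(4)] C(2)]
            osc_shift[OF osc_mono[OF st(3) le(2)] C(3)] osc_shift[OF osc_mono[OF st(4) le(3)] C(4)])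
    qed
    \<comment> \<open>A family bounded by C oscillates by at most 2 C; the second entry makes
      \<open>w * c0\<close> large enough for t.\<close>
    define c0 where "c0 = max (2 * C) (2 * C / w)"
    have C0: "0 \<le> C" using C(1) norm_ge_zero order_trans by blast
    have c0: "0 \<le> c0" "2 * C \<le> c0" "2 * C \<le> w * c0"
      using C0 k(1) by (auto simp: c0_def pos_divide_le_eq[symmetric] mult.commute[of w] le_max_iff_disj)
    have pw: "osc4 j (\<kappa> ^ i * c0) (w * (\<kappa> ^ i * c0))" for i
    proof (induction i)
      case 0
      show ?case
        unfolding osc4_def power_0 mult_1_left
        by (intro conjI; rule osc_mono[OF osc_bounded_le], rule C, rule c0)
    next
      case (Suc i)
      show ?case using contr[OF Suc] k c0 by (simp add: mult.assoc)
    qed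
    have "osc4 j e e" if "0 < e" for e
    proof -
      have "(\<lambda>i. \<kappa> ^ i * c0) \<longlonglongrightarrow> 0 * c0" using k by (intro tendsto_intros LIMSEQ_power_zero) auto
      moreover have "0 < min e (e / w)" using that k(1) by simp
      ultimately have "\<forall>\<^sub>F i in sequentially. \<kappa> ^ i * c0 < min e (e / w)"
        by (intro order_tendstoD) auto
      then obtain i where "\<kappa> ^ i * c0 < min e (e / w)" by (auto simp: eventually_sequentially)
      then have "\<kappa> ^ i * c0 \<le> e" "w * (\<kappa> ^ i * c0) \<le> e"
        using k(1) by (auto simp: pos_less_divide_eq mult.commute[of w])
      then show ?thesis using pw[of i] unfolding osc4_def using osc_mono by blast
    qed
    then show ?thesis unfolding osc4_def by (simp add: osc_closed)
  qed
qed

theorem limit_solution: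
  shows "admissible rlim tlim ulim slim"
    and "\<And>j. j \<le> Suc n \<Longrightarrow> bounded_deriv j rlim \<and> bounded_deriv j tlim \<and> bounded_deriv j ulim \<and> bounded_deriv j slim"
    and "continuous_on UNIV (mderivs (Suc n) (emb rlim))" "continuous_on UNIV (mderivs (Suc n) (emb tlim))"
      "continuous_on UNIV (mderivs (Suc n) (emb ulim))" "continuous_on UNIV (mderivs (Suc n) (emb slim))"
    and "rlim = nr rlim ulim slim" "tlim = nt rlim tlim" "ulim = nu rlim ulim slim" "slim = ns tlim ulim slim"
proof -
  have tower: "mdiff (Suc n) (emb w) \<and> (\<forall>x. (\<lambda>m. mderivs 1 (emb (f m)) x) \<longlonglongrightarrow> mderivs 1 (emb w) x) \<and>
      continuous_on UNIV (mderivs (Suc n) (emb w)) \<and> (\<forall>j\<le>Suc n. bounded_deriv j w)"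
    if "\<And>m. C1b n l (emb (f m))" "\<And>j. j \<le> Suc n \<Longrightarrow> osc (\<lambda>m. mderivs j (emb (f m))) 0" "\<And>x. (\<lambda>m. f m x) \<longlonglongrightarrow> w x"
    for f :: "nat \<Rightarrow> 'a \<Rightarrow> 'a" and w l
    using limit_tower[of "Suc n" "\<lambda>m. emb (f m)" "emb w", OF C1b_mdiff[OF that(1)] that(2)
        bounded_linear.tendsto[OF bounded_linear_mconst that(3)]]
    unfolding bounded_deriv_def by simp
  have oscs: "osc (\<lambda>m. mderivs j (emb (rr m))) 0" "osc (\<lambda>m. mderivs j (emb (tt m))) 0"
    "osc (\<lambda>m. mderivs j (emb (uu m))) 0" "osc (\<lambda>m. mderivs j (emb (ss m))) 0" if "j \<le> Suc n" for j
    using iter_osc[OF that] by (auto simp: osc4_def)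
  note R = tower[OF iter_admissible(1) oscs(1) iter_lim(1)] and T = tower[OF iter_admissible(2) oscs(2) iter_lim(2)]
    and U = tower[OF iter_admissible(3) oscs(3) iter_lim(3)] and V = tower[OF iter_admissible(4) oscs(4) iter_lim(4)]
  show "\<And>j. j \<le> Suc n \<Longrightarrow> bounded_deriv j rlim \<and> bounded_deriv j tlim \<and> bounded_deriv j ulim \<and> bounded_deriv j slim"
    and "continuous_on UNIV (mderivs (Suc n) (emb rlim))" "continuous_on UNIV (mderivs (Suc n) (emb tlim))"
      "continuous_on UNIV (mderivs (Suc n) (emb ulim))" "continuous_on UNIV (mderivs (Suc n) (emb slim))"
    using R T U V by auto
  have ddlim: "(\<lambda>m. mderiv (emb (rr m)) x) \<longlonglongrightarrow> mderiv (emb rlim) x" "(\<lambda>m. mderiv (emb (tt m)) x) \<longlonglongrightarrow> mderiv (emb tlim) x"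
    "(\<lambda>m. mderiv (emb (uu m)) x) \<longlonglongrightarrow> mderiv (emb ulim) x" "(\<lambda>m. mderiv (emb (ss m)) x) \<longlonglongrightarrow> mderiv (emb slim) x" for x
    using R T U V by (simp_all add: mderivs_Suc)
  have nb: "norm z \<le> l" if "f \<longlonglongrightarrow> z" "\<And>m. norm (f m) \<le> l" for f :: "nat \<Rightarrow> ('a, 'a) multilin" and z l
    using tendsto_upperbound[OF tendsto_norm[OF that(1)]] that(2) by (simp add: always_eventually)
  have C1: "C1b n lr (emb rlim)" "C1b n lt (emb tlim)" "C1b n lu (emb ulim)" "C1b n ls (emb slim)"
    using R T U V nb[OF ddlim(1) C1b_norm[OF iter_admissible(1)]] nb[OF ddlim(2) C1b_norm[OF iter_admissible(2)]]
      nb[OF ddlim(3) C1b_norm[OF iter_admissible(3)]] nb[OF ddlim(4) C1b_norm[OF iter_admissible(4)]]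
    by (auto simp: C1b_def)
  have z0: "z = 0" if "f \<longlonglongrightarrow> z" "\<And>m. f m = 0" for f :: "nat \<Rightarrow> 'z::real_normed_vector" and z
  proof -
    have "f = (\<lambda>m. 0)" using that(2) by auto
    then show ?thesis using that(1) by (simp add: LIMSEQ_const_iff)
  qed
  have fixp: "P z = z" if "f \<longlonglongrightarrow> z" "\<And>m. P (f m) = f m" "bounded_linear P" for f :: "nat \<Rightarrow> 'a" and z P
    using LIMSEQ_unique[OF bounded_linear.tendsto[OF that(3,1)]] that by simp
  have zerop: "P z = 0" if "f \<longlonglongrightarrow> z" "\<And>m. P (f m) = 0" "bounded_linear P" for f :: "nat \<Rightarrow> 'a" and z P
    using z0[OF bounded_linear.tendsto[OF that(3,1)]] that by simp
  note D = goodD[OF admissible_iter]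
  show "admissible rlim tlim ulim slim"
    unfolding admissible_def
  proof (intro conjI allI)
    fix x
    show "Pc (rlim x) = rlim x" by (rule fixp[OF iter_lim(1) D(13) lin(1)])
    show "Pu (rlim x) = 0" by (rule zerop[OF iter_lim(1) D(14) lin(2)])
    show "Ps (rlim x) = 0" by (rule zerop[OF iter_lim(1) D(15) lin(3)])
    show "Pc (tlim x) = tlim x" by (rule fixp[OF iter_lim(2) D(16) lin(1)])
    show "Pc (ulim x) = 0" by (rule zerop[OF iter_lim(3) D(17) lin(1)])
    show "Pu (ulim x) = ulim x" by (rule fixp[OF iter_lim(3) D(18) lin(2)])
    show "Ps (ulim x) = 0" by (rule zerop[OF iter_lim(3) D(19) lin(3)])
    show "Pc (slim x) = 0" by (rule zerop[OF iter_lim(4) D(20) lin(1)])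
    show "Pu (slim x) = 0" by (rule zerop[OF iter_lim(4) D(21) lin(2)])
    show "Ps (slim x) = slim x" by (rule fixp[OF iter_lim(4) D(22) lin(3)])
    show "rlim 0 = 0" by (rule z0[OF iter_lim(1) D(5)])
    show "tlim 0 = 0" by (rule z0[OF iter_lim(2) D(6)])
    show "ulim 0 = 0" by (rule z0[OF iter_lim(3) D(7)])
    show "slim 0 = 0" by (rule z0[OF iter_lim(4) D(8)])
    show "mderiv (emb rlim) 0 = 0" by (rule z0[OF ddlim(1) D(9)])
    show "mderiv (emb tlim) 0 = 0" by (rule z0[OF ddlim(2) D(10)])
    show "mderiv (emb ulim) 0 = 0" by (rule z0[OF ddlim(3) D(11)])
    show "mderiv (emb slim) 0 = 0" by (rule z0[OF ddlim(4) D(12)])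
  qed (use C1 in auto)
  have cont: "(\<lambda>m. f (p m)) \<longlonglongrightarrow> f q" if "C1b n l (emb f)" "p \<longlonglongrightarrow> q" for f :: "'a \<Rightarrow> 'a" and p q l
    using has_derivative_continuous[OF mconst_differentiable[OF C1b_diff[OF that(1)]]] that(2)
    by (simp add: isCont_tendsto_compose)
  \<comment> \<open>In the last three limits an iterate is evaluated at an iterate, so pointwise
    convergence is not enough; continuous convergence along the moving points is used.\<close>
  have lims: "(\<lambda>m. g (Kf (uu m) (ss m) x)) \<longlonglongrightarrow> g (Kf ulim slim x)" "(\<lambda>m. k (Rf (rr m) x)) \<longlonglongrightarrow> k (Rf rlim x)"
    "(\<lambda>m. rr m (Tf (tt m) x)) \<longlonglongrightarrow> rlim (Tf tlim x)" "(\<lambda>m. uu m (Rf (rr m) x)) \<longlonglongrightarrow> ulim (Rf rlim x)"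
    "(\<lambda>m. ss m (Tf (tt m) x)) \<longlonglongrightarrow> slim (Tf tlim x)" for x
    by (rule cont[OF gC(1)] cont[OF kC(1)] tendsto_along_tail_nhds[OF iter_tail_nhds(1)] tendsto_along_tail_nhds[OF iter_tail_nhds(3)]
        tendsto_along_tail_nhds[OF iter_tail_nhds(4)], rule RTK_lim)+
  have KT: "(\<lambda>m. g (Kf (uu m) (ss m) (Tf (tt m) x))) \<longlonglongrightarrow> g (Kf ulim slim (Tf tlim x))" for x
    by (intro cont[OF gC(1)] tendsto_along_tail_nhds[OF tendsto_tail_nhds[OF C1b_lip[OF C1b_K[OF admissible_iter]]] RTK_lim(2)] RTK_lim)
  have L: "(\<lambda>m. L (f m)) \<longlonglongrightarrow> L z" if "f \<longlonglongrightarrow> z" "bounded_linear L" for f :: "nat \<Rightarrow> 'a" and z and L :: "'a \<Rightarrow> 'a"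
    by (rule bounded_linear.tendsto[OF that(2,1)])
  show "rlim = nr rlim ulim slim"
  proof
    fix x
    have "(\<lambda>m. rr (Suc m) x) \<longlonglongrightarrow> nr rlim ulim slim x"
      unfolding iter_Suc nr_def by (intro tendsto_add tendsto_minus tendsto_const L[OF _ lin(1)] lims)
    then show "rlim x = nr rlim ulim slim x" using LIMSEQ_unique[OF LIMSEQ_Suc[OF iter_lim(1)]] by blast
  qed
  show "tlim = nt rlim tlim"
  proof
    fix x
    have "(\<lambda>m. tt (Suc m) x) \<longlonglongrightarrow> nt rlim tlim x"
      unfolding iter_Suc nt_def by (intro tendsto_minus L[OF _ lin(5)] lims)
    then show "tlim x = nt rlim tlim x" using LIMSEQ_unique[OF LIMSEQ_Suc[OF iter_lim(2)]] by blast
  qed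
  show "ulim = nu rlim ulim slim"
  proof
    fix x
    have "(\<lambda>m. uu (Suc m) x) \<longlonglongrightarrow> nu rlim ulim slim x"
      unfolding iter_Suc nu_def by (intro tendsto_add tendsto_minus L[OF _ lin(6)] lims)
    then show "ulim x = nu rlim ulim slim x" using LIMSEQ_unique[OF LIMSEQ_Suc[OF iter_lim(3)]] by blast
  qed
  show "slim = ns tlim ulim slim"
  proof
    fix x
    have "(\<lambda>m. ss (Suc m) x) \<longlonglongrightarrow> ns tlim ulim slim x"
      unfolding iter_Suc ns_def by (intro tendsto_add L[OF _ lin(7)] L[OF _ lin(3)] lims KT)
    then show "slim x = ns tlim ulim slim x" using LIMSEQ_unique[OF LIMSEQ_Suc[OF iter_lim(4)]] by blast
  qed
qed

end

section \<open>Subspaces and derivatives given on lists\<close>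

text \<open>Baire category argument for the bounded inverse theorem. Boundedness of the inverses has to
  be proved, because the supremum defining onorm_on is unspecified for an unbounded map.\<close>

lemma Baire_scaled_ball:
  fixes S :: "'a::banach set" and p :: "'a \<Rightarrow> real"
  assumes S: "subspace S" "closed S"
    and p: "\<And>x y. x \<in> S \<Longrightarrow> y \<in> S \<Longrightarrow> p (x - y) \<le> p x + p y"
      "\<And>c x. x \<in> S \<Longrightarrow> p (c *\<^sub>R x) = \<bar>c\<bar> * p x"
  obtains M where "\<And>y. y \<in> S \<Longrightarrow> \<exists>z\<in>S. p z \<le> M * norm y \<and> norm (y - z) \<le> norm y / 2"
proof -
  \<comment> \<open>p will be the norm of the inverse operator. Its sublevel sets exhaust S, so by
    Baire one of them is dense in some ball of S.\<close>
  define B where "B k = {y \<in> S. p y \<le> real k}" for k :: nat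
  have cm: "completely_metrizable_space (top_of_set S)"
    using completely_metrizable_space_closedin[OF completely_metrizable_space_euclidean, of S] S(2) by auto
  have "\<exists>k. top_of_set S interior_of (closure (B k)) \<noteq> {}"
  proof (rule ccontr)
    assume "\<not> ?thesis"
    then have "top_of_set S interior_of (closure (B k)) = {}" for k by auto
    moreover have "closure (B k) \<subseteq> S" for k
      using closure_minimal[of "B k" S] S(2) by (auto simp: B_def)
    then have "closedin (top_of_set S) (closure (B k))" for k
      by (simp add: closed_subset)
    ultimately have "top_of_set S interior_of \<Union>(range (\<lambda>k. closure (B k))) = {}"
      by (intro Baire_category_alt) (auto simp: cm)
    moreover have "\<Union>(range (\<lambda>k. closure (B k))) = S"
    proof
      show "\<Union>(range (\<lambda>k. closure (B k))) \<subseteq> S" using \<open>\<And>k. closure (B k) \<subseteq> S\<close> by auto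
      show "S \<subseteq> \<Union>(range (\<lambda>k. closure (B k)))"
      proof
        fix y assume "y \<in> S"
        obtain k where "p y \<le> real k" using real_arch_simple by blast
        then show "y \<in> \<Union>(range (\<lambda>k. closure (B k)))"
          using \<open>y \<in> S\<close> closure_subset[of "B k"] by (auto simp: B_def)
      qed
    qed
    ultimately show False
      using interior_of_topspace[of "top_of_set S"] subspace_0[OF S(1)] by auto
  qed
  then obtain k T y0 where T: "openin (top_of_set S) T" "y0 \<in> T" "T \<subseteq> closure (B k)"
    unfolding interior_of_def by auto
  then obtain e where e: "0 < e" "ball y0 e \<inter> S \<subseteq> T"
    unfolding openin_contains_ball by blast
  have y0: "y0 \<in> S" using T openin_subset by fastforce
  \<comment> \<open>The ball is moved to the origin: y is the difference of y0 + y and y0, both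
    approximated from \<open>B k\<close>, and p of the difference of the approximants is at most 2
    k.\<close>
  have step: "\<exists>z\<in>S. p z \<le> 2 * real k \<and> norm (y - z) < \<delta>" if y: "y \<in> S" "norm y < e" and \<delta>: "0 < \<delta>" for y \<delta>
  proof -
    have "y0 + y \<in> closure (B k)"
      using e(2) T(3) y y0 subspace_add[OF S(1)] by (auto simp: dist_norm subset_iff)
    then obtain b1 where b1: "b1 \<in> B k" "dist b1 (y0 + y) < \<delta>/2"
      using \<delta> by (meson closure_approachable half_gt_zero)
    have "y0 \<in> closure (B k)" using T by auto
    then obtain b2 where b2: "b2 \<in> B k" "dist b2 y0 < \<delta>/2"
      using \<delta> by (meson closure_approachable half_gt_zero)
    have "p (b1 - b2) \<le> 2 * real k" using p(1)[of b1 b2] b1 b2 by (auto simp: B_def)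
    moreover have "norm (y - (b1 - b2)) < \<delta>"
      using b1(2) b2(2) norm_triangle_ineq4[of "b2 - y0" "b1 - (y0 + y)"] by (simp add: dist_norm algebra_simps)
    moreover have "b1 - b2 \<in> S" using b1 b2 subspace_diff[OF S(1)] by (auto simp: B_def)
    ultimately show ?thesis by blast
  qed
  have "\<exists>z\<in>S. p z \<le> (4 * real k / e) * norm y \<and> norm (y - z) \<le> norm y / 2" if "y \<in> S" for y
  proof (cases "y = 0")
    case True
    then show ?thesis using subspace_0[OF S(1)] p(2)[of 0 0] by (intro bexI[of _ 0]) auto
  next
    case False
    \<comment> \<open>The vector c y has norm e/2, and an approximation of it within e/4 becomes one
      of y within half its norm after scaling back.\<close>
    define c where "c = e / (2 * norm y)"
    have c: "0 < c" using False e by (simp add: c_def)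
    have "norm (c *\<^sub>R y) < e" using False e by (simp add: c_def)
    moreover have "c *\<^sub>R y \<in> S" using that subspace_scale[OF S(1)] by blast
    ultimately obtain z where z: "z \<in> S" "p z \<le> 2 * real k" "norm (c *\<^sub>R y - z) < e / 4"
      using step[of "c *\<^sub>R y" "e/4"] e by auto
    have "p (inverse c *\<^sub>R z) \<le> (4 * real k / e) * norm y"
      using z(2) c p(2)[OF z(1), of "inverse c"] mult_left_mono[OF z(2), of "inverse c"] False e
      by (simp add: c_def field_simps)
    moreover have "norm (y - inverse c *\<^sub>R z) \<le> norm y / 2"
    proof -
      have "y - inverse c *\<^sub>R z = inverse c *\<^sub>R (c *\<^sub>R y - z)" using c by (simp add: scaleR_diff_right)
      then have "norm (y - inverse c *\<^sub>R z) = inverse c * norm (c *\<^sub>R y - z)" using c by simp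
      also have "\<dots> \<le> inverse c * (e / 4)" using c z(3) by (intro mult_left_mono) auto
      also have "\<dots> = norm y / 2" using False e by (simp add: c_def)
      finally show ?thesis .
    qed
    ultimately show ?thesis using z(1) subspace_scale[OF S(1)] by blast
  qed
  then show ?thesis using that by blast
qed

text \<open>Successive approximation: the remainders w i at least halve, so the preimages x i of the
  approximants have an absolutely convergent sum in S. As A is continuous, this sum is mapped to y,
  and its norm is bounded by a geometric series.\<close>

lemma bounded_inverse_on:
  fixes S :: "'a::banach set"
  assumes S: "subspace S" "closed S" and A: "bounded_linear A" "bij_betw A S S"
  shows "\<exists>C. \<forall>y\<in>S. norm (inv_into S A y) \<le> C * norm y"
    and "\<And>x y c. x \<in> S \<Longrightarrow> y \<in> S \<Longrightarrow> inv_into S A (c *\<^sub>R x + y) = c *\<^sub>R inv_into S A x + inv_into S A y"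
proof -
  let ?I = "inv_into S A"
  have I: "?I y \<in> S" "A (?I y) = y" if "y \<in> S" for y
    using that A(2) bij_betw_imp_surj_on inv_into_into f_inv_into_f by (metis, metis)
  have IA: "?I (A x) = x" if "x \<in> S" for x
    using that A(2) bij_betw_inv_into_left by metis
  show lin: "?I (c *\<^sub>R x + y) = c *\<^sub>R ?I x + ?I y" if "x \<in> S" "y \<in> S" for x y c
  proof -
    have "A (c *\<^sub>R ?I x + ?I y) = c *\<^sub>R x + y"
      using I that by (simp add: linear_simps[OF A(1)])
    then show ?thesis
      using IA[of "c *\<^sub>R ?I x + ?I y"] I that S(1) by (simp add: subspace_add subspace_scale)
  qed
  have I0: "?I 0 = 0" using lin[of 0 0 1] subspace_0[OF S(1)] by simp
  have scale: "?I (c *\<^sub>R x) = c *\<^sub>R ?I x" if "x \<in> S" for c x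
    using lin[of x 0 c] subspace_0[OF S(1)] that I0 by simp
  have diff: "?I (x - y) = ?I x - ?I y" if "x \<in> S" "y \<in> S" for x y
    using lin[of y x "-1"] that by simp
  obtain M where M: "\<And>y. y \<in> S \<Longrightarrow> \<exists>z\<in>S. norm (?I z) \<le> M * norm y \<and> norm (y - z) \<le> norm y / 2"
  proof (rule Baire_scaled_ball[OF S, of "\<lambda>y. norm (?I y)"])
    show "norm (?I (x - y)) \<le> norm (?I x) + norm (?I y)" if "x \<in> S" "y \<in> S" for x y
      using diff[OF that] norm_triangle_ineq4 by simp
  qed (use scale in auto)
  then obtain Z where Z: "\<And>y. y \<in> S \<Longrightarrow> Z y \<in> S \<and> norm (?I (Z y)) \<le> M * norm y \<and> norm (y - Z y) \<le> norm y / 2"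
    by metis
  have "norm (?I y) \<le> 2 * \<bar>M\<bar> * norm y" if y: "y \<in> S" for y
  proof -
    define w where "w = rec_nat y (\<lambda>_ v. v - Z v)"
    have w0: "w 0 = y" and wS: "w (Suc i) = w i - Z (w i)" for i by (simp_all add: w_def)
    have wmem: "w i \<in> S" for i by (induction i) (use y Z subspace_diff[OF S(1)] in \<open>auto simp: w0 wS\<close>)
    have wn: "norm (w i) \<le> norm y * (1/2) ^ i" for i
    proof (induction i)
      case (Suc i)
      then show ?case using Z[OF wmem[of i]] by (simp add: wS)
    qed (simp add: w0)
    define x where "x i = ?I (Z (w i))" for i
    have xn: "norm (x i) \<le> (\<bar>M\<bar> * norm y) * (1/2) ^ i" for i
    proof -
      have "norm (x i) \<le> M * norm (w i)" using Z[OF wmem[of i]] by (simp add: x_def)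
      also have "\<dots> \<le> \<bar>M\<bar> * (norm y * (1/2) ^ i)" using wn by (intro mult_mono) auto
      finally show ?thesis by (simp add: mult.assoc)
    qed
    have gs: "summable (\<lambda>i. (\<bar>M\<bar> * norm y) * (1/2::real) ^ i)" by (intro summable_mult summable_geometric) simp
    then have xs: "summable x" by (rule summable_comparison_test'[of _ 0]) (use xn in auto)
    have part: "A (\<Sum>i<m. x i) = y - w m" for m
    proof (induction m)
      case (Suc m)
      have "A (x m) = Z (w m)" using I Z[OF wmem[of m]] by (simp add: x_def)
      then show ?case using Suc by (simp add: linear_simps[OF A(1)] wS)
    qed (simp add: w0 linear_simps[OF A(1)])
    have "(\<lambda>m. A (\<Sum>i<m. x i)) \<longlonglongrightarrow> A (suminf x)"
      by (intro bounded_linear.tendsto[OF A(1)] summable_LIMSEQ xs)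
    moreover have "(\<lambda>m. A (\<Sum>i<m. x i)) \<longlonglongrightarrow> y - 0"
    proof -
      have "(\<lambda>i. norm y * (1/2::real) ^ i) \<longlonglongrightarrow> norm y * 0" by (intro tendsto_intros LIMSEQ_power_zero) simp
      then have "w \<longlonglongrightarrow> 0" using wn by (intro Lim_null_comparison[of w]) (auto intro: always_eventually)
      then show ?thesis unfolding part by (intro tendsto_intros)
    qed
    ultimately have Ax: "A (suminf x) = y" using LIMSEQ_unique by fastforce
    have "suminf x \<in> S"
    proof (rule closed_sequentially[OF S(2) _ summable_LIMSEQ[OF xs]])
      show "(\<Sum>i<m. x i) \<in> S" for m
        using I Z wmem by (intro subspace_sum[OF S(1)]) (auto simp: x_def)
    qed
    then have "?I y = suminf x" using IA Ax by force
    also have "norm (suminf x) \<le> (\<Sum>i. (\<bar>M\<bar> * norm y) * (1/2) ^ i)"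
      by (rule norm_suminf_le[OF xn gs])
    also have "\<dots> = 2 * \<bar>M\<bar> * norm y"
      by (subst suminf_mult) (simp_all add: suminf_geometric summable_geometric)
    finally show ?thesis .
  qed
  then show "\<exists>C. \<forall>y\<in>S. norm (?I y) \<le> C * norm y" by blast
qed

section \<open>Multilinear maps on a subspace, given on lists\<close>

lemma mlin_onD:
  assumes "mlin_on S k B" "length xs + length ys + 1 = k" "set xs \<subseteq> S" "set ys \<subseteq> S" "u \<in> S" "w \<in> S"
  shows "B (xs @ (a *\<^sub>R u + w) # ys) = a *\<^sub>R B (xs @ u # ys) + B (xs @ w # ys)"
  using assms(1)[unfolded mlin_on_def, rule_format, of "xs @ u # ys" "length xs" u w a] assms(2-)
  by (simp add: list_update_append)

lemma mlin_on_hom: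
  assumes "subspace S" "mlin_on S k B" "length xs + length ys + 1 = k" "set xs \<subseteq> S" "set ys \<subseteq> S" "u \<in> S"
  shows "B (xs @ (a *\<^sub>R u) # ys) = a *\<^sub>R B (xs @ u # ys)"
  using mlin_onD[OF assms(2-6) subspace_0[OF assms(1)], of a]
    mlin_onD[OF assms(2-5) subspace_0[OF assms(1)] subspace_0[OF assms(1)], of 1] by simp

text \<open>Replacing the entries by their signs one at a time pulls out their norms, a zero entry
  staying 0. Thus the supremum over unit lists controls all lists. \<open>us\<close> collects the
  entries already treated.\<close>

lemma mlin_on_sgn:
  assumes "subspace S" "mlin_on S k B" "length us + length vs = k" "set us \<subseteq> S" "set vs \<subseteq> S"
  shows "B (us @ vs) = pnorm vs *\<^sub>R B (us @ map sgn vs)"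
  using assms(3-)
proof (induction vs arbitrary: us)
  case (Cons v vs)
  have s: "sgn v \<in> S" using Cons.prems by (simp add: sgn_div_norm subspace_scale[OF assms(1)])
  have "B (us @ (norm v *\<^sub>R sgn v) # vs) = norm v *\<^sub>R B (us @ sgn v # vs)"
    using Cons.prems s by (intro mlin_on_hom[OF assms(1,2)]) auto
  also have "norm v *\<^sub>R sgn v = v" by (cases "v = 0") (simp_all add: sgn_div_norm)
  finally show ?case using Cons.IH[of "us @ [sgn v]"] Cons.prems s by simp
qed simp

lemma mnorm_upper:
  assumes "subspace S" "mlin_on S k B" "mbounded S k B" "length vs = k" "set vs \<subseteq> S"
  shows "norm (B vs) \<le> mnorm S k B * pnorm vs"
proof -
  have "map sgn vs \<in> unit_lists S k"
    using assms subspace_scale[OF assms(1)] by (auto simp: unit_lists_def norm_sgn) (auto simp: sgn_div_norm)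
  then have "norm (B (map sgn vs)) \<le> mnorm S k B"
    unfolding mnorm_def using assms(3) by (intro cSUP_upper) (auto simp: mbounded_def)
  then have "pnorm vs * norm (B (map sgn vs)) \<le> mnorm S k B * pnorm vs"
    using mult_right_mono[OF \<open>norm (B (map sgn vs)) \<le> mnorm S k B\<close> pnorm_nonneg[of vs]] by (simp only: mult.commute)
  then show ?thesis using mlin_on_sgn[OF assms(1,2), of "[]" vs] assms by simp
qed

lemma unit_lists_zero: "subspace S \<Longrightarrow> replicate k 0 \<in> unit_lists S k"
  by (auto simp: unit_lists_def subspace_0)

lemma mnorm_le:
  assumes "subspace S" "\<And>vs. vs \<in> unit_lists S k \<Longrightarrow> norm (B vs) \<le> C"
  shows "mnorm S k B \<le> C"
  unfolding mnorm_def using unit_lists_zero[OF assms(1)] assms(2) by (intro cSUP_least) auto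

lemma mnorm_nonneg:
  assumes "subspace S" "mbounded S k B" shows "0 \<le> mnorm S k B"
  unfolding mnorm_def using unit_lists_zero[OF assms(1)] assms(2)
  by (intro cSUP_upper2[of _ _ "replicate k 0"]) (auto simp: mbounded_def)

text \<open>The bound C, of any size, makes the supremum in \<open>onorm_on\<close> one over a
  bounded set; then \<open>onorm_on S f\<close> is a bound itself.\<close>

lemma onorm_on_bound:
  assumes S: "subspace S" and lin: "\<And>x y c. x \<in> S \<Longrightarrow> y \<in> S \<Longrightarrow> f (c *\<^sub>R x + y) = c *\<^sub>R f x + f y"
    and b: "\<And>x. x \<in> S \<Longrightarrow> norm (f x) \<le> C * norm x"
  shows "x \<in> S \<Longrightarrow> norm (f x) \<le> onorm_on S f * norm x" "0 \<le> onorm_on S f"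
proof -
  have ml: "mlin_on S 1 (\<lambda>vs. f (hd vs))"
    unfolding mlin_on_def using lin by (auto simp: length_Suc_conv)
  have "norm (f (hd vs)) \<le> \<bar>C\<bar>" if vs: "vs \<in> unit_lists S 1" for vs
  proof -
    obtain v where v: "vs = [v]" "v \<in> S" "norm v \<le> 1"
      using vs by (auto simp: unit_lists_def length_Suc_conv)
    have "C * norm v \<le> \<bar>C\<bar> * norm v" by (intro mult_right_mono) auto
    also have "\<dots> \<le> \<bar>C\<bar>" using v by (simp add: mult_left_le)
    finally show ?thesis using b[OF v(2)] v(1) by simp
  qed
  then have mb: "mbounded S 1 (\<lambda>vs. f (hd vs))"
    unfolding mbounded_def by (intro bdd_aboveI2) blast
  show "0 \<le> onorm_on S f" unfolding onorm_on_def by (rule mnorm_nonneg[OF S mb])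
  show "x \<in> S \<Longrightarrow> norm (f x) \<le> onorm_on S f * norm x"
    using mnorm_upper[OF S ml mb, of "[x]"] by (simp add: onorm_on_def)
qed

text \<open>The derivative of order j of f o P, built from a derivative B of f given on lists: every
  entry is projected first, and all other orders are 0.\<close>

definition mpull :: "nat \<Rightarrow> ('a::real_normed_vector \<Rightarrow> 'a) \<Rightarrow> ('a list \<Rightarrow> 'b::real_normed_vector) \<Rightarrow> ('a, 'b) multilin"
  where "mpull j P B = Multilin (\<lambda>vs. if length vs = j then B (map P vs) else 0)"

lemma pnorm_map_le:
  assumes "\<And>x. norm (P x) \<le> norm x" shows "pnorm (map P vs) \<le> pnorm vs"
  by (induction vs) (auto intro!: mult_mono assms)

lemma mpull:
  assumes S: "subspace S" and P: "bounded_linear P" "\<And>x. P x \<in> S" "\<And>x. norm (P x) \<le> norm x"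
    and B: "mlin_on S j B" "mbounded S j B"
  shows "mapp (mpull j P B) vs = (if length vs = j then B (map P vs) else 0)"
    and "norm (mpull j P B) \<le> mnorm S j B"
proof -
  have bd: "norm (B (map P vs)) \<le> mnorm S j B * pnorm vs" if "length vs = j" for vs
  proof -
    have "norm (B (map P vs)) \<le> mnorm S j B * pnorm (map P vs)"
      using that P(2) by (intro mnorm_upper[OF S B]) auto
    also have "\<dots> \<le> mnorm S j B * pnorm vs"
      by (intro mult_left_mono pnorm_map_le P(3) mnorm_nonneg[OF S B(2)])
    finally show ?thesis .
  qed
  have eq: "mapp (mpull j P B) = (\<lambda>vs. if length vs = j then B (map P vs) else 0)"
    unfolding mpull_def
  proof (rule Multilin_inverse, intro CollectI conjI allI)
    fix xs ys u v and a :: real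
    show "(if length (xs @ (a *\<^sub>R u + v) # ys) = j then B (map P (xs @ (a *\<^sub>R u + v) # ys)) else 0) =
        a *\<^sub>R (if length (xs @ u # ys) = j then B (map P (xs @ u # ys)) else 0) +
        (if length (xs @ v # ys) = j then B (map P (xs @ v # ys)) else 0)"
      using P(2) mlin_onD[OF B(1), of "map P xs" "map P ys" "P u" "P v" a]
      by (auto simp: linear_simps[OF P(1)] image_subset_iff)
    have "norm (if length vs = j then B (map P vs) else 0) \<le> mnorm S j B * pnorm vs" for vs
      using bd mnorm_nonneg[OF S B(2)] by auto
    then show "\<exists>C. \<forall>vs. norm (if length vs = j then B (map P vs) else 0) \<le> C * pnorm vs" by blast
  qed
  then show "mapp (mpull j P B) vs = (if length vs = j then B (map P vs) else 0)" by simp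
  show "norm (mpull j P B) \<le> mnorm S j B"
    using bd mnorm_nonneg[OF S B(2)] by (intro multilin_norm_bound) (auto simp: eq)
qed

text \<open>The chain rule with the linear inner map P, done directly on remainders: the remainder
  of the pulled-back family at y is the pull-back of the remainder of D at P y, and neither pulling
  back nor P increases norms.\<close>

lemma Cn_on_mderivs:
  fixes f :: "'a::real_normed_vector \<Rightarrow> 'b::real_normed_vector" and P :: "'a \<Rightarrow> 'a"
  assumes S: "subspace S" and P: "bounded_linear P" "\<And>x. P x \<in> S" "\<And>x. norm (P x) \<le> norm x"
    and D: "Cn_on n S T f D"
  shows "mdiff n (emb (\<lambda>x. f (P x)))" "\<And>j x. j \<le> n \<Longrightarrow> mderivs j (emb (\<lambda>x. f (P x))) x = mpull j P (D j (P x))"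
    and "continuous_on UNIV (mderivs n (emb (\<lambda>x. f (P x))))"
proof -
  define U where "U j x = mpull j P (D j (P x))" for j x
  have ml: "mlin_on S j (D j x)" "mbounded S j (D j x)" if "j \<le> n" "x \<in> S" for j x
    using D that by (auto simp: Cn_on_def)
  have D0: "D 0 x [] = f x" if "x \<in> S" for x using D that by (auto simp: Cn_on_def)
  have Dd: "((\<lambda>y. mnorm S j (\<lambda>vs. D j y vs - D j x vs - D (Suc j) x ((y - x) # vs)) / norm (y - x)) \<longlongrightarrow> 0) (at x within S)"
    if "j < n" "x \<in> S" for j x using D that by (auto simp: Cn_on_def)
  have Dc: "((\<lambda>y. mnorm S n (\<lambda>vs. D n y vs - D n x vs)) \<longlongrightarrow> 0) (at x within S)" if "x \<in> S" for x
    using D that by (auto simp: Cn_on_def)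
  have mapU: "mapp (U j x) vs = (if length vs = j then D j (P x) (map P vs) else 0)" if "j \<le> n" for j x vs
    unfolding U_def using mpull(1)[OF S P ml[OF that P(2)]] .
  have ml_diff: "mlin_on S j (\<lambda>vs. B vs - B' vs)" if "mlin_on S j B" "mlin_on S j B'" for j and B B' :: "'a list \<Rightarrow> 'b"
    using that unfolding mlin_on_def by (simp add: algebra_simps)
  have mb_diff: "mbounded S j (\<lambda>vs. B vs - B' vs)" if mb: "mbounded S j B" "mbounded S j B'" for j and B B' :: "'a list \<Rightarrow> 'b"
  proof -
    obtain C C' where "\<And>vs. vs \<in> unit_lists S j \<Longrightarrow> norm (B vs) \<le> C" "\<And>vs. vs \<in> unit_lists S j \<Longrightarrow> norm (B' vs) \<le> C'"
      using mb unfolding mbounded_def bdd_above_def by auto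
    then have "norm (B vs - B' vs) \<le> C + C'" if "vs \<in> unit_lists S j" for vs
      using that norm_triangle_ineq4[of "B vs" "B' vs"] by (meson add_mono order_trans)
    then show ?thesis unfolding mbounded_def by (intro bdd_aboveI2) blast
  qed
  have slice: "mlin_on S j (\<lambda>vs. D (Suc j) x (h # vs))" "mbounded S j (\<lambda>vs. D (Suc j) x (h # vs))"
    if "Suc j \<le> n" "x \<in> S" "h \<in> S" for j x h
  proof -
    note m = ml[OF that(1,2)]
    show "mlin_on S j (\<lambda>vs. D (Suc j) x (h # vs))"
      unfolding mlin_on_def
    proof (intro allI impI, elim conjE)
      fix vs i u w and a :: real
      assume "length vs = j" "set vs \<subseteq> S" "i < j" "u \<in> S" "w \<in> S"
      then show "D (Suc j) x (h # vs[i := a *\<^sub>R u + w]) = a *\<^sub>R D (Suc j) x (h # vs[i := u]) + D (Suc j) x (h # vs[i := w])"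
        using m(1)[unfolded mlin_on_def, rule_format, of "h # vs" "Suc i" u w a] that by simp
    qed
    have "norm (D (Suc j) x (h # vs)) \<le> mnorm S (Suc j) (D (Suc j) x) * norm h" if "vs \<in> unit_lists S j" for vs
    proof -
      have "norm (D (Suc j) x (h # vs)) \<le> mnorm S (Suc j) (D (Suc j) x) * pnorm (h # vs)"
        using that \<open>h \<in> S\<close> by (intro mnorm_upper[OF S m]) (auto simp: unit_lists_def)
      also have "\<dots> \<le> mnorm S (Suc j) (D (Suc j) x) * norm h"
        using that by (intro mult_left_mono mnorm_nonneg[OF S m(2)]) (auto simp: unit_lists_def intro!: mult_left_le pnorm_le_1)
      finally show ?thesis .
    qed
    then show "mbounded S j (\<lambda>vs. D (Suc j) x (h # vs))"
      unfolding mbounded_def by (intro bdd_aboveI2) blast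
  qed
  have der: "(U j has_derivative mslice (U (Suc j) x)) (at x)" if j: "j < n" for j x
    unfolding has_derivative_at_within[of _ _ x] has_derivative_within
  proof
    define E where "E y vs = D j y vs - D j (P x) vs - D (Suc j) (P x) ((y - P x) # vs)" for y vs
    show "bounded_linear (mslice (U (Suc j) x))" by (rule bounded_linear_mslice_right)
    have Em: "mlin_on S j (E y)" "mbounded S j (E y)" if "y \<in> S" for y
      unfolding E_def[abs_def] using ml[of j] slice[of j "P x" "y - P x"] j P(2) that subspace_diff[OF S]
      by (intro ml_diff mb_diff; simp)+
    have eq: "U j y - U j x - mslice (U (Suc j) x) (y - x) = mpull j P (E (P y))" for y
    proof (rule multilin_eqI)
      fix vs
      show "mapp (U j y - U j x - mslice (U (Suc j) x) (y - x)) vs = mapp (mpull j P (E (P y))) vs"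
        using j by (simp add: mapU mpull(1)[OF S P Em[OF P(2)]] E_def linear_simps[OF P(1)])
    qed
    have bound: "norm (U j y - U j x - mslice (U (Suc j) x) (y - x)) \<le> mnorm S j (E (P y))" for y
      unfolding eq by (rule mpull(2)[OF S P Em[OF P(2)]])
    show "((\<lambda>y. (1 / norm (y - x)) *\<^sub>R (U j y - (U j x + mslice (U (Suc j) x) (y - x)))) \<longlongrightarrow> 0) (at x)"
    proof (rule tendstoI)
      fix e :: real assume e: "0 < e"
      then have "\<forall>\<^sub>F y in at (P x) within S. dist (mnorm S j (E y) / norm (y - P x)) 0 < e"
        using tendstoD[OF Dd[OF j P(2)[of x]]] unfolding E_def by simp
      then obtain d where d: "0 < d" "\<And>y. y \<in> S \<Longrightarrow> y \<noteq> P x \<Longrightarrow> dist y (P x) < d \<Longrightarrow> \<bar>mnorm S j (E y) / norm (y - P x)\<bar> < e"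
        unfolding eventually_at by (auto simp: dist_real_def)
      have "dist ((1 / norm (y - x)) *\<^sub>R (U j y - (U j x + mslice (U (Suc j) x) (y - x)))) 0 < e"
        if y: "y \<noteq> x" "dist y x < d" for y
      proof -
        have Px: "norm (P y - P x) \<le> norm (y - x)" using P(3)[of "y - x"] by (simp add: linear_simps[OF P(1)])
        have ny: "0 < norm (y - x)" using y by simp
        have "norm (U j y - (U j x + mslice (U (Suc j) x) (y - x))) < e * norm (y - x)"
        proof (cases "P y = P x")
          case True
          \<comment> \<open>The limit within S excludes the point P x itself. There the remainder
            reduces to the derivative in direction 0, which vanishes.\<close>
          have "D (Suc j) (P x) (0 # vs) = 0" if "length vs = j" "set vs \<subseteq> S" for vs
            using mlin_on_hom[OF S ml(1)[of "Suc j" "P x"], of "[]" vs 0 0] that j P(2) subspace_0[OF S] by simp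
          then have "mnorm S j (E (P y)) \<le> 0"
            using True by (intro mnorm_le[OF S]) (auto simp: E_def unit_lists_def)
          then show ?thesis using bound[of y] e mult_pos_pos[OF e ny] by (simp add: diff_diff_eq)
        next
          case False
          then have "mnorm S j (E (P y)) < e * norm (P y - P x)"
            using d(2)[OF P(2) False] y Px by (simp add: dist_norm abs_less_iff pos_divide_less_eq)
          also have "\<dots> \<le> e * norm (y - x)" using Px e by simp
          finally show ?thesis using bound[of y] by (simp add: diff_diff_eq)
        qed
        then show ?thesis using ny by (simp add: pos_divide_less_eq)
      qed
      then show "\<forall>\<^sub>F y in at x. dist ((1 / norm (y - x)) *\<^sub>R (U j y - (U j x + mslice (U (Suc j) x) (y - x)))) 0 < e"
        unfolding eventually_at using d(1) by auto
    qed
  qed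
  have Nil: "mapp (U (Suc j) x) [] = 0" if "j < n" for j x using that by (simp add: mapU)
  have U0: "U 0 = emb (\<lambda>x. f (P x))"
    by (intro HOL.ext multilin_eqI) (simp add: mapU mapp_mconst D0 P(2))
  show "mdiff n (emb (\<lambda>x. f (P x)))" using tower_mdiff[of n U, OF der Nil] by (simp add: U0)
  show dkU: "mderivs j (emb (\<lambda>x. f (P x))) x = mpull j P (D j (P x))" if "j \<le> n" for j x
    using tower_mderivs[of n U, OF der Nil that] by (simp add: U0 U_def)
  have "isCont (U n) x" for x
    unfolding isCont_def
  proof (rule tendstoI)
    fix e :: real assume "0 < e"
    define E where "E y vs = D n y vs - D n (P x) vs" for y vs
    have Em: "mlin_on S n (E y)" "mbounded S n (E y)" if "y \<in> S" for y
      unfolding E_def[abs_def] using ml[of n] P(2) that by (intro ml_diff mb_diff; simp)+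
    have eq: "U n y - U n x = mpull n P (E (P y))" for y
      by (rule multilin_eqI) (simp add: mapU mpull(1)[OF S P Em[OF P(2)]] E_def)
    have bound: "norm (U n y - U n x) \<le> mnorm S n (E (P y))" for y
      unfolding eq by (rule mpull(2)[OF S P Em[OF P(2)]])
    have "\<forall>\<^sub>F y in at (P x) within S. dist (mnorm S n (E y)) 0 < e"
      using tendstoD[OF Dc[OF P(2)[of x]]] \<open>0 < e\<close> unfolding E_def by simp
    then obtain d where d: "0 < d" "\<And>y. y \<in> S \<Longrightarrow> y \<noteq> P x \<Longrightarrow> dist y (P x) < d \<Longrightarrow> \<bar>mnorm S n (E y)\<bar> < e"
      unfolding eventually_at by (auto simp: dist_real_def)
    have "dist (U n y) (U n x) < e" if y: "dist y x < d" for y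
    proof (cases "P y = P x")
      case True
      then show ?thesis using \<open>0 < e\<close> by (simp add: U_def)
    next
      case False
      have "dist (P y) (P x) < d" using P(3)[of "y - x"] y by (simp add: linear_simps[OF P(1)] dist_norm)
      then show ?thesis using d(2)[OF P(2) False] bound[of y] by (simp add: dist_norm abs_less_iff)
    qed
    then show "\<forall>\<^sub>F y in at x. dist (U n y) (U n x) < e"
      unfolding eventually_at using d(1) by auto
  qed
  moreover have "mderivs n (emb (\<lambda>x. f (P x))) = U n" using dkU by (auto simp: U_def)
  ultimately show "continuous_on UNIV (mderivs n (emb (\<lambda>x. f (P x))))"
    by (simp add: continuous_on_eq_continuous_at)
qed

lemma small_Cnb_C1b:
  fixes f :: "'a::real_normed_vector \<Rightarrow> 'b::real_normed_vector" and P :: "'a \<Rightarrow> 'a"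
  assumes S: "subspace S" and P: "bounded_linear P" "\<And>x. P x \<in> S" "\<And>x. norm (P x) \<le> norm x"
    and f: "small_Cnb (Suc n) S T f L"
  shows "C1b n L (emb (\<lambda>x. f (P x)))" "f (P 0) = 0" "mderiv (emb (\<lambda>x. f (P x))) 0 = 0"
    and "\<And>j. j \<le> Suc n \<Longrightarrow> \<exists>C. \<forall>x. norm (mderivs j (emb (\<lambda>x. f (P x))) x) \<le> C"
    and "continuous_on UNIV (mderivs (Suc n) (emb (\<lambda>x. f (P x))))"
proof -
  obtain D where D: "Cnb_on (Suc n) S T f D" "f 0 = 0" "\<And>v. v \<in> S \<Longrightarrow> D 1 0 [v] = 0" "\<And>x. x \<in> S \<Longrightarrow> mnorm S 1 (D 1 x) \<le> L"
    using f by (auto simp: small_Cnb_def)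
  then have Cn: "Cn_on (Suc n) S T f D" by (simp add: Cnb_on_def)
  have ml: "mlin_on S j (D j x)" "mbounded S j (D j x)" if "j \<le> Suc n" "x \<in> S" for j x
    using Cn that by (auto simp: Cn_on_def)
  note C = Cn_on_mderivs[OF S P Cn]
  have P0: "P 0 = 0" by (simp add: linear_simps[OF P(1)])
  have d1: "mderiv (emb (\<lambda>x. f (P x))) x = mpull 1 P (D 1 (P x))" for x
    using C(2)[of 1 x] by (simp add: mderivs_Suc)
  have "norm (mpull 1 P (D 1 (P x))) \<le> L" for x
    using mpull(2)[OF S P ml[of 1 "P x"]] P(2)[of x] D(4)[of "P x"] by simp
  then show "C1b n L (emb (\<lambda>x. f (P x)))" using C(1) by (simp add: C1b_def d1)
  show "f (P 0) = 0" using D(2) P0 by simp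
  show "mderiv (emb (\<lambda>x. f (P x))) 0 = 0"
  proof (rule multilin_eqI)
    fix vs
    show "mapp (mderiv (emb (\<lambda>x. f (P x))) 0) vs = mapp 0 vs"
      \<comment> \<open>The nested fact is 1 \<le> Suc n.\<close>
      unfolding d1 mpull(1)[OF S P ml[OF Suc_le_mono[THEN iffD2, OF le0, folded One_nat_def] P(2)]]
      using D(3) P(2) P0 by (auto simp: length_Suc_conv)
  qed
  show "\<exists>C. \<forall>x. norm (mderivs j (emb (\<lambda>x. f (P x))) x) \<le> C" if j: "j \<le> Suc n" for j
  proof -
    have "bdd_above ((\<lambda>x. mnorm S j (D j x)) ` S)" using D(1) j by (auto simp: Cnb_on_def)
    then obtain K where K: "\<And>x. x \<in> S \<Longrightarrow> mnorm S j (D j x) \<le> K"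
      unfolding bdd_above_def by blast
    have "norm (mpull j P (D j (P x))) \<le> K" for x
      using mpull(2)[OF S P ml[OF j P(2)], of x] K[OF P(2), of x] by linarith
    then show ?thesis using C(2)[OF j] by auto
  qed
  show "continuous_on UNIV (mderivs (Suc n) (emb (\<lambda>x. f (P x))))" by (rule C(3))
qed

section \<open>Back from the whole space to derivatives on lists over the subspace\<close>

lemma mlin_on_mapp: "mlin_on S j (mapp w)"
  unfolding mlin_on_def
proof (intro allI impI, elim conjE)
  fix vs :: "'a list" and i u v and a :: real
  assume "length vs = j" "i < j"
  then show "mapp w (vs[i := a *\<^sub>R u + v]) = a *\<^sub>R mapp w (vs[i := u]) + mapp w (vs[i := v])"
    by (simp add: upd_conv_take_nth_drop mapp_lin)
qed

lemma norm_mapp_unit: "vs \<in> unit_lists S j \<Longrightarrow> norm (mapp w vs) \<le> norm w"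
  using norm_mapp[of w vs] mult_left_le[OF pnorm_le_1 norm_ge_zero, of vs w]
  by (force simp: unit_lists_def)

lemma mbounded_mapp: "mbounded S j (mapp w)"
  unfolding mbounded_def by (intro bdd_aboveI2[of _ _ "norm w"] norm_mapp_unit)

lemma mnorm_mapp_le: "subspace S \<Longrightarrow> mnorm S j (mapp w) \<le> norm w"
  by (intro mnorm_le norm_mapp_unit)

lemma Cn_on_of_mderivs:
  fixes f :: "'a::real_normed_vector \<Rightarrow> 'b::real_normed_vector"
  assumes S: "subspace S" and f: "mdiff n (emb f)" "continuous_on UNIV (mderivs n (emb f))" and T: "\<And>x. x \<in> S \<Longrightarrow> f x \<in> T"
  shows "Cn_on n S T f (\<lambda>j x. mapp (mderivs j (emb f) x))"
  unfolding Cn_on_def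
proof (intro conjI ballI allI impI mlin_on_mapp mbounded_mapp)
  let ?U = "\<lambda>j. mderivs j (emb f)"
  fix x assume "x \<in> S"
  show "f x \<in> T" by (rule T[OF \<open>x \<in> S\<close>])
  show "mapp (?U 0 x) [] = f x" by (simp add: mapp_mconst)
  fix j assume j: "j < n"
  have eq: "(\<lambda>vs. mapp (?U j y) vs - mapp (?U j x) vs - mapp (?U (Suc j) x) ((y - x) # vs))
      = mapp (?U j y - ?U j x - mslice (?U (Suc j) x) (y - x))" for y by auto
  have "(?U j has_derivative mslice (?U (Suc j) x)) (at x within S)"
    using has_derivative_at_withinI[OF mdiff_works[OF f(1) j]] .
  then have "((\<lambda>y. norm ((1 / norm (y - x)) *\<^sub>R (?U j y - (?U j x + mslice (?U (Suc j) x) (y - x))))) \<longlongrightarrow> 0) (at x within S)"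
    unfolding has_derivative_within using tendsto_norm_zero by blast
  then show "((\<lambda>y. mnorm S j (\<lambda>vs. mapp (?U j y) vs - mapp (?U j x) vs - mapp (?U (Suc j) x) ((y - x) # vs)) / norm (y - x))
      \<longlongrightarrow> 0) (at x within S)"
    unfolding eq
  proof (rule Lim_null_comparison[rotated])
    have "mnorm S j (mapp w) / norm (y - x) \<le> norm w / norm (y - x)" "0 \<le> mnorm S j (mapp w)" for w :: "('a, 'b) multilin" and y
      using mnorm_mapp_le[OF S, of j w] mnorm_nonneg[OF S mbounded_mapp] by (auto intro: divide_right_mono)
    then show "\<forall>\<^sub>F y in at x within S. norm (mnorm S j (mapp (?U j y - ?U j x - mslice (?U (Suc j) x) (y - x))) / norm (y - x))
        \<le> norm ((1 / norm (y - x)) *\<^sub>R (?U j y - (?U j x + mslice (?U (Suc j) x) (y - x))))"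
      by (intro always_eventually allI) (simp add: diff_diff_eq)
  qed
next
  let ?U = "\<lambda>j. mderivs j (emb f)"
  fix x assume "x \<in> S"
  have eq: "(\<lambda>vs. mapp (?U n y) vs - mapp (?U n x) vs) = mapp (?U n y - ?U n x)" for y by auto
  have "(?U n \<longlongrightarrow> ?U n x) (at x within S)"
    using f(2) continuous_on_subset[OF f(2), of S] \<open>x \<in> S\<close> by (simp add: continuous_on_def)
  then have "((\<lambda>y. norm (?U n y - ?U n x)) \<longlongrightarrow> 0) (at x within S)"
    by (simp add: LIM_zero tendsto_norm_zero)
  then show "((\<lambda>y. mnorm S n (\<lambda>vs. mapp (?U n y) vs - mapp (?U n x) vs)) \<longlongrightarrow> 0) (at x within S)"
    unfolding eq
    by (rule Lim_null_comparison[rotated])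
      (auto intro!: always_eventually mnorm_mapp_le[OF S] simp: mnorm_nonneg[OF S mbounded_mapp])
qed

lemma Cn_on_cong: "(\<And>x. x \<in> S \<Longrightarrow> f x = f' x) \<Longrightarrow> Cn_on n S T f D \<Longrightarrow> Cn_on n S T f' D"
  unfolding Cn_on_def by simp

lemma small_Cnb_of_mderivs:
  fixes f :: "'a::real_normed_vector \<Rightarrow> 'b::real_normed_vector"
  assumes S: "subspace S" and f: "C1b n L (emb f)" "continuous_on UNIV (mderivs (Suc n) (emb f))"
    "\<And>x. x \<in> S \<Longrightarrow> f x \<in> T" "f 0 = 0" "mderiv (emb f) 0 = 0"
    "\<And>j. j \<le> Suc n \<Longrightarrow> \<exists>C. \<forall>x. norm (mderivs j (emb f) x) \<le> C"
  shows "small_Cnb (Suc n) S T f L"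
  unfolding small_Cnb_def Cnb_on_def
proof (intro exI conjI allI impI ballI)
  show "Cn_on (Suc n) S T f (\<lambda>j x. mapp (mderivs j (emb f) x))"
    by (rule Cn_on_of_mderivs[OF S C1b_mdiff[OF f(1)] f(2,3)])
  show "bdd_above ((\<lambda>x. mnorm S j (mapp (mderivs j (emb f) x))) ` S)" if j: "j \<le> Suc n" for j
  proof -
    obtain C where "\<And>x. norm (mderivs j (emb f) x) \<le> C" using f(6)[OF j] by blast
    then have "mnorm S j (mapp (mderivs j (emb f) x)) \<le> C" for x
      using mnorm_mapp_le[OF S] order_trans by blast
    then show ?thesis by (intro bdd_aboveI2)
  qed
  show "mapp (mderivs 1 (emb f) 0) [v] = 0" for v using f(5) by (simp add: mderivs_Suc)
  show "mnorm S 1 (mapp (mderivs 1 (emb f) x)) \<le> L" for x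
    using mnorm_mapp_le[OF S, of 1 "mderiv (emb f) x"] C1b_norm[OF f(1), of x] by (simp add: mderivs_Suc)
qed (use f in auto)

section \<open>The conjugacy\<close>

text \<open>The maximum norm makes the decomposition unique: the difference of two decompositions of
  x represents 0, so the largest norm of its parts is 0. Uniqueness makes the chosen components
  linear, and the same norm formula bounds them by 1.\<close>

lemma direct_sum_projections:
  fixes Xc Xu Xs :: "'a::real_normed_vector set"
  assumes subsp: "subspace Xc" "subspace Xu" "subspace Xs"
    and decomp: "\<forall>x. \<exists>a\<in>Xc. \<exists>b\<in>Xu. \<exists>c\<in>Xs. x = a + b + c"
    and maxnorm: "\<forall>a\<in>Xc. \<forall>b\<in>Xu. \<forall>c\<in>Xs. norm (a + b + c) = max (norm a) (max (norm b) (norm c))"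
  obtains pc pu ps where "\<And>x. pc x \<in> Xc" "\<And>x. pu x \<in> Xu" "\<And>x. ps x \<in> Xs" "\<And>x. x = pc x + pu x + ps x"
    "bounded_linear pc" "bounded_linear pu" "bounded_linear ps"
    "\<And>x. x \<in> Xc \<Longrightarrow> pc x = x \<and> pu x = 0 \<and> ps x = 0"
    "\<And>x. x \<in> Xu \<Longrightarrow> pc x = 0 \<and> pu x = x \<and> ps x = 0"
    "\<And>x. x \<in> Xs \<Longrightarrow> pc x = 0 \<and> pu x = 0 \<and> ps x = x"
    "\<And>x. norm x = max (norm (pc x)) (max (norm (pu x)) (norm (ps x)))"
proof -
  obtain pc pu ps where p: "\<And>x. pc x \<in> Xc" "\<And>x. pu x \<in> Xu" "\<And>x. ps x \<in> Xs" "\<And>x. x = pc x + pu x + ps x"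
    using decomp by metis
  have norm_eq: "norm x = max (norm (pc x)) (max (norm (pu x)) (norm (ps x)))" for x
    using maxnorm p by metis
  have uniq: "pc (a + b + c) = a \<and> pu (a + b + c) = b \<and> ps (a + b + c) = c" if "a \<in> Xc" "b \<in> Xu" "c \<in> Xs" for a b c
  proof -
    let ?x = "a + b + c"
    have "(a - pc ?x) + (b - pu ?x) + (c - ps ?x) = ?x - (pc ?x + pu ?x + ps ?x)" by simp
    also have "\<dots> = 0" using p(4)[of ?x] by simp
    finally have "max (norm (a - pc ?x)) (max (norm (b - pu ?x)) (norm (c - ps ?x))) = 0"
      using maxnorm p that subsp by (metis norm_zero subspace_diff)
    then have "norm (a - pc ?x) \<le> 0" "norm (b - pu ?x) \<le> 0" "norm (c - ps ?x) \<le> 0" by linarith+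
    then show ?thesis by simp
  qed
  have 0: "0 \<in> Xc" "0 \<in> Xu" "0 \<in> Xs" using subsp subspace_0 by auto
  have add: "pc (x + y) = pc x + pc y \<and> pu (x + y) = pu x + pu y \<and> ps (x + y) = ps x + ps y" for x y
  proof -
    have "x + y = (pc x + pc y) + (pu x + pu y) + (ps x + ps y)"
      using p(4)[of x] p(4)[of y] by (metis (no_types, lifting) add.assoc add.left_commute)
    then show ?thesis using uniq[of "pc x + pc y" "pu x + pu y" "ps x + ps y"] p subsp by (simp add: subspace_add)
  qed
  have scale: "pc (c *\<^sub>R x) = c *\<^sub>R pc x \<and> pu (c *\<^sub>R x) = c *\<^sub>R pu x \<and> ps (c *\<^sub>R x) = c *\<^sub>R ps x" for c x
  proof -
    have "c *\<^sub>R x = c *\<^sub>R pc x + c *\<^sub>R pu x + c *\<^sub>R ps x"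
      using p(4)[of x] by (metis scaleR_add_right)
    then show ?thesis using uniq[of "c *\<^sub>R pc x" "c *\<^sub>R pu x" "c *\<^sub>R ps x"] p subsp by (simp add: subspace_scale)
  qed
  have le: "norm (pc x) \<le> norm x * 1" "norm (pu x) \<le> norm x * 1" "norm (ps x) \<le> norm x * 1" for x
    using norm_eq[of x] by linarith+
  show ?thesis
  proof (rule that[OF p])
    show "bounded_linear pc" "bounded_linear pu" "bounded_linear ps"
      using add scale le by (auto intro!: bounded_linear_intro[of _ 1])
    show "pc x = x \<and> pu x = 0 \<and> ps x = 0" if "x \<in> Xc" for x using uniq[of x 0 0] 0 that by simp
    show "pc x = 0 \<and> pu x = x \<and> ps x = 0" if "x \<in> Xu" for x using uniq[of 0 x 0] 0 that by simp
    show "pc x = 0 \<and> pu x = 0 \<and> ps x = x" if "x \<in> Xs" for x using uniq[of 0 0 x] 0 that by simp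
  qed (rule norm_eq)
qed

text \<open>The constants solve the linear equations behind \<open>admissible_step\<close>;
  multiplying by the denominators, positive by smallness, recovers these. That lu and ls do not
  exceed 1 + Lc is a consequence of theta2 and theta3 at order 1.\<close>

lemma constants:
  fixes ac aci aui as Lg Lc :: real
  assumes nn: "0 \<le> ac" "0 \<le> aci" "0 \<le> aui" "0 \<le> as" "0 \<le> Lg" "0 \<le> Lc"
    and sm: "smallness (Suc n) ac aci aui as Lg Lc"
  defines "lr \<equiv> cLr ac Lg Lc" and "lt \<equiv> cLt ac aci Lg Lc" and "lu \<equiv> cLu ac aui Lg Lc"
    and "ls \<equiv> cLs ac aci as Lg Lc" and "a \<equiv> cLm1 ac aci Lg Lc"
  shows "0 \<le> lr" "0 \<le> lt" "0 \<le> lu" "0 \<le> ls" "0 \<le> a"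
    "aci * lr < 1" "a * (1 - aci * lr) = aci" "a = aci + lt"
    "lr = ac * Lc + Lg * (1 + Lc) + Lc * (ac + lr)"
    "lu = aui * (lu * (ac + lr) + Lg * (1 + Lc))"
    "ls = (as * ls + Lg * (1 + Lc)) * a"
    "lu \<le> 1 + Lc" "ls \<le> 1 + Lc" "Lg + Lc < 1"
    "\<And>j. j \<le> Suc n \<Longrightarrow> aui * ((ac + lr) ^ j + Lg + lu) < 1"
    "\<And>j. j \<le> Suc n \<Longrightarrow> a ^ j * (as * (1 + a * ls) + Lg * (1 + a * (1 + Lc))) < 1"
proof -
  have s: "Lc < 1" "lr * aci < 1" "lr * aui + ac * aui < 1" "lr * aci + as * aci < 1"
    using sm by (auto simp: smallness_def lr_def)
  show "Lg + Lc < 1" using sm by (auto simp: smallness_def theta1_def)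
  show t2: "aui * ((ac + lr) ^ j + Lg + lu) < 1" if "j \<le> Suc n" for j
    using sm that by (auto simp: smallness_def theta2_def lr_def lu_def)
  show t3: "a ^ j * (as * (1 + a * ls) + Lg * (1 + a * (1 + Lc))) < 1" if "j \<le> Suc n" for j
    using sm that by (auto simp: smallness_def theta3_def a_def ls_def)
  have lr: "lr = (Lg + Lc * (2 * ac + Lg)) / (1 - Lc)" by (simp add: lr_def cLr_def)
  show lr0: "0 \<le> lr" using nn s by (simp add: lr)
  have "lr * (1 - Lc) = Lg + Lc * (2 * ac + Lg)" using s by (simp add: lr)
  then show "lr = ac * Lc + Lg * (1 + Lc) + Lc * (ac + lr)" by (simp add: algebra_simps)
  show q: "aci * lr < 1" using s by (simp add: mult.commute)
  have lt: "lt = aci\<^sup>2 * lr / (1 - aci * lr)" by (simp add: lt_def cLt_def lr_def)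
  show lt0: "0 \<le> lt" using q lr0 by (simp add: lt)
  show at: "a = aci + lt" by (simp add: a_def cLm1_def lt_def)
  then show a0: "0 \<le> a" using lt0 nn by simp
  have "lt * (1 - aci * lr) = aci\<^sup>2 * lr" using q by (simp add: lt)
  then show a_eq: "a * (1 - aci * lr) = aci" unfolding at by (simp add: algebra_simps power2_eq_square)
  have du: "0 < 1 - lr * aui - ac * aui" using s by simp
  have lu: "lu = aui * (1 + Lc) * Lg / (1 - lr * aui - ac * aui)" by (simp add: lu_def cLu_def lr_def)
  show lu0: "0 \<le> lu" using du nn by (simp add: lu)
  have lu_m: "lu * (1 - lr * aui - ac * aui) = aui * (1 + Lc) * Lg" using du by (simp add: lu)
  then show "lu = aui * (lu * (ac + lr) + Lg * (1 + Lc))" by (simp add: algebra_simps)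
  have ds: "0 < 1 - lr * aci - as * aci" using s by simp
  have ls: "ls = aci * (1 + Lc) * Lg / (1 - lr * aci - as * aci)" by (simp add: ls_def cLs_def lr_def)
  show ls0: "0 \<le> ls" using ds nn by (simp add: ls)
  have ls_m: "ls * (1 - lr * aci - as * aci) = aci * (1 + Lc) * Lg" using ds by (simp add: ls)
  \<comment> \<open>The definition of ls features aci, its equation a; the factor 1 - aci lr
    converts a into aci by \<open>a_eq\<close>.\<close>
  have "ls * (1 - aci * lr) = (as * ls + Lg * (1 + Lc)) * a * (1 - aci * lr)"
    using ls_m unfolding mult.assoc[of _ a] a_eq by (simp add: algebra_simps)
  then show "ls = (as * ls + Lg * (1 + Lc)) * a" using q by simp
  \<comment> \<open>Order 1 of theta2, with the term lu dropped, says that aui Lg is at most the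
    denominator of lu.\<close>
  have "aui * (ac + lr + Lg) \<le> aui * ((ac + lr) ^ 1 + Lg + lu)" using nn lu0 by (intro mult_left_mono) auto
  also have "\<dots> < 1" using t2[of 1] by simp
  finally have "aui * Lg \<le> 1 - lr * aui - ac * aui" by (simp add: algebra_simps)
  then have "(1 + Lc) * (aui * Lg) \<le> (1 + Lc) * (1 - lr * aui - ac * aui)" using nn by (intro mult_left_mono) auto
  then show "lu \<le> 1 + Lc" unfolding lu using du by (simp add: pos_divide_le_eq mult_ac)
  \<comment> \<open>Order 1 of theta3, with the terms in ls and 1 + Lc dropped, gives a (as + Lg) <
    1; multiplying by 1 - aci lr replaces a by aci.\<close>
  have "a * (as + Lg) \<le> a ^ 1 * (as * (1 + a * ls) + Lg * (1 + a * (1 + Lc)))"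
    using nn a0 ls0 by (simp add: mult_left_mono distrib_left add_mono)
  also have "\<dots> < 1" using t3[of 1] by simp
  finally have "a * (as + Lg) * (1 - aci * lr) \<le> 1 - aci * lr" using q
    by (simp add: mult_left_le_one_le nn a0)
  moreover have "aci * (as + Lg) = a * (1 - aci * lr) * (as + Lg)" by (simp add: a_eq)
  ultimately have "aci * (as + Lg) \<le> 1 - aci * lr" by (simp only: mult_ac)
  then have "aci * Lg \<le> 1 - lr * aci - as * aci" by (simp add: algebra_simps)
  then have "(1 + Lc) * (aci * Lg) \<le> (1 + Lc) * (1 - lr * aci - as * aci)" using nn by (intro mult_left_mono) auto
  then show "ls \<le> 1 + Lc" unfolding ls using ds by (simp add: pos_divide_le_eq mult_ac)
qed

theorem theorem2p1:
  fixes n :: nat and Xc Xu Xs :: "'a::banach set" and A g kc :: "'a \<Rightarrow> 'a"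
    and Lg Lc :: real
  assumes n2: "n \<ge> 2"
    and subsp: "subspace Xc" "subspace Xu" "subspace Xs"
    and clsd: "closed Xc" "closed Xu" "closed Xs"
    and decomp: "\<forall>x. \<exists>a\<in>Xc. \<exists>b\<in>Xu. \<exists>c\<in>Xs. x = a + b + c"
    and maxnorm: "\<forall>a\<in>Xc. \<forall>b\<in>Xu. \<forall>c\<in>Xs. norm (a + b + c) = max (norm a) (max (norm b) (norm c))"
    and A_lin: "bounded_linear A"
    and A_inv: "A ` Xc \<subseteq> Xc" "A ` Xu \<subseteq> Xu" "A ` Xs \<subseteq> Xs"
    and Ac_bij: "bij_betw A Xc Xc" and Au_bij: "bij_betw A Xu Xu"
    and spec1: "\<forall>m. 1 \<le> m \<and> m \<le> n \<longrightarrow>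
                 onorm_on Xc (inv_into Xc A) ^ m * onorm_on Xs A < 1"
    and spec2: "\<forall>m. 1 \<le> m \<and> m \<le> n \<longrightarrow>
                 onorm_on Xu (inv_into Xu A) * onorm_on Xc A ^ m < 1"
    and Lg0: "Lg \<ge> 0" and Lc0: "Lc \<ge> 0"
    and g: "small_Cnb n UNIV UNIV g Lg"
    and kc: "small_Cnb n Xc Xc kc Lc"
    and small: "smallness n (onorm_on Xc A) (onorm_on Xc (inv_into Xc A))
                  (onorm_on Xu (inv_into Xu A)) (onorm_on Xs A) Lg Lc"
  shows "\<exists>r t ku ks.
     (let ac = onorm_on Xc A; aci = onorm_on Xc (inv_into Xc A);
          aui = onorm_on Xu (inv_into Xu A); as = onorm_on Xs A;
          R = (\<lambda>x. A x + r x);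
          T = (\<lambda>x. inv_into Xc A x + t x);
          K = (\<lambda>x. (x + kc x) + ku x + ks x)
      in (\<exists>DK. Cn_on n Xc UNIV K DK) \<and> (\<exists>DR. Cn_on n Xc Xc R DR) \<and>
         (\<forall>x\<in>Xc. A (K x) + g (K x) = K (R x)) \<and>
         small_Cnb n Xc Xc r (cLr ac Lg Lc) \<and>
         small_Cnb n Xc Xc t (cLt ac aci Lg Lc) \<and>
         (\<forall>x\<in>Xc. T (R x) = x \<and> R (T x) = x) \<and>
         small_Cnb n Xc Xu ku (cLu ac aui Lg Lc) \<and>
         small_Cnb n Xc Xs ks (cLs ac aci as Lg Lc))"
proof -
  obtain N where n: "n = Suc N" using n2 by (cases n) auto
  obtain pc pu ps where pm: "\<And>x. pc x \<in> Xc" "\<And>x. pu x \<in> Xu" "\<And>x. ps x \<in> Xs" "\<And>x. x = pc x + pu x + ps x"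
    and pl: "bounded_linear pc" "bounded_linear pu" "bounded_linear ps"
    and pX: "\<And>x. x \<in> Xc \<Longrightarrow> pc x = x \<and> pu x = 0 \<and> ps x = 0"
      "\<And>x. x \<in> Xu \<Longrightarrow> pc x = 0 \<and> pu x = x \<and> ps x = 0"
      "\<And>x. x \<in> Xs \<Longrightarrow> pc x = 0 \<and> pu x = 0 \<and> ps x = x"
    and pn: "\<And>x. norm x = max (norm (pc x)) (max (norm (pu x)) (norm (ps x)))"
    using direct_sum_projections[OF subsp decomp maxnorm] by blast
  have ple: "norm (pc x) \<le> norm x" "norm (pu x) \<le> norm x" "norm (ps x) \<le> norm x" for x
    using pn[of x] by linarith+
  define Ic where "Ic = inv_into Xc A"
  define Iu where "Iu = inv_into Xu A"
  define ac where "ac = onorm_on Xc A"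
  define aci where "aci = onorm_on Xc Ic"
  define aui where "aui = onorm_on Xu Iu"
  define as where "as = onorm_on Xs A"
  obtain KA where KA: "\<And>x. norm (A x) \<le> KA * norm x"
    using bounded_linear.bounded[OF A_lin] by (auto simp: mult.commute)
  have Alin: "A (c *\<^sub>R x + y) = c *\<^sub>R A x + A y" for c x y by (simp add: linear_simps[OF A_lin])
  note ocA = onorm_on_bound[of Xc A KA, OF subsp(1) Alin KA, folded ac_def]
  note osA = onorm_on_bound[of Xs A KA, OF subsp(3) Alin KA, folded as_def]
  \<comment> \<open>The size of these bounds does not matter: their existence turns
    \<open>onorm_on\<close> of the inverses into actual bounds.\<close>
  obtain Ki Ku where Ki: "\<And>x. x \<in> Xc \<Longrightarrow> norm (Ic x) \<le> Ki * norm x" and Ku: "\<And>x. x \<in> Xu \<Longrightarrow> norm (Iu x) \<le> Ku * norm x"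
    using bounded_inverse_on(1)[OF subsp(1) clsd(1) A_lin Ac_bij] bounded_inverse_on(1)[OF subsp(2) clsd(2) A_lin Au_bij]
    unfolding Ic_def Iu_def by blast
  note Iclin = bounded_inverse_on(2)[OF subsp(1) clsd(1) A_lin Ac_bij, folded Ic_def]
  note Iulin = bounded_inverse_on(2)[OF subsp(2) clsd(2) A_lin Au_bij, folded Iu_def]
  have ocI: "\<And>x. x \<in> Xc \<Longrightarrow> norm (Ic x) \<le> aci * norm x" "0 \<le> aci"
    using onorm_on_bound[of Xc Ic Ki, OF subsp(1)] Iclin Ki unfolding aci_def by blast+
  have ouI: "\<And>x. x \<in> Xu \<Longrightarrow> norm (Iu x) \<le> aui * norm x" "0 \<le> aui"
    using onorm_on_bound[of Xu Iu Ku, OF subsp(2)] Iulin Ku unfolding aui_def by blast+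
  have AI: "A (Ic x) = x" "Ic x \<in> Xc" "Ic (A x) = x" "A x \<in> Xc" if "x \<in> Xc" for x
    using that Ac_bij A_inv(1) unfolding Ic_def
    by (auto simp: bij_betw_inv_into_right bij_betw_inv_into_left inv_into_into[of x A Xc] bij_betw_def)
  have AU: "A (Iu x) = x" "Iu x \<in> Xu" if "x \<in> Xu" for x
    using that Au_bij unfolding Iu_def
    by (auto simp: bij_betw_inv_into_right inv_into_into[of x A Xu] bij_betw_def)
  have bl: "bounded_linear (\<lambda>x. L (p x))"
    if p: "bounded_linear p" "\<And>x. p x \<in> X" "\<And>x. norm (p x) \<le> norm x"
      and L: "\<And>x y c. x \<in> X \<Longrightarrow> y \<in> X \<Longrightarrow> L (c *\<^sub>R x + y) = c *\<^sub>R L x + L y" "\<And>x. x \<in> X \<Longrightarrow> norm (L x) \<le> l * norm x" "0 \<le> l"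
      and X: "subspace X"
    for L p :: "'a \<Rightarrow> 'a" and X l
  proof (rule bounded_linear_intro[of _ l])
    have L0: "L 0 = 0" using L(1)[of 0 0 1] subspace_0[OF X] by simp
    show "L (p (x + y)) = L (p x) + L (p y)" for x y
      using L(1)[OF p(2)[of x] p(2)[of y], of 1] by (simp add: linear_simps[OF p(1)])
    show "L (p (c *\<^sub>R x)) = c *\<^sub>R L (p x)" for c x
      using L(1)[OF p(2)[of x] subspace_0[OF X], of c] by (simp add: linear_simps[OF p(1)] L0)
    show "norm (L (p x)) \<le> norm x * l" for x
      using L(2)[OF p(2)] mult_left_mono[OF p(3) L(3), of x] order_trans by (metis mult.commute)
  qed
  have nb: "norm (L (p x)) \<le> l * norm x"
    if "\<And>x. p x \<in> X" "\<And>x. norm (p x) \<le> norm x" "\<And>x. x \<in> X \<Longrightarrow> norm (L x) \<le> l * norm x" "0 \<le> l"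
    for L p :: "'a \<Rightarrow> 'a" and X l x
    using that(3)[OF that(1)] mult_left_mono[OF that(2,4), of x] order_trans by metis
  note sc = small_Cnb_C1b[OF subspace_UNIV bounded_linear_ident _ order_refl g[unfolded n], simplified]
  note sk = small_Cnb_C1b[OF subsp(1) pl(1) pm(1) ple(1) kc[unfolded n]]
  have kmem: "kc x \<in> Xc" if "x \<in> Xc" for x
    using kc that by (auto simp: small_Cnb_def Cnb_on_def Cn_on_def)
  have small': "smallness (Suc N) ac aci aui as Lg Lc"
    using small n by (simp add: ac_def aci_def aui_def as_def Ic_def Iu_def)
  note cs = constants[OF ocA(2) ocI(2) ouI(2) osA(2) Lg0 Lc0 small']
  have psX: "A (ps x) \<in> Xs" for x using A_inv(3) pm(3) by auto
  interpret cm_setting N pc pu ps "\<lambda>x. A (pc x)" "\<lambda>x. Ic (pc x)" "\<lambda>x. Iu (pu x)" "\<lambda>x. A (ps x)" g "\<lambda>x. kc (pc x)"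
    ac aci aui as Lg Lc "cLr ac Lg Lc" "cLt ac aci Lg Lc" "cLu ac aui Lg Lc" "cLs ac aci as Lg Lc" "cLm1 ac aci Lg Lc"
  proof (intro cm_setting.intro)
    show "bounded_linear (\<lambda>x. A (pc x))" "bounded_linear (\<lambda>x. A (ps x))"
      by (rule bounded_linear_compose[OF A_lin pl(1)] bounded_linear_compose[OF A_lin pl(3)])+
    show "bounded_linear (\<lambda>x. Ic (pc x))" by (rule bl[OF pl(1) pm(1) ple(1) Iclin ocI subsp(1)])
    show "bounded_linear (\<lambda>x. Iu (pu x))" by (rule bl[OF pl(2) pm(2) ple(2) Iulin ouI subsp(2)])
    show "norm (A (pc x)) \<le> ac * norm x" for x by (rule nb[OF pm(1) ple(1) ocA])
    show "norm (Ic (pc x)) \<le> aci * norm x" for x by (rule nb[OF pm(1) ple(1) ocI])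
    show "norm (Iu (pu x)) \<le> aui * norm x" for x by (rule nb[OF pm(2) ple(2) ouI])
    show "norm (A (ps x)) \<le> as * norm x" for x by (rule nb[OF pm(3) ple(3) osA])
    show "norm x \<le> max (norm (pc x)) (max (norm (pu x)) (norm (ps x)))" for x using pn[of x] by simp
    show "mderiv (emb (\<lambda>x. kc (pc x))) 0 = 0" by (rule sk(3))
    show "mderiv (emb g) 0 = 0" by (rule sc(3))
    show "\<exists>C. \<forall>x. norm (mderivs j (emb g) x) \<le> C" if "j \<le> Suc N" for j by (rule sc(4)[OF that])
    show "\<exists>C. \<forall>x. norm (mderivs j (emb (\<lambda>x. kc (pc x))) x) \<le> C" if "j \<le> Suc N" for j by (rule sk(4)[OF that])
  qed (use pl ple pm pX AI AU psX kmem cs ocA(2) ocI(2) ouI(2) osA(2) Lg0 Lc0 sc(1,2,5) sk(1,2,5) in auto)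
  note sol = limit_solution
  note G = goodD[OF sol(1)]
  let ?r = rlim and ?t = tlim and ?u = ulim and ?s = slim
  have mem: "?r x \<in> Xc" "?t x \<in> Xc" "?u x \<in> Xu" "?s x \<in> Xs" for x
    using pm(1)[of "?r x"] pm(1)[of "?t x"] pm(2)[of "?u x"] pm(3)[of "?s x"] G by simp_all
  have Rf: "Rf ?r x = A x + ?r x" and Tf: "Tf ?t x = Ic x + ?t x" and Kf: "Kf ?u ?s x = (x + kc x) + ?u x + ?s x"
    if "x \<in> Xc" for x using pX(1)[OF that] by (simp_all add: Rf_def Tf_def Kf_def)
  have Rmem: "Rf ?r x \<in> Xc" and Tmem: "Tf ?t x \<in> Xc" for x
    using mem AI pm(1) subsp(1) by (simp_all add: Rf_def Tf_def subspace_add)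
  \<comment> \<open>Applying A to the equation for t gives A t = - r T, that is, R T = id on the
    centre space.\<close>
  have RT: "Rf ?r (Tf ?t x) = x" if x: "x \<in> Xc" for x
  proof -
    have "?t x = - Ic (pc (?r (Tf ?t x)))" using fun_cong[OF sol(8), of x] by (simp only: nt_def)
    then have "A (?t x) = A (- Ic (pc (?r (Tf ?t x))))" by (rule arg_cong)
    also have "\<dots> = - ?r (Tf ?t x)"
      using AI(1)[OF mem(1)] pX(1)[OF mem(1)] by (simp add: linear_simps[OF A_lin])
    finally have "A (Tf ?t x) = x - ?r (Tf ?t x)"
      using AI(1)[OF x] Tf[OF x] by (simp add: linear_simps(1)[OF A_lin])
    then show ?thesis by (simp add: Rf[OF Tmem])
  qed
  \<comment> \<open>The inverse of A turns r into a map with Lipschitz constant aci lr < 1, so R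
    cannot identify two points.\<close>
  have inj: "x = y" if "x \<in> Xc" "y \<in> Xc" "Rf ?r x = Rf ?r y" for x y
  proof -
    have xy: "x - y \<in> Xc" "?r y - ?r x \<in> Xc" using that mem subspace_diff[OF subsp(1)] by auto
    have "A x + ?r x = A y + ?r y" using that(3) unfolding Rf[OF that(1)] Rf[OF that(2)] .
    then have "A (x - y) = ?r y - ?r x"
      by (simp add: linear_simps(2)[OF A_lin] algebra_simps)
    then have "x - y = Ic (?r y - ?r x)" using AI(3)[OF xy(1)] by simp
    then have "norm (x - y) \<le> aci * norm (?r y - ?r x)" using ocI(1)[OF xy(2)] by simp
    also have "\<dots> \<le> aci * (cLr ac Lg Lc * norm (y - x))"
      by (intro mult_left_mono C1b_lip[OF G(1)] ocI(2))
    finally have "(1 - aci * cLr ac Lg Lc) * norm (x - y) \<le> 0" by (simp add: algebra_simps norm_minus_commute)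
    then show ?thesis using cs(6) by (simp add: mult_le_0_iff)
  qed
  \<comment> \<open>R T = id at the point R x says that T (R x) and x have the same image under
    R.\<close>
  have TR: "Tf ?t (Rf ?r x) = x" if "x \<in> Xc" for x
    by (rule inj[OF Tmem that RT[OF Rmem]])
  have conj: "A (Kf ?u ?s x) + g (Kf ?u ?s x) = Kf ?u ?s (Rf ?r x)" if x: "x \<in> Xc" for x
  proof -
    let ?K = "Kf ?u ?s x"
    have r: "?r x = A (kc x) + pc (g ?K) - kc (Rf ?r x)"
      using fun_cong[OF sol(7), of x] pX(1)[OF x] pX(1)[OF Rmem] pX(1)[OF kmem[OF x]] by (simp add: nr_def)
    have u: "?u x = Iu (?u (Rf ?r x)) - Iu (pu (g ?K))"
      using fun_cong[OF sol(9), of x] pX(2)[OF mem(3)] by (simp add: nu_def)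
    have Au: "A (?u x) = ?u (Rf ?r x) - pu (g ?K)"
      by (subst u) (simp add: linear_simps[OF A_lin] AU mem pm)
    \<comment> \<open>The equation for s at the point R x, where T (R x) = x, is the stable
      component of the conjugacy.\<close>
    have s: "?s (Rf ?r x) = A (?s x) + ps (g ?K)"
      using fun_cong[OF sol(10), of "Rf ?r x"] TR[OF x] pX(3)[OF mem(4)] by (simp add: ns_def)
    have "A ?K + g ?K = (A x + A (kc x) + pc (g ?K)) + (A (?u x) + pu (g ?K)) + (A (?s x) + ps (g ?K))"
      using pm(4)[of "g ?K"] by (simp add: Kf[OF x] linear_simps[OF A_lin])
    also have "A x + A (kc x) + pc (g ?K) = Rf ?r x + kc (Rf ?r x)"
    proof -
      have "A (kc x) + pc (g ?K) = ?r x + kc (Rf ?r x)" using r by (simp add: algebra_simps)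
      then have "A x + A (kc x) + pc (g ?K) = A x + (?r x + kc (Rf ?r x))" by (simp only: add.assoc)
      then show ?thesis by (simp only: Rf[OF x] add.assoc)
    qed
    finally show ?thesis by (simp add: Kf[OF Rmem] Au s)
  qed
  have cont_add: "continuous_on UNIV (mderivs (Suc N) (\<lambda>x. v x + w x))"
    if "mdiff (Suc N) v" "mdiff (Suc N) w" "continuous_on UNIV (mderivs (Suc N) v)" "continuous_on UNIV (mderivs (Suc N) w)"
    for v w :: "'a \<Rightarrow> ('a, 'a) multilin"
    using that by (simp add: mderivs_add continuous_on_add)
  have cont_lin: "continuous_on UNIV (mderivs (Suc N) (emb L))" if "bounded_linear L" for L :: "'a \<Rightarrow> 'a"
    using linear_mderivs(2)[OF that, of N] by (metis continuous_on_cong continuous_on_const)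
  note CCl = linear_mderivs(1)[where k="Suc N"]
  have "continuous_on UNIV (mderivs (Suc N) (emb (Kf ?u ?s)))"
    unfolding emb_Kf
    by (intro cont_add mdiff_add CCl[OF pl(1)] C1b_mdiff[OF G(3)] C1b_mdiff[OF G(4)] C1b_mdiff[OF kC(1)] cont_lin pl(1) kcont sol(5,6))
  then have CK: "Cn_on (Suc N) Xc UNIV (Kf ?u ?s) (\<lambda>j x. mapp (mderivs j (emb (Kf ?u ?s)) x))"
    by (intro Cn_on_of_mderivs subsp(1) C1b_mdiff[OF C1b_K[OF sol(1)]]) auto
  have "continuous_on UNIV (mderivs (Suc N) (emb (Rf ?r)))"
    unfolding emb_Rf by (intro cont_add CCl C1b_mdiff[OF G(1)] cont_lin lin(4) sol(3))
  then have CR: "Cn_on (Suc N) Xc Xc (Rf ?r) (\<lambda>j x. mapp (mderivs j (emb (Rf ?r)) x))"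
    by (intro Cn_on_of_mderivs subsp(1) C1b_mdiff[OF C1b_R[OF G(1)]] Rmem)
  have sm: "small_Cnb n Xc Xc ?r (cLr ac Lg Lc)" "small_Cnb n Xc Xc ?t (cLt ac aci Lg Lc)"
    "small_Cnb n Xc Xu ?u (cLu ac aui Lg Lc)" "small_Cnb n Xc Xs ?s (cLs ac aci as Lg Lc)"
    unfolding n using sol(2) unfolding bounded_deriv_def
    by (intro small_Cnb_of_mderivs subsp(1) G mem sol; simp)+
  have K: "\<exists>DK. Cn_on n Xc UNIV (\<lambda>x. (x + kc x) + ?u x + ?s x) DK"
    unfolding n using Cn_on_cong[OF Kf CK] by blast
  have R: "\<exists>DR. Cn_on n Xc Xc (\<lambda>x. A x + ?r x) DR"
    unfolding n using Cn_on_cong[OF Rf CR] by blast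
  have "(\<forall>x\<in>Xc. A ((x + kc x) + ?u x + ?s x) + g ((x + kc x) + ?u x + ?s x) =
      ((A x + ?r x) + kc (A x + ?r x)) + ?u (A x + ?r x) + ?s (A x + ?r x))"
    using conj Kf Rf Kf[OF Rmem] by (metis (no_types))
  moreover have "\<forall>x\<in>Xc. Ic (A x + ?r x) + ?t (A x + ?r x) = x \<and> A (Ic x + ?t x) + ?r (Ic x + ?t x) = x"
    using TR RT Tf Rf Tf[OF Rmem] Rf[OF Tmem] by metis
  ultimately show ?thesis
    using K R sm unfolding Let_def ac_def aci_def aui_def as_def Ic_def Iu_def by blast
qed

end
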